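(* There exist absolute constants $c_1,c_2>0$ such that the following holds for every $n\geq 1$. Let $K\subseteq\mathbb{R}^n$ be a centered convex body of volume one. Then, for every $0<\vartheta<1$, $$ d_\ast(K,\vartheta)\geq \min\left\{n,\; n\max\left\{0,\ln\left(\frac{c_1\sqrt n}{\vartheta\, w(K)}\right)\right\}\right\}. $$ In particular, $d_\ast(K,\vartheta)=n$ whenever $$ \vartheta\leq c_2\frac{\sqrt n}{w(K)}. $$
   Context: A convex body in $\mathbb{R}^n$ is a compact convex set with nonempty interior; it is centered if its barycenter is the origin. The support function is $h_K(x)=\sup_{y\in K}\langle x,y\rangle$. $\sigma$ is the rotationally invariant probability measure on the Euclidean unit sphere $S^{n-1}$, and $w(K)=\int_{S^{n-1}}h_K(\theta)\,d\sigma(\theta)$. For $0<\vartheta<1$, $$ d_\ast(K,\vartheta)=\min\left\{-\ln\sigma\{\theta\in S^{n-1}:h_K(\theta)\leq\vartheta w(K)\},\; n\right\}, $$ with $-\ln 0=+\infty$. Absolute constants do not depend on $n$, $K$ or $\vartheta$. *)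

theory Defs
  imports "HOL-Probability.Probability"
begin

(* The constants of the theorem must not depend on the dimension n, so n has to be a term and not
   a type. R^n is therefore the carrier {..<n} \<rightarrow>\<^sub>E UNIV of extensional functions, which is both the
   topspace of powertop_real {..<n} and the space of the product measure below; vector operations
   on it restrict their result to {..<n}. *)

abbreviation Rn :: "nat \<Rightarrow> (nat \<Rightarrow> real) set" where
  "Rn n \<equiv> {..<n} \<rightarrow>\<^sub>E UNIV"

abbreviation lborel_n :: "nat \<Rightarrow> (nat \<Rightarrow> real) measure" where
  "lborel_n n \<equiv> Pi\<^sub>M {..<n} (\<lambda>_. lborel)"

definition inner_n :: "nat \<Rightarrow> (nat \<Rightarrow> real) \<Rightarrow> (nat \<Rightarrow> real) \<Rightarrow> real" where
  "inner_n n x y = (\<Sum>i<n. x i * y i)"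

definition sphere_n :: "nat \<Rightarrow> (nat \<Rightarrow> real) set" where
  "sphere_n n = {x \<in> Rn n. inner_n n x x = 1}"

definition convex_n :: "nat \<Rightarrow> (nat \<Rightarrow> real) set \<Rightarrow> bool" where
  "convex_n n K \<longleftrightarrow> (\<forall>x\<in>K. \<forall>y\<in>K. \<forall>u\<ge>0. \<forall>v\<ge>0. u + v = 1 \<longrightarrow>
     (\<lambda>i\<in>{..<n}. u * x i + v * y i) \<in> K)"

definition convex_body :: "nat \<Rightarrow> (nat \<Rightarrow> real) set \<Rightarrow> bool" where
  "convex_body n K \<longleftrightarrow>
     compactin (powertop_real {..<n}) K \<and> convex_n n K \<and> powertop_real {..<n} interior_of K \<noteq> {}"

definition volume_n :: "nat \<Rightarrow> (nat \<Rightarrow> real) set \<Rightarrow> real" where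
  "volume_n n K = measure (lborel_n n) K"

definition barycenter :: "nat \<Rightarrow> (nat \<Rightarrow> real) set \<Rightarrow> nat \<Rightarrow> real" where
  "barycenter n K = (\<lambda>i\<in>{..<n}. (LINT x:K|lborel_n n. x i) / volume_n n K)"

definition centered :: "nat \<Rightarrow> (nat \<Rightarrow> real) set \<Rightarrow> bool" where
  "centered n K \<longleftrightarrow> barycenter n K = (\<lambda>i\<in>{..<n}. 0)"

definition support_fun :: "nat \<Rightarrow> (nat \<Rightarrow> real) set \<Rightarrow> (nat \<Rightarrow> real) \<Rightarrow> real" where
  "support_fun n K x = (SUP y\<in>K. inner_n n x y)"

definition mat_vec :: "nat \<Rightarrow> (nat \<Rightarrow> nat \<Rightarrow> real) \<Rightarrow> (nat \<Rightarrow> real) \<Rightarrow> nat \<Rightarrow> real" where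
  "mat_vec n U x = (\<lambda>i\<in>{..<n}. \<Sum>j<n. U i j * x j)"

definition orthogonal_mat :: "nat \<Rightarrow> (nat \<Rightarrow> nat \<Rightarrow> real) \<Rightarrow> bool" where
  "orthogonal_mat n U \<longleftrightarrow>
     (\<forall>i<n. \<forall>j<n. (\<Sum>k<n. U k i * U k j) = (if i = j then 1 else 0))"

(* Invariance is under all of O(n). For n \<ge> 2 this determines the same measure as invariance
   under SO(n); for n = 1 it gives mass 1/2 to each of the two points of the sphere. *)
definition rotation_invariant_prob :: "nat \<Rightarrow> (nat \<Rightarrow> real) measure \<Rightarrow> bool" where
  "rotation_invariant_prob n \<sigma> \<longleftrightarrow>
     prob_space \<sigma> \<and>
     space \<sigma> = sphere_n n \<and>
     sets \<sigma> = sets (restrict_space (lborel_n n) (sphere_n n)) \<and>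
     (\<forall>U. orthogonal_mat n U \<longrightarrow> distr \<sigma> \<sigma> (mat_vec n U) = \<sigma>)"

definition mean_support :: "nat \<Rightarrow> (nat \<Rightarrow> real) measure \<Rightarrow> (nat \<Rightarrow> real) set \<Rightarrow> real" where
  "mean_support n \<sigma> K = (LINT \<theta>|\<sigma>. support_fun n K \<theta>)"

definition neg_ln :: "real \<Rightarrow> ereal" where
  "neg_ln p = (if p = 0 then \<infinity> else ereal (- ln p))"

definition d_star :: "nat \<Rightarrow> (nat \<Rightarrow> real) measure \<Rightarrow> (nat \<Rightarrow> real) set \<Rightarrow> real \<Rightarrow> ereal" where
  "d_star n \<sigma> K t =
     min (neg_ln (measure \<sigma> {\<theta> \<in> sphere_n n. support_fun n K \<theta> \<le> t * mean_support n \<sigma> K}))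
         (ereal (real n))"

end

theory Submission
  imports Defs
begin

text \<open>
  Put \<open>h\<close> for the support function of \<open>K\<close>. Up to a factor \<open>C ^ n\<close>, the
  Blaschke-Santalo inequality says that the integral of \<open>exp (- h)\<close> over \<open>R^n\<close> is at most
  \<open>C ^ n\<close> when \<open>K\<close> is centered of volume one. On the cone over
  \<open>{h \<le> s} \<subseteq> S^(n-1)\<close>, cut off at radius \<open>n / s\<close>, the integrand is at least
  \<open>exp (- n)\<close>, and the ball of radius \<open>n / s\<close> contains a cube of side
  \<open>2 sqrt n / s\<close>. Hence \<open>\<sigma> {h \<le> s} \<le> (C s / sqrt n) ^ n\<close>, which is the claim.

  The Santalo inequality is proved with a bad constant by induction on the dimension, following
  Lehec: for log-concave \<open>f\<close> with barycenter 0 and \<open>f x * g y \<le> exp (- <x,y>)\<close>, a shear puts the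
  barycenters of both halves of \<open>f\<close> on the last axis, and integrating along that axis over a half-line
  gives a pair of functions of the same kind in dimension \<open>n - 1\<close>. Each half of \<open>f\<close> carries at least
  a sixth of its mass, by a weak Gruenbaum inequality deduced from Prekopa-Leindler.
\<close>

text \<open>An absolute \<open>c1\<close> leaves room for a factor \<open>C ^ n\<close>, so each
  dimension of the induction may cost a fixed factor. It is \<open>384 = 2 * 6 * 32\<close>: 32 is
  lost on a half-line, 6 is the share of mass in a half, and 2 counts the halves on the dual side.
  The final \<open>192 * exp 1\<close> is 384, times \<open>exp 1\<close> from the lower bound
  \<open>exp (- n)\<close>, over the 2 in the side of the cube. The obstacle in the induction is
  that cutting \<open>f\<close> in two destroys the barycenter condition. The first moments of the
  two halves add up to zero, so both barycenters lie on one line through the origin, and a single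
  shear turns this line into the last axis. Its inverse transpose acts on \<open>g\<close> and keeps
  the duality; since both halves use the same shear vector, the dual halves cover the whole space.
  On the sphere, \<open>\<sigma>\<close> is known only through its invariance. In place of polar
  coordinates, pairs of a point and a direction at a small angle are counted in two ways. This
  compares \<open>\<sigma>\<close> of a set of directions with the volume of a slightly thickened
  cone, which raises the threshold from \<open>s\<close> to some \<open>s' > s\<close>; then
  \<open>s'\<close> tends to \<open>s\<close>.\<close>

section \<open>The Prekopa-Leindler inequality\<close>

text \<open>If \<open>a\<close> is close to \<open>Sup A\<close> and \<open>b\<close> to \<open>Inf B\<close>, then \<open>C\<close> contains the halves of
  \<open>A + b\<close> and \<open>a + B\<close>, which essentially overlap only at \<open>(a + b) / 2\<close>.\<close>

lemma half_sum_set_measure: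
  fixes A B C :: "real set"
  assumes [measurable]: "A \<in> sets borel" "B \<in> sets borel" "C \<in> sets borel"
    and ne: "A \<noteq> {}" "B \<noteq> {}" and bdd: "A \<subseteq> {-k..k}" "B \<subseteq> {-k..k}"
    and sub: "\<And>a b. a \<in> A \<Longrightarrow> b \<in> B \<Longrightarrow> (a + b) / 2 \<in> C"
  shows "emeasure lborel A + emeasure lborel B \<le> 2 * emeasure lborel C"
proof (rule ennreal_le_epsilon)
  fix e :: real assume e: "0 < e"
  have bA: "bdd_above A" "bdd_below B" using bdd by (auto intro: bdd_above_mono bdd_below_mono)
  obtain a where a: "a \<in> A" "Sup A - e/2 < a"
    using less_cSupE[of "Sup A - e/2" A] ne e by auto
  obtain b where b: "b \<in> B" "b < Inf B + e/2"
    using cInf_lessD[of B "Inf B + e/2"] ne e by auto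
  let ?A1 = "A \<inter> {..a}" and ?B1 = "B \<inter> {b<..}"
  have aff: "emeasure lborel X = 2 * emeasure lborel ((\<lambda>z. (2::real) * z - c) -` X)"
    if [measurable]: "X \<in> sets borel" for X c
  proof -
    have m: "(\<lambda>z. (2::real) * z - c) -` X \<in> sets borel"
      using measurable_sets[of "\<lambda>z. (2::real) * z - c" borel borel X] that by simp
    have "emeasure lborel X = (\<integral>\<^sup>+x. indicator X x \<partial>lborel)" by simp
    also have "\<dots> = 2 * (\<integral>\<^sup>+x. indicator X (- c + 2 * x) \<partial>lborel)"
      using nn_integral_real_affine[of "indicator X" 2 "-c"] by simp
    also have "(\<integral>\<^sup>+x. indicator X (- c + 2 * x) \<partial>lborel)
        = (\<integral>\<^sup>+x. indicator ((\<lambda>z. 2 * z - c) -` X) x \<partial>lborel)"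
      by (intro nn_integral_cong) (auto simp: indicator_def)
    finally show ?thesis using m by simp
  qed
  let ?U = "(\<lambda>z. 2 * z - b) -` ?A1" and ?V = "(\<lambda>z. 2 * z - a) -` ?B1"
  have mU: "?U \<in> sets borel" "?V \<in> sets borel"
    using measurable_sets[of "\<lambda>z. (2::real) * z - b" borel borel ?A1]
      measurable_sets[of "\<lambda>z. (2::real) * z - a" borel borel ?B1] by simp_all
  have "?U \<subseteq> C"
  proof
    fix z assume "z \<in> ?U" then have "2 * z - b \<in> A" by auto
    from sub[OF this b(1)] show "z \<in> C" by simp
  qed
  moreover have "?V \<subseteq> C"
  proof
    fix z assume "z \<in> ?V" then have "2 * z - a \<in> B" by auto
    from sub[OF a(1) this] show "z \<in> C" by simp
  qed
  moreover have "?U \<inter> ?V = {}" by auto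
  ultimately have "emeasure lborel ?U + emeasure lborel ?V \<le> emeasure lborel C"
    using mU by (subst plus_emeasure) (auto intro!: emeasure_mono)
  then have 1: "emeasure lborel ?A1 + emeasure lborel ?B1 \<le> 2 * emeasure lborel C"
  proof -
    have "emeasure lborel ?A1 + emeasure lborel ?B1 = 2 * (emeasure lborel ?U + emeasure lborel ?V)"
      unfolding distrib_left by (intro arg_cong2[where f="(+)"] aff) auto
    also have "\<dots> \<le> 2 * emeasure lborel C"
      by (intro mult_left_mono) (use \<open>emeasure lborel ?U + emeasure lborel ?V \<le> emeasure lborel C\<close> in auto)
    finally show ?thesis .
  qed
  have "A \<subseteq> ?A1 \<union> {a..a+e/2}"
  proof
    fix x assume "x \<in> A" with cSup_upper[OF this bA(1)] a show "x \<in> ?A1 \<union> {a..a+e/2}" by auto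
  qed
  then have "emeasure lborel A \<le> emeasure lborel (?A1 \<union> {a..a+e/2})" by (intro emeasure_mono) auto
  also have "\<dots> \<le> emeasure lborel ?A1 + ennreal (e/2)"
    using e by (intro order_trans[OF emeasure_subadditive]) auto
  finally have 2: "emeasure lborel A \<le> emeasure lborel ?A1 + ennreal (e/2)" .
  have "B \<subseteq> ?B1 \<union> {b-e/2..b}"
  proof
    fix x assume "x \<in> B" with cInf_lower[OF this bA(2)] b show "x \<in> ?B1 \<union> {b-e/2..b}" by auto
  qed
  then have "emeasure lborel B \<le> emeasure lborel (?B1 \<union> {b-e/2..b})" by (intro emeasure_mono) auto
  also have "\<dots> \<le> emeasure lborel ?B1 + ennreal (e/2)"
    using e by (intro order_trans[OF emeasure_subadditive]) auto
  finally have 3: "emeasure lborel B \<le> emeasure lborel ?B1 + ennreal (e/2)" .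
  have "emeasure lborel A + emeasure lborel B
      \<le> (emeasure lborel ?A1 + emeasure lborel ?B1) + (ennreal (e/2) + ennreal (e/2))"
    using add_mono[OF 2 3] by (simp add: ac_simps)
  also have "ennreal (e/2) + ennreal (e/2) = ennreal e"
    using e by (simp flip: ennreal_plus)
  finally show "emeasure lborel A + emeasure lborel B \<le> 2 * emeasure lborel C + ennreal e"
    using 1 by (auto intro: order_trans[OF _ add_right_mono])
qed

text \<open>Levels are measured as fractions \<open>t\<close> of the cap \<open>c\<close>. In the
  Prekopa-Leindler argument this allows functions with different caps to be compared at the same
  \<open>t\<close>. Negative values of \<open>h\<close> contribute nothing on either side.\<close>

lemma layer_cake_min:
  fixes h :: "'a \<Rightarrow> real"
  assumes [measurable]: "h \<in> borel_measurable M" and "sigma_finite_measure M" and c: "0 < c"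
  shows "(\<integral>\<^sup>+x. ennreal (min (h x) c) \<partial>M)
    = c * (\<integral>\<^sup>+t. indicator {0<..<1} t * emeasure M {x \<in> space M. t * c < h x} \<partial>lborel)"
proof -
  interpret sigma_finite_measure M by fact
  interpret pair_sigma_finite M "lborel :: real measure" ..
  have pt: "ennreal (min u c) = c * (\<integral>\<^sup>+t. indicator {0<..<1} t * indicator {t. t * c < u} t \<partial>lborel)" for u
  proof -
    have "(\<integral>\<^sup>+t. indicator {0<..<1} t * indicator {t. t * c < u} t \<partial>lborel)
        = (\<integral>\<^sup>+t. indicator {0<..<min 1 (u/c)} t \<partial>lborel)"
      using c by (intro nn_integral_cong) (auto simp: indicator_def field_simps)
    also have "\<dots> = ennreal (min 1 (u/c))"
      by (cases "0 \<le> min 1 (u/c)") (auto simp: ennreal_neg min_def)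
    finally show ?thesis using c
      by (simp add: ennreal_mult'[symmetric] min_def field_simps)
  qed
  have "(\<integral>\<^sup>+x. ennreal (min (h x) c) \<partial>M)
      = c * (\<integral>\<^sup>+x. \<integral>\<^sup>+t. indicator {0<..<1} t * indicator {p \<in> space (M \<Otimes>\<^sub>M lborel). snd p * c < h (fst p)} (x, t) \<partial>lborel \<partial>M)"
    unfolding pt
    by (subst nn_integral_cmult[symmetric], measurable)
       (intro nn_integral_cong, auto simp: indicator_def space_pair_measure intro!: nn_integral_cong arg_cong2[where f="(*)"])
  also have "\<dots> = c * (\<integral>\<^sup>+t. \<integral>\<^sup>+x. indicator {0<..<1} t * indicator {p \<in> space (M \<Otimes>\<^sub>M lborel). snd p * c < h (fst p)} (x, t) \<partial>M \<partial>lborel)"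
    by (subst Fubini') simp_all
  also have "\<dots> = c * (\<integral>\<^sup>+t. indicator {0<..<1} t * emeasure M {x \<in> space M. t * c < h x} \<partial>lborel)"
  proof (intro arg_cong2[where f="(*)"] refl nn_integral_cong)
    fix t :: real
    have "(\<integral>\<^sup>+x. indicator {0<..<1} t * indicator {p \<in> space (M \<Otimes>\<^sub>M lborel). snd p * c < h (fst p)} (x, t) \<partial>M)
      = indicator {0<..<1} t * (\<integral>\<^sup>+x. indicator {x \<in> space M. t * c < h x} x \<partial>M)"
      by (subst nn_integral_cmult[symmetric], measurable)
         (auto simp: indicator_def space_pair_measure intro!: nn_integral_cong)
    then show "(\<integral>\<^sup>+x. indicator {0<..<1} t * indicator {p \<in> space (M \<Otimes>\<^sub>M lborel). snd p * c < h (fst p)} (x, t) \<partial>M)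
      = indicator {0<..<1} t * emeasure M {x \<in> space M. t * c < h x}" by simp
  qed
  finally show ?thesis .
qed

text \<open>The additive inequality for sets holds only for nonempty sets, so \<open>f\<close> and
  \<open>g\<close> are scaled by their suprema \<open>a\<close> and \<open>b\<close>: for
  \<open>t < 1\<close> the levels \<open>t * a\<close> and \<open>t * b\<close> are both exceeded
  somewhere, and half-sums of such points lie where \<open>h\<close> exceeds \<open>t * c\<close>
  with \<open>c = sqrt (a * b)\<close>. Integrating over \<open>t\<close> bounds
  \<open>F / a + G / b\<close> by \<open>2 * H / c\<close>, and AM-GM turns the sum into the
  product.\<close>

lemma prekopa_leindler_bounded:
  fixes f g :: "real \<Rightarrow> real" and h :: "real \<Rightarrow> ennreal"
  assumes [measurable]: "f \<in> borel_measurable borel" "g \<in> borel_measurable borel" "h \<in> borel_measurable borel"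
    and f0: "\<And>x. 0 \<le> f x" "\<And>x. f x \<le> k" "\<And>x. f x \<noteq> 0 \<Longrightarrow> x \<in> {-k..k}"
    and g0: "\<And>x. 0 \<le> g x" "\<And>x. g x \<le> k" "\<And>x. g x \<noteq> 0 \<Longrightarrow> x \<in> {-k..k}"
    and le: "\<And>x y. ennreal (f x) * ennreal (g y) \<le> (h ((x + y) / 2))\<^sup>2"
  shows "(\<integral>\<^sup>+x. f x \<partial>lborel) * (\<integral>\<^sup>+x. g x \<partial>lborel) \<le> (\<integral>\<^sup>+x. h x \<partial>lborel)\<^sup>2"
proof -
  define a where "a = (SUP x. f x)"
  define b where "b = (SUP x. g x)"
  have bdd: "bdd_above (range f)" "bdd_above (range g)" using f0(2) g0(2) by (auto intro!: bdd_aboveI)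
  have fa: "f x \<le> a" and gb: "g x \<le> b" for x
    unfolding a_def b_def by (intro cSUP_upper bdd; simp)+
  have ab0: "0 \<le> a" "0 \<le> b" using fa[of 0] gb[of 0] f0(1)[of 0] g0(1)[of 0] by auto
  show ?thesis
  proof (cases "a = 0 \<or> b = 0")
    case True
    then have "(\<forall>x. f x = 0) \<or> (\<forall>x. g x = 0)" using fa gb f0(1) g0(1) by (metis order_antisym)
    then show ?thesis by auto
  next
    case False
    with ab0 have ab: "0 < a" "0 < b" by auto
    define c where "c = sqrt (a * b)"
    have c: "0 < c" "c\<^sup>2 = a * b" using ab by (auto simp: c_def)
    \<comment> \<open>\<open>layer_cake_min\<close> takes real functions, so \<open>h\<close> is
      capped at \<open>c\<close>. The cap is finite and has the same superlevel sets at the levels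
      \<open>t * c\<close> with \<open>t < 1\<close>.\<close>
    define hr where "hr = (\<lambda>x. enn2real (min (h x) c))"
    have [measurable]: "hr \<in> borel_measurable borel" by (simp add: hr_def)
    have hr: "ennreal (hr x) = min (h x) c" for x
      unfolding hr_def by (intro ennreal_enn2real) (auto simp: min_less_iff_disj)
    define A where "A = (\<lambda>t. {x. t * a < f x})"
    define B where "B = (\<lambda>t. {x. t * b < g x})"
    define C where "C = (\<lambda>t. {x. ennreal (t * c) < h x})"
    have [measurable]: "A t \<in> sets borel" "B t \<in> sets borel" "C t \<in> sets borel" for t
      unfolding A_def B_def C_def by measurable
    have key: "emeasure lborel (A t) + emeasure lborel (B t) \<le> 2 * emeasure lborel (C t)"
      if t: "0 < t" "t < 1" for t
    proof (rule half_sum_set_measure)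
      have "t * a < a" using t ab by simp
      then show "A t \<noteq> {}" unfolding A_def using less_cSUP_iff[OF _ bdd(1), of "t * a"]
        by (auto simp flip: a_def)
      have "t * b < b" using t ab by simp
      then show "B t \<noteq> {}" unfolding B_def using less_cSUP_iff[OF _ bdd(2), of "t * b"]
        by (auto simp flip: b_def)
      have "0 < t * a" "0 < t * b" using t ab by auto
      then show "A t \<subseteq> {-k..k}" "B t \<subseteq> {-k..k}" using f0(3) g0(3) by (force simp: A_def B_def)+
      fix x y assume xy: "x \<in> A t" "y \<in> B t"
      have "(t * c)\<^sup>2 = (t * a) * (t * b)" unfolding power_mult_distrib c by (simp add: power2_eq_square)
      also have "\<dots> < f x * g y" using xy t ab
        by (intro mult_strict_mono) (auto simp: A_def B_def f0 intro: le_less_trans[of 0 "t * a"])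
      finally have "ennreal ((t * c)\<^sup>2) < ennreal (f x * g y)" by (intro ennreal_lessI) (auto intro: le_less_trans[OF zero_le_power2])
      then have 1: "ennreal (t * c) ^ 2 < (h ((x + y) / 2))\<^sup>2"
      proof -
        have "ennreal (t * c) ^ 2 = ennreal ((t * c)\<^sup>2)" using t c by (intro ennreal_power) simp
        then show ?thesis
          using le[of x y] f0 g0 \<open>ennreal ((t * c)\<^sup>2) < _\<close> by (simp add: ennreal_mult)
      qed
      have "\<not> h ((x + y) / 2) \<le> ennreal (t * c)"
      proof
        assume "h ((x + y) / 2) \<le> ennreal (t * c)"
        then have "(h ((x + y) / 2))\<^sup>2 \<le> (ennreal (t * c))\<^sup>2" by (rule power_mono) simp
        with 1 show False by (simp add: leD)
      qed
      then show "(x + y) / 2 \<in> C t" by (simp add: C_def not_le)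
    qed auto
    have F: "(\<integral>\<^sup>+x. f x \<partial>lborel) = a * (\<integral>\<^sup>+t. indicator {0<..<1} t * emeasure lborel (A t) \<partial>lborel)"
      using layer_cake_min[of f lborel a] fa ab
      by (simp add: sigma_finite_lborel min_absorb1 A_def)
    have G: "(\<integral>\<^sup>+x. g x \<partial>lborel) = b * (\<integral>\<^sup>+t. indicator {0<..<1} t * emeasure lborel (B t) \<partial>lborel)"
      using layer_cake_min[of g lborel b] gb ab
      by (simp add: sigma_finite_lborel min_absorb1 B_def)
    have fin: "(\<integral>\<^sup>+x. u x \<partial>lborel) < \<infinity>" if "\<And>x. u x \<le> k" "\<And>x. u x \<noteq> 0 \<Longrightarrow> x \<in> {-k..k}" for u :: "real \<Rightarrow> real"
    proof -
      have "(\<integral>\<^sup>+x. u x \<partial>lborel) \<le> (\<integral>\<^sup>+x. ennreal k * indicator {-k..k} x \<partial>lborel)"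
        using that by (intro nn_integral_mono) (force simp: indicator_def intro: ennreal_leI)
      also have "\<dots> < \<infinity>" by (cases "-k \<le> k") (auto simp: nn_integral_cmult_indicator ennreal_mult_less_top)
      finally show ?thesis .
    qed
    obtain Fr where Fr: "(\<integral>\<^sup>+x. f x \<partial>lborel) = ennreal Fr" "0 \<le> Fr"
      using fin[of f] f0 by (cases "(\<integral>\<^sup>+x. f x \<partial>lborel)") auto
    obtain Gr where Gr: "(\<integral>\<^sup>+x. g x \<partial>lborel) = ennreal Gr" "0 \<le> Gr"
      using fin[of g] g0 by (cases "(\<integral>\<^sup>+x. g x \<partial>lborel)") auto
    define Ai where "Ai = (\<integral>\<^sup>+t. indicator {0<..<1} t * emeasure lborel (A t) \<partial>lborel)"
    define Bi where "Bi = (\<integral>\<^sup>+t. indicator {0<..<1} t * emeasure lborel (B t) \<partial>lborel)"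
    define Ci where "Ci = (\<integral>\<^sup>+t. indicator {0<..<1} t * emeasure lborel (C t) \<partial>lborel)"
    have div: "z = ennreal (r / d)" if "ennreal r = ennreal d * z" "0 < d" "0 \<le> r" for r d z
    proof -
      have "z = ennreal (1 / d * d) * z" using that by simp
      also have "\<dots> = ennreal (1 / d) * (ennreal d * z)"
        using that by (subst ennreal_mult) (auto simp: mult.assoc)
      also have "\<dots> = ennreal (1 / d * r)" using that by (subst ennreal_mult) auto
      finally show ?thesis by simp
    qed
    have A': "Ai = ennreal (Fr / a)" using F Fr ab by (intro div) (simp_all add: Ai_def)
    have B': "Bi = ennreal (Gr / b)" using G Gr ab by (intro div) (simp_all add: Bi_def)
    have mm: "(\<lambda>t. emeasure lborel (A t)) \<in> borel_measurable borel" "(\<lambda>t. emeasure lborel (B t)) \<in> borel_measurable borel"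
        "(\<lambda>t. emeasure lborel (C t)) \<in> borel_measurable borel"
      using lborel.measurable_emeasure_Pair[of "{p \<in> space (borel \<Otimes>\<^sub>M lborel). fst p * a < f (snd p)}" borel]
        lborel.measurable_emeasure_Pair[of "{p \<in> space (borel \<Otimes>\<^sub>M lborel). fst p * b < g (snd p)}" borel]
        lborel.measurable_emeasure_Pair[of "{p \<in> space (borel \<Otimes>\<^sub>M lborel). ennreal (fst p * c) < h (snd p)}" borel]
      by (simp_all add: A_def B_def C_def vimage_def space_pair_measure)
    note [measurable] = mm
    have "Ai + Bi = (\<integral>\<^sup>+t. indicator {0<..<1} t * (emeasure lborel (A t) + emeasure lborel (B t)) \<partial>lborel)"
      unfolding Ai_def Bi_def by (subst nn_integral_add[symmetric]) (auto simp: distrib_left)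
    also have "\<dots> \<le> (\<integral>\<^sup>+t. 2 * (indicator {0<..<1} t * emeasure lborel (C t)) \<partial>lborel)"
      using key by (intro nn_integral_mono) (auto simp: indicator_def)
    also have "\<dots> = 2 * Ci" unfolding Ci_def by (subst nn_integral_cmult) auto
    finally have ABC: "ennreal (Fr / a) + ennreal (Gr / b) \<le> 2 * Ci" by (simp add: A' B')
    have "c * Ci = (\<integral>\<^sup>+x. ennreal (min (hr x) c) \<partial>lborel)"
    proof -
      have "t * c < hr x \<longleftrightarrow> ennreal (t * c) < h x" if "0 < t" "t < 1" for t x
      proof -
        have "t * c < hr x \<longleftrightarrow> ennreal (t * c) < ennreal (hr x)"
          using that c by (subst ennreal_less_iff) auto
        also have "\<dots> \<longleftrightarrow> ennreal (t * c) < h x"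
          using that c by (auto simp: hr min_less_iff_conj ennreal_less_iff)
        finally show ?thesis .
      qed
      then have "indicator {0<..<1} t * emeasure lborel (C t) = indicator {0<..<1} t * emeasure lborel {x \<in> space lborel. t * c < hr x}" for t
        by (auto simp: indicator_def C_def)
      then show ?thesis
        using layer_cake_min[of hr lborel c] c by (simp add: sigma_finite_lborel Ci_def)
    qed
    also have "\<dots> \<le> (\<integral>\<^sup>+x. h x \<partial>lborel)"
    proof (intro nn_integral_mono)
      fix x have "ennreal (min (hr x) c) \<le> ennreal (hr x)" by (intro ennreal_leI) auto
      also have "\<dots> \<le> h x" by (simp add: hr)
      finally show "ennreal (min (hr x) c) \<le> h x" .
    qed
    finally have H: "c * Ci \<le> (\<integral>\<^sup>+x. h x \<partial>lborel)" .
    have "4 * (Fr * Gr) \<le> (c * (Fr / a + Gr / b))\<^sup>2"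
    proof -
      have "4 * (Fr / a) * (Gr / b) \<le> (Fr / a + Gr / b)\<^sup>2"
        using sum_squares_bound[of "Fr/a" "Gr/b"] unfolding power2_sum by linarith
      then have "c\<^sup>2 * (4 * (Fr / a) * (Gr / b)) \<le> c\<^sup>2 * (Fr / a + Gr / b)\<^sup>2" by (intro mult_left_mono) auto
      then show ?thesis using ab by (simp add: power_mult_distrib c)
    qed
    then have 4: "ennreal (4 * (Fr * Gr)) \<le> ennreal ((c * (Fr / a + Gr / b))\<^sup>2)" by (rule ennreal_leI)
    have "4 * (ennreal Fr * ennreal Gr) = ennreal (4 * (Fr * Gr))" using Fr Gr by (simp add: ennreal_mult)
    also note 4
    also have "ennreal ((c * (Fr / a + Gr / b))\<^sup>2) = (ennreal c * (ennreal (Fr / a) + ennreal (Gr / b)))\<^sup>2"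
    proof -
      have z: "0 \<le> Fr / a" "0 \<le> Gr / b" using ab Fr Gr by auto
      then have "ennreal ((c * (Fr / a + Gr / b))\<^sup>2) = (ennreal (c * (Fr / a + Gr / b)))\<^sup>2"
        using c by (intro ennreal_power[symmetric]) simp
      also have "ennreal (c * (Fr / a + Gr / b)) = ennreal c * ennreal (Fr / a + Gr / b)"
        using c z by (intro ennreal_mult) auto
      finally show ?thesis using z by (simp only: ennreal_plus)
    qed
    also have "\<dots> \<le> (ennreal c * (2 * Ci))\<^sup>2" by (intro power_mono mult_left_mono ABC) auto
    also have "\<dots> = 4 * (c * Ci)\<^sup>2" by (simp add: power2_eq_square ac_simps)
    also have "\<dots> \<le> 4 * (\<integral>\<^sup>+x. h x \<partial>lborel)\<^sup>2" by (intro mult_left_mono power_mono H) auto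
    finally have "4 * (ennreal Fr * ennreal Gr) \<le> 4 * (\<integral>\<^sup>+x. h x \<partial>lborel)\<^sup>2" .
    then have "ennreal (1/4) * (4 * (ennreal Fr * ennreal Gr)) \<le> ennreal (1/4) * (4 * (\<integral>\<^sup>+x. h x \<partial>lborel)\<^sup>2)"
      by (rule mult_left_mono) simp
    moreover have "ennreal (1/4) * (4 * z) = z" for z
    proof -
      have "ennreal (1/4) * 4 = ennreal (1/4) * ennreal 4" by simp
      also have "\<dots> = 1" by (subst ennreal_mult[symmetric]) auto
      finally show ?thesis by (simp add: mult.assoc[symmetric])
    qed
    ultimately show ?thesis by (simp add: Fr Gr)
  qed
qed

text \<open>Monotone convergence from the bounded case: only \<open>f\<close> and \<open>g\<close>
  are cut off in height and support, while \<open>h\<close> stays as it is. The squared form avoids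
  square roots in \<open>ennreal\<close>.\<close>

theorem prekopa_leindler_real:
  fixes f g h :: "real \<Rightarrow> ennreal"
  assumes [measurable]: "f \<in> borel_measurable borel" "g \<in> borel_measurable borel" "h \<in> borel_measurable borel"
    and le: "\<And>x y. f x * g y \<le> (h ((x + y) / 2))\<^sup>2"
  shows "(\<integral>\<^sup>+x. f x \<partial>lborel) * (\<integral>\<^sup>+x. g x \<partial>lborel) \<le> (\<integral>\<^sup>+x. h x \<partial>lborel)\<^sup>2"
proof -
  define tr where "tr = (\<lambda>(k::nat) (u::real \<Rightarrow> ennreal) x. enn2real (min (u x) (of_nat k)) * indicator {-real k..real k} x)"
  have tr: "ennreal (tr k u x) = min (u x) (of_nat k) * indicator {-real k..real k} x" for k u x
    unfolding tr_def by (auto simp: indicator_def min_less_iff_disj of_nat_less_top intro!: ennreal_enn2real)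
  have tr_le: "ennreal (tr k u x) \<le> u x" for k u x
    unfolding tr by (auto simp: indicator_def)
  have tr_k: "tr k u x \<le> real k" for k u x
  proof -
    have "ennreal (tr k u x) \<le> ennreal (real k)"
      unfolding tr by (auto simp: indicator_def ennreal_of_nat_eq_real_of_nat)
    then show ?thesis by simp
  qed
  have tr_mono: "ennreal (tr k u x) \<le> ennreal (tr l u x)" if "k \<le> l" for k l u x
  proof -
    have "min (u x) (of_nat k) \<le> min (u x) (of_nat l)" using that by (intro min.mono) (auto simp: of_nat_mono)
    then show ?thesis unfolding tr using that by (auto simp: indicator_def)
  qed
  have tr_sup: "(SUP k. ennreal (tr k u x)) = u x" for u x
  proof (rule LIMSEQ_unique[OF LIMSEQ_SUP])
    show "incseq (\<lambda>k. ennreal (tr k u x))" using tr_mono by (auto intro: incseq_SucI)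
    have "(\<lambda>k. min (u x) (of_nat k)) \<longlonglongrightarrow> min (u x) top"
      by (intro tendsto_min tendsto_const) (simp add: of_nat_tendsto_top_ennreal)
    moreover have "eventually (\<lambda>k. min (u x) (of_nat k) = ennreal (tr k u x)) sequentially"
    proof -
      obtain N where "\<bar>x\<bar> \<le> real N" using real_arch_simple by blast
      then show ?thesis by (auto simp: tr eventually_sequentially indicator_def intro!: exI[of _ N])
    qed
    ultimately show "(\<lambda>k. ennreal (tr k u x)) \<longlonglongrightarrow> u x"
      by (simp add: Lim_transform_eventually)
  qed
  have trm[measurable]: "tr k u \<in> borel_measurable borel" if [measurable]: "u \<in> borel_measurable borel" for k u
    unfolding tr_def by measurable
  have sup: "(\<integral>\<^sup>+x. u x \<partial>lborel) = (SUP k. \<integral>\<^sup>+x. ennreal (tr k u x) \<partial>lborel)"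
    if [measurable]: "u \<in> borel_measurable borel" for u
    by (subst nn_integral_monotone_convergence_SUP[symmetric])
       (auto simp: tr_sup le_fun_def tr_mono intro!: incseq_SucI)
  \<comment> \<open>The product of two suprema is a double supremum with independent cutoffs
    \<open>j\<close> and \<open>k\<close>; raising both to \<open>max j k\<close> reduces to a
    common cutoff.\<close>
  have step: "(\<integral>\<^sup>+x. ennreal (tr j f x) \<partial>lborel) * (\<integral>\<^sup>+x. ennreal (tr k g x) \<partial>lborel) \<le> (\<integral>\<^sup>+x. h x \<partial>lborel)\<^sup>2" for j k
  proof -
    have "(\<integral>\<^sup>+x. ennreal (tr j f x) \<partial>lborel) * (\<integral>\<^sup>+x. ennreal (tr k g x) \<partial>lborel)
        \<le> (\<integral>\<^sup>+x. ennreal (tr (max j k) f x) \<partial>lborel) * (\<integral>\<^sup>+x. ennreal (tr (max j k) g x) \<partial>lborel)"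
      by (intro mult_mono nn_integral_mono tr_mono) auto
    also have "\<dots> \<le> (\<integral>\<^sup>+x. h x \<partial>lborel)\<^sup>2"
    proof (rule prekopa_leindler_bounded[where k="real (max j k)"])
      show "ennreal (tr (max j k) f x) * ennreal (tr (max j k) g y) \<le> (h ((x + y) / 2))\<^sup>2" for x y
        by (rule order_trans[OF mult_mono le]) (auto simp: tr_le)
      show "tr (max j k) f x \<le> real (max j k)" "tr (max j k) g x \<le> real (max j k)" for x
        by (rule tr_k)+
    qed (auto simp: tr_def indicator_def simp del: of_nat_max)
    finally show ?thesis .
  qed
  show ?thesis
    unfolding sup[of f, simplified] sup[of g, simplified]
    by (simp add: SUP_mult_left_ennreal SUP_mult_right_ennreal) (intro SUP_least step)
qed

section \<open>Slicing off the last coordinate, and Prekopa-Leindler in several variables\<close>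

definition midpoint_n :: "nat \<Rightarrow> (nat \<Rightarrow> real) \<Rightarrow> (nat \<Rightarrow> real) \<Rightarrow> nat \<Rightarrow> real" where
  "midpoint_n n x y = (\<lambda>i\<in>{..<n}. (x i + y i) / 2)"

interpretation lborel_prod: product_sigma_finite "\<lambda>_::nat. lborel :: real measure"
  by standard

lemma space_lborel_n [simp]: "space (lborel_n n) = Rn n"
  by (simp add: space_PiM)

lemma fun_upd_Rn: "x \<in> Rn n \<Longrightarrow> x(n := s) \<in> Rn (Suc n)"
  by (auto simp: PiE_iff extensional_def)

lemma midpoint_Rn [simp]: "midpoint_n n x y \<in> Rn n"
  by (auto simp: midpoint_n_def)

lemma midpoint_upd:
  "midpoint_n (Suc n) (x(n := s)) (y(n := t)) = (midpoint_n n x y)(n := (s + t) / 2)"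
  by (auto simp: midpoint_n_def fun_eq_iff)

lemma measurable_fun_upd_Suc [measurable]:
  "(\<lambda>p. (fst p)(n := snd p)) \<in> lborel_n n \<Otimes>\<^sub>M lborel \<rightarrow>\<^sub>M lborel_n (Suc n)"
  using measurable_add_dim[of n "{..<n}" "\<lambda>_. lborel"]
  by (simp add: lessThan_Suc case_prod_beta')

lemma measurable_section_point:
  "x \<in> Rn n \<Longrightarrow> (\<lambda>s. x(n := s)) \<in> borel \<rightarrow>\<^sub>M lborel_n (Suc n)"
  using measurable_compose[OF measurable_Pair1'[of x "lborel_n n" lborel] measurable_fun_upd_Suc] by simp

lemma measurable_section_height [measurable]:
  "(\<lambda>x. x(n := s)) \<in> lborel_n n \<rightarrow>\<^sub>M lborel_n (Suc n)"
  using measurable_compose[OF measurable_Pair2'[of s lborel "lborel_n n"] measurable_fun_upd_Suc] by simp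

lemma nn_integral_lborel_Suc:
  assumes "f \<in> borel_measurable (lborel_n (Suc n))"
  shows "(\<integral>\<^sup>+x. f x \<partial>lborel_n (Suc n)) = (\<integral>\<^sup>+x. \<integral>\<^sup>+s. f (x(n := s)) \<partial>lborel \<partial>lborel_n n)"
    and "(\<integral>\<^sup>+x. f x \<partial>lborel_n (Suc n)) = (\<integral>\<^sup>+s. \<integral>\<^sup>+x. f (x(n := s)) \<partial>lborel_n n \<partial>lborel)"
  using lborel_prod.product_nn_integral_insert[of "{..<n}" n f]
    lborel_prod.product_nn_integral_insert_rev[of "{..<n}" n f] assms
  by (simp_all add: lessThan_Suc)

lemma nn_integral_lborel_0: "(\<integral>\<^sup>+x. f x \<partial>lborel_n 0) = f (\<lambda>_. undefined)"
  by (simp add: PiM_empty nn_integral_count_space_finite)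

lemma measurable_nn_integral_slice:
  assumes "f \<in> borel_measurable (lborel_n (Suc n))"
  shows "(\<lambda>s. \<integral>\<^sup>+x. f (x(n := s)) \<partial>lborel_n n) \<in> borel_measurable borel"
proof -
  interpret finite_product_sigma_finite "\<lambda>_::nat. lborel :: real measure" "{..<n}"
    by standard simp
  have "(\<lambda>p. f ((snd p)(n := fst p))) \<in> borel_measurable (lborel \<Otimes>\<^sub>M lborel_n n)"
    using measurable_compose[OF measurable_pair_swap' measurable_compose[OF measurable_fun_upd_Suc assms]]
    by (simp add: case_prod_beta')
  from borel_measurable_nn_integral_fst[OF this] show ?thesis by simp
qed

text \<open>For slices at heights \<open>s\<close> and \<open>t\<close> of the last coordinate, the
  induction hypothesis is precisely the one-dimensional hypothesis for the slice integrals. The base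
  case evaluates at the single point of \<open>Rn 0\<close>.\<close>

theorem prekopa_leindler:
  assumes "f \<in> borel_measurable (lborel_n n)" "g \<in> borel_measurable (lborel_n n)"
    "h \<in> borel_measurable (lborel_n n)"
    and "\<And>x y. x \<in> Rn n \<Longrightarrow> y \<in> Rn n \<Longrightarrow> f x * g y \<le> (h (midpoint_n n x y))\<^sup>2"
  shows "(\<integral>\<^sup>+x. f x \<partial>lborel_n n) * (\<integral>\<^sup>+x. g x \<partial>lborel_n n) \<le> (\<integral>\<^sup>+x. h x \<partial>lborel_n n)\<^sup>2"
  using assms
proof (induction n arbitrary: f g h)
  case 0
  have "midpoint_n 0 (\<lambda>_. undefined) (\<lambda>_. undefined) = (\<lambda>_. undefined)"
    by (auto simp: midpoint_n_def)
  then show ?case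
    using 0(4)[of "\<lambda>_. undefined" "\<lambda>_. undefined"] by (simp only: nn_integral_lborel_0) simp
next
  case (Suc n)
  note [measurable] = Suc.prems(1-3)
  let ?J = "\<lambda>u s. \<integral>\<^sup>+x. u (x(n := s)) \<partial>lborel_n n"
  have "(\<integral>\<^sup>+s. ?J f s \<partial>lborel) * (\<integral>\<^sup>+s. ?J g s \<partial>lborel) \<le> (\<integral>\<^sup>+s. ?J h s \<partial>lborel)\<^sup>2"
  proof (rule prekopa_leindler_real)
    show "?J f \<in> borel_measurable borel" "?J g \<in> borel_measurable borel" "?J h \<in> borel_measurable borel"
      by (simp_all add: measurable_nn_integral_slice)
    show "?J f s * ?J g t \<le> (?J h ((s + t) / 2))\<^sup>2" for s t
    proof (rule Suc.IH)
      fix x y assume "x \<in> Rn n" "y \<in> Rn n"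
      then show "f (x(n := s)) * g (y(n := t)) \<le> (h ((midpoint_n n x y)(n := (s + t) / 2)))\<^sup>2"
        using Suc.prems(4)[OF fun_upd_Rn fun_upd_Rn] unfolding midpoint_upd by blast
    qed measurable
  qed
  then show ?case
    by (subst (1 2 3) nn_integral_lborel_Suc(2)) simp_all
qed

section \<open>Measure-preserving shears\<close>

text \<open>A linear map sending the last basis vector to \<open>e\<close> times the vector with
  entries \<open>v\<close> and last entry 1. Composing \<open>f\<close> with it brings a barycenter
  in that direction onto the last axis. The sign \<open>e\<close> selects which half of
  \<open>f\<close> ends up where the last coordinate is positive.\<close>

definition flip_coshear :: "nat \<Rightarrow> real \<Rightarrow> (nat \<Rightarrow> real) \<Rightarrow> (nat \<Rightarrow> real) \<Rightarrow> nat \<Rightarrow> real" where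
  "flip_coshear n e v x = (\<lambda>i\<in>{..<Suc n}. if i = n then e * x n else x i + e * x n * v i)"

text \<open>The inverse transpose of \<open>flip_coshear n e v\<close> when \<open>e\<close> is 1 or
  -1; it acts on the dual variable so that inner products are kept.\<close>

definition flip_shear :: "nat \<Rightarrow> real \<Rightarrow> (nat \<Rightarrow> real) \<Rightarrow> (nat \<Rightarrow> real) \<Rightarrow> nat \<Rightarrow> real" where
  "flip_shear n e v y = (\<lambda>i\<in>{..<Suc n}. if i = n then e * y n - (\<Sum>j<n. v j * y j) else y i)"

lemma flip_coshear_Rn [simp]: "flip_coshear n e v x \<in> Rn (Suc n)"
  unfolding flip_coshear_def by auto

lemma flip_shear_Rn [simp]: "flip_shear n e v x \<in> Rn (Suc n)"
  unfolding flip_shear_def by auto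

lemma measurable_flip_coshear [measurable]:
  "flip_coshear n e v \<in> lborel_n (Suc n) \<rightarrow>\<^sub>M lborel_n (Suc n)"
  unfolding flip_coshear_def
proof (rule measurable_restrict)
  fix i assume i: "i \<in> {..<Suc n}"
  then have [measurable]: "(\<lambda>x. x i) \<in> borel_measurable (lborel_n (Suc n))"
    "(\<lambda>x. x n) \<in> borel_measurable (lborel_n (Suc n))"
    using measurable_component_singleton[of _ "{..<Suc n}" "\<lambda>_. lborel :: real measure"] by auto
  show "(\<lambda>x. if i = n then e * x n else x i + e * x n * v i) \<in> lborel_n (Suc n) \<rightarrow>\<^sub>M lborel"
    by (cases "i = n") simp_all
qed

lemma measurable_flip_shear [measurable]:
  "flip_shear n e v \<in> lborel_n (Suc n) \<rightarrow>\<^sub>M lborel_n (Suc n)"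
  unfolding flip_shear_def
proof (rule measurable_restrict)
  fix i assume i: "i \<in> {..<Suc n}"
  then have [measurable]: "(\<lambda>x. x j) \<in> borel_measurable (lborel_n (Suc n))" if "j < Suc n" for j
    using measurable_component_singleton[of j "{..<Suc n}" "\<lambda>_. lborel :: real measure"] that by auto
  show "(\<lambda>y. if i = n then e * y n - (\<Sum>j<n. v j * y j) else y i) \<in> lborel_n (Suc n) \<rightarrow>\<^sub>M lborel"
    using i by (cases "i = n") (auto intro!: borel_measurable_diff borel_measurable_times borel_measurable_sum)
qed

lemma inner_flip_coshear_flip_shear:
  assumes "e * e = 1"
  shows "inner_n (Suc n) (flip_coshear n e v x) (flip_shear n e v y) = inner_n (Suc n) x y"
proof -
  have "inner_n (Suc n) (flip_coshear n e v x) (flip_shear n e v y)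
      = (\<Sum>i<n. (x i + e * x n * v i) * y i) + e * x n * (e * y n - (\<Sum>j<n. v j * y j))"
    by (simp add: inner_n_def flip_coshear_def flip_shear_def)
  also have "\<dots> = (\<Sum>i<n. x i * y i) + (e * e) * x n * y n"
    by (simp add: distrib_left distrib_right sum.distrib sum_distrib_left right_diff_distrib ac_simps)
  finally show ?thesis using assms by (simp add: inner_n_def)
qed

lemma flip_coshear_upd:
  "flip_coshear n e v (x(n := s)) = (\<lambda>i\<in>{..<n}. x i + e * s * v i)(n := e * s)"
  by (auto simp: flip_coshear_def fun_eq_iff)

lemma flip_shear_upd:
  "x \<in> Rn n \<Longrightarrow> flip_shear n e v (x(n := s)) = x(n := e * s - (\<Sum>j<n. v j * x j))"
  by (auto simp: flip_shear_def fun_eq_iff PiE_iff extensional_def)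

lemma measurable_component_n: "i < n \<Longrightarrow> (\<lambda>x. x i) \<in> borel_measurable (lborel_n n)"
  using measurable_component_singleton[of i "{..<n}" "\<lambda>_. lborel :: real measure"] by simp

lemma measurable_translation_n: "(\<lambda>x. \<lambda>i\<in>{..<n}. x i + c i) \<in> lborel_n n \<rightarrow>\<^sub>M lborel_n n"
  by (rule measurable_restrict) (simp add: measurable_component_n borel_measurable_add)

lemma distr_lborel_n_translation:
  "distr (lborel_n n) (lborel_n n) (\<lambda>x. \<lambda>i\<in>{..<n}. x i + c i) = lborel_n n"
proof (rule lborel_prod.PiM_eqI)
  fix A :: "nat \<Rightarrow> real set" assume A: "\<And>i. i \<in> {..<n} \<Longrightarrow> A i \<in> sets lborel"
  let ?f = "\<lambda>x. \<lambda>i\<in>{..<n}. x i + c i"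
  have [measurable]: "?f \<in> lborel_n n \<rightarrow>\<^sub>M lborel_n n" by (rule measurable_translation_n)
  have pre: "(\<lambda>s. c i + s) -` A i \<in> sets borel" if "i < n" for i
    using measurable_sets[of "\<lambda>s. c i + s" borel borel "A i"] A[of i] that by simp
  have "?f -` Pi\<^sub>E {..<n} A \<inter> space (lborel_n n) = Pi\<^sub>E {..<n} (\<lambda>i. (\<lambda>s. c i + s) -` A i)"
    by (auto simp: PiE_iff extensional_def add.commute)
  then have "emeasure (distr (lborel_n n) (lborel_n n) ?f) (Pi\<^sub>E {..<n} A)
      = emeasure (lborel_n n) (Pi\<^sub>E {..<n} (\<lambda>i. (\<lambda>s. c i + s) -` A i))"
    using A by (subst emeasure_distr) (auto intro!: sets_PiM_I_finite)
  also have "\<dots> = (\<Prod>i<n. emeasure lborel ((\<lambda>s. c i + s) -` A i))"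
    using pre by (subst lborel_prod.emeasure_PiM) auto
  also have "\<dots> = (\<Prod>i<n. emeasure lborel (A i))"
  proof (rule prod.cong)
    fix i assume "i \<in> {..<n}"
    then have "emeasure (distr lborel borel ((+) (c i))) (A i) = emeasure lborel ((\<lambda>s. c i + s) -` A i)"
      using A by (subst emeasure_distr) auto
    then show "emeasure lborel ((\<lambda>s. c i + s) -` A i) = emeasure lborel (A i)"
      by (simp add: lborel_distr_plus)
  qed simp
  finally show "emeasure (distr (lborel_n n) (lborel_n n) ?f) (Pi\<^sub>E {..<n} A) = (\<Prod>i<n. emeasure lborel (A i))" .
qed auto

lemma nn_integral_lborel_n_translation:
  assumes [measurable]: "f \<in> borel_measurable (lborel_n n)"
  shows "(\<integral>\<^sup>+x. f (\<lambda>i\<in>{..<n}. x i + c i) \<partial>lborel_n n) = (\<integral>\<^sup>+x. f x \<partial>lborel_n n)"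
proof -
  have [measurable]: "(\<lambda>x. \<lambda>i\<in>{..<n}. x i + c i) \<in> lborel_n n \<rightarrow>\<^sub>M lborel_n n"
    by (rule measurable_translation_n)
  have "(\<integral>\<^sup>+x. f x \<partial>distr (lborel_n n) (lborel_n n) (\<lambda>x. \<lambda>i\<in>{..<n}. x i + c i))
      = (\<integral>\<^sup>+x. f (\<lambda>i\<in>{..<n}. x i + c i) \<partial>lborel_n n)"
    by (rule nn_integral_distr) measurable
  then show ?thesis by (simp add: distr_lborel_n_translation)
qed

lemma nn_integral_sign:
  fixes f :: "real \<Rightarrow> ennreal"
  assumes "e = 1 \<or> e = -1" "f \<in> borel_measurable borel"
  shows "(\<integral>\<^sup>+s. f (e * s + c) \<partial>lborel) = (\<integral>\<^sup>+s. f s \<partial>lborel)"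
  using nn_integral_real_affine[OF assms(2), of e c] assms(1) by (auto simp: add.commute)

lemma distr_eqI_nn_integral:
  assumes "T \<in> M \<rightarrow>\<^sub>M M" "\<And>f. f \<in> borel_measurable M \<Longrightarrow> (\<integral>\<^sup>+x. f (T x) \<partial>M) = (\<integral>\<^sup>+x. f x \<partial>M)"
  shows "distr M M T = M"
proof (rule measure_eqI)
  fix A assume A: "A \<in> sets (distr M M T)"
  then have "emeasure (distr M M T) A = (\<integral>\<^sup>+x. indicator A x \<partial>distr M M T)" by simp
  also have "\<dots> = (\<integral>\<^sup>+x. indicator A (T x) \<partial>M)" using A assms(1) by (intro nn_integral_distr) auto
  also have "\<dots> = (\<integral>\<^sup>+x. indicator A x \<partial>M)" using A by (intro assms(2)) simp
  finally show "emeasure (distr M M T) A = emeasure M A" using A by simp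
qed simp

text \<open>On each slice of constant last coordinate the map is a translation, and the last
  coordinate changes at most its sign. Fubini with the last coordinate outermost replaces a
  determinant computation.\<close>

lemma distr_flip_coshear:
  assumes e: "e = 1 \<or> e = -1"
  shows "distr (lborel_n (Suc n)) (lborel_n (Suc n)) (flip_coshear n e v) = lborel_n (Suc n)"
proof (rule distr_eqI_nn_integral)
  fix f :: "_ \<Rightarrow> ennreal" assume [measurable]: "f \<in> borel_measurable (lborel_n (Suc n))"
  note m = measurable_nn_integral_slice[OF \<open>f \<in> _\<close>]
  have "(\<integral>\<^sup>+x. f (flip_coshear n e v x) \<partial>lborel_n (Suc n))
      = (\<integral>\<^sup>+s. \<integral>\<^sup>+x. f ((\<lambda>i\<in>{..<n}. x i + e * s * v i)(n := e * s)) \<partial>lborel_n n \<partial>lborel)"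
    by (subst nn_integral_lborel_Suc(2)) (simp_all add: flip_coshear_upd)
  also have "\<dots> = (\<integral>\<^sup>+s. \<integral>\<^sup>+x. f (x(n := e * s)) \<partial>lborel_n n \<partial>lborel)"
    by (intro nn_integral_cong nn_integral_lborel_n_translation) measurable
  also have "\<dots> = (\<integral>\<^sup>+s. \<integral>\<^sup>+x. f (x(n := s)) \<partial>lborel_n n \<partial>lborel)"
    using nn_integral_sign[OF e m, of 0] by simp
  also have "\<dots> = (\<integral>\<^sup>+x. f x \<partial>lborel_n (Suc n))" by (subst nn_integral_lborel_Suc(2)) simp_all
  finally show "(\<integral>\<^sup>+x. f (flip_coshear n e v x) \<partial>lborel_n (Suc n)) = (\<integral>\<^sup>+x. f x \<partial>lborel_n (Suc n))" .
qed simp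

text \<open>Here each line parallel to the last axis is mapped to itself by a sign and a
  translation, so the last coordinate is integrated first.\<close>

lemma distr_flip_shear:
  assumes e: "e = 1 \<or> e = -1"
  shows "distr (lborel_n (Suc n)) (lborel_n (Suc n)) (flip_shear n e v) = lborel_n (Suc n)"
proof (rule distr_eqI_nn_integral)
  fix f :: "_ \<Rightarrow> ennreal" assume [measurable]: "f \<in> borel_measurable (lborel_n (Suc n))"
  have "(\<integral>\<^sup>+x. f (flip_shear n e v x) \<partial>lborel_n (Suc n))
      = (\<integral>\<^sup>+x. \<integral>\<^sup>+s. f (x(n := e * s + - (\<Sum>j<n. v j * x j))) \<partial>lborel \<partial>lborel_n n)"
    by (subst nn_integral_lborel_Suc(1)) (auto intro!: nn_integral_cong simp: flip_shear_upd)
  also have "\<dots> = (\<integral>\<^sup>+x. \<integral>\<^sup>+s. f (x(n := s)) \<partial>lborel \<partial>lborel_n n)"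
  proof (rule nn_integral_cong)
    fix x assume "x \<in> space (lborel_n n)"
    then have m: "(\<lambda>s. f (x(n := s))) \<in> borel_measurable borel"
      using measurable_compose[OF measurable_section_point \<open>f \<in> _\<close>] by simp
    show "(\<integral>\<^sup>+s. f (x(n := e * s + - (\<Sum>j<n. v j * x j))) \<partial>lborel) = (\<integral>\<^sup>+s. f (x(n := s)) \<partial>lborel)"
      by (rule nn_integral_sign[OF e m])
  qed
  also have "\<dots> = (\<integral>\<^sup>+x. f x \<partial>lborel_n (Suc n))" by (subst nn_integral_lborel_Suc(1)) simp_all
  finally show "(\<integral>\<^sup>+x. f (flip_shear n e v x) \<partial>lborel_n (Suc n)) = (\<integral>\<^sup>+x. f x \<partial>lborel_n (Suc n))" .
qed simp

lemma nn_integral_distr_self: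
  assumes "distr M M T = M" "T \<in> M \<rightarrow>\<^sub>M M" "f \<in> borel_measurable M"
  shows "(\<integral>\<^sup>+x. f (T x) \<partial>M) = (\<integral>\<^sup>+x. f x \<partial>M)"
  using nn_integral_distr[of T M M f] assms by simp

lemma integral_distr_self:
  fixes f :: "_ \<Rightarrow> real"
  assumes "distr M M T = M" "T \<in> M \<rightarrow>\<^sub>M M" "f \<in> borel_measurable M"
  shows "(LINT x|M. f (T x)) = (LINT x|M. f x)"
  using integral_distr[of T M M f] assms by simp

text \<open>The multiplicative midpoint form admits zeros and avoids logarithms. Bounded values and
  bounded support make the moments finite; like log-concavity, they pass to sheared functions and to
  integrals over half-lines, so the class is stable under the induction.\<close>

definition log_concave_bounded :: "nat \<Rightarrow> ((nat \<Rightarrow> real) \<Rightarrow> real) \<Rightarrow> bool" where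
  "log_concave_bounded n f \<longleftrightarrow> f \<in> borel_measurable (lborel_n n) \<and> (\<forall>x\<in>Rn n. 0 \<le> f x) \<and>
     (\<exists>B R. \<forall>x\<in>Rn n. f x \<le> B \<and> (f x \<noteq> 0 \<longrightarrow> (\<forall>i<n. \<bar>x i\<bar> \<le> R))) \<and>
     (\<forall>x\<in>Rn n. \<forall>y\<in>Rn n. f x * f y \<le> (f (midpoint_n n x y))\<^sup>2)"

lemma midpoint_flip_coshear:
  "flip_coshear n e v (midpoint_n (Suc n) x y)
    = midpoint_n (Suc n) (flip_coshear n e v x) (flip_coshear n e v y)"
  by (auto simp: flip_coshear_def midpoint_n_def fun_eq_iff field_simps)

lemma log_concave_bounded_flip_coshear:
  assumes f: "log_concave_bounded (Suc n) f" and e: "e = 1 \<or> e = -1"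
  shows "log_concave_bounded (Suc n) (\<lambda>x. f (flip_coshear n e v x))"
proof -
  obtain B R where BR: "\<And>x. x \<in> Rn (Suc n) \<Longrightarrow> f x \<le> B"
    "\<And>x i. x \<in> Rn (Suc n) \<Longrightarrow> f x \<noteq> 0 \<Longrightarrow> i < Suc n \<Longrightarrow> \<bar>x i\<bar> \<le> R"
    using f unfolding log_concave_bounded_def by meson
  have [measurable]: "f \<in> borel_measurable (lborel_n (Suc n))"
    using f by (simp add: log_concave_bounded_def)
  \<comment> \<open>From the image \<open>y\<close>, the point is recovered by
    \<open>x n = e * y n\<close> and \<open>x i = y i - y n * v i\<close>; this sum bounds
    both.\<close>
  define R' where "R' = \<bar>R\<bar> + \<bar>R\<bar> * (\<Sum>j<n. \<bar>v j\<bar>)"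
  have "\<bar>x i\<bar> \<le> R'" if "f (flip_coshear n e v x) \<noteq> 0" and i: "i < Suc n" for x i
  proof -
    let ?y = "flip_coshear n e v x"
    have y: "\<bar>?y j\<bar> \<le> \<bar>R\<bar>" if "j < Suc n" for j
      using BR(2)[of ?y j] \<open>f ?y \<noteq> 0\<close> that by simp
    have yn: "?y n = e * x n" by (simp add: flip_coshear_def)
    then have xn: "\<bar>x n\<bar> \<le> \<bar>R\<bar>" using y[of n] e by (auto simp: abs_mult)
    have s0: "0 \<le> (\<Sum>j<n. \<bar>v j\<bar>)" by (intro sum_nonneg) simp
    show ?thesis
    proof (cases "i = n")
      case True
      then show ?thesis using xn s0 by (simp add: R'_def add_increasing2)
    next
      case False
      then have "x i = ?y i - ?y n * v i" using i by (simp add: flip_coshear_def)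
      then have "\<bar>x i\<bar> \<le> \<bar>?y i\<bar> + \<bar>?y n\<bar> * \<bar>v i\<bar>" by (simp add: abs_mult[symmetric])
      also have "\<dots> \<le> \<bar>R\<bar> + \<bar>R\<bar> * (\<Sum>j<n. \<bar>v j\<bar>)"
        using False i by (intro add_mono mult_mono y member_le_sum) auto
      finally show ?thesis by (simp add: R'_def)
    qed
  qed
  then have "\<exists>B R. \<forall>x\<in>Rn (Suc n). f (flip_coshear n e v x) \<le> B \<and> (f (flip_coshear n e v x) \<noteq> 0 \<longrightarrow> (\<forall>i<Suc n. \<bar>x i\<bar> \<le> R))"
    using BR(1) by (intro exI[of _ B] exI[of _ R']) auto
  moreover have "\<forall>x\<in>Rn (Suc n). \<forall>y\<in>Rn (Suc n). f (flip_coshear n e v x) * f (flip_coshear n e v y)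
      \<le> (f (flip_coshear n e v (midpoint_n (Suc n) x y)))\<^sup>2"
    using f by (simp add: midpoint_flip_coshear log_concave_bounded_def)
  moreover have "\<forall>x\<in>Rn (Suc n). 0 \<le> f (flip_coshear n e v x)"
    using f by (simp add: log_concave_bounded_def)
  ultimately show ?thesis unfolding log_concave_bounded_def by (auto intro: measurable_compose[OF measurable_flip_coshear])
qed

lemma emeasure_lborel_n_cube:
  "0 \<le> R \<Longrightarrow> emeasure (lborel_n n) ({..<n} \<rightarrow>\<^sub>E {-R..R}) = ennreal ((2 * R) ^ n)"
  by (subst lborel_prod.emeasure_PiM) (simp_all add: ennreal_power)

lemma integrable_lborel_n_bounded:
  fixes f :: "(nat \<Rightarrow> real) \<Rightarrow> real"
  assumes "f \<in> borel_measurable (lborel_n n)"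
    and "\<And>x. x \<in> Rn n \<Longrightarrow> \<bar>f x\<bar> \<le> B" "\<And>x i. x \<in> Rn n \<Longrightarrow> f x \<noteq> 0 \<Longrightarrow> i < n \<Longrightarrow> \<bar>x i\<bar> \<le> R"
  shows "integrable (lborel_n n) f"
proof (rule integrableI_bounded_set[where A="{..<n} \<rightarrow>\<^sub>E {-\<bar>R\<bar>..\<bar>R\<bar>}" and B=B])
  show "emeasure (lborel_n n) ({..<n} \<rightarrow>\<^sub>E {-\<bar>R\<bar>..\<bar>R\<bar>}) < \<infinity>"
    by (subst emeasure_lborel_n_cube) auto
  show "AE x in lborel_n n. x \<in> ({..<n} \<rightarrow>\<^sub>E {-\<bar>R\<bar>..\<bar>R\<bar>}) \<longrightarrow> norm (f x) \<le> B"
    using assms(2) by (intro AE_I2) auto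
  show "AE x in lborel_n n. x \<notin> ({..<n} \<rightarrow>\<^sub>E {-\<bar>R\<bar>..\<bar>R\<bar>}) \<longrightarrow> f x = 0"
  proof (intro AE_I2 impI, rule ccontr)
    fix x assume that: "x \<in> space (lborel_n n)" "x \<notin> ({..<n} \<rightarrow>\<^sub>E {-\<bar>R\<bar>..\<bar>R\<bar>})" and "f x \<noteq> 0"
    then have "\<bar>x i\<bar> \<le> \<bar>R\<bar>" if "i < n" for i using assms(3)[of x i] that \<open>x \<in> space _\<close> by auto
    with that show False by (auto simp: PiE_iff abs_le_iff minus_le_iff)
  qed
qed (use assms(1) in \<open>auto intro!: sets_PiM_I_finite\<close>)

section \<open>Log-concave functions on the line\<close>

lemma nn_integral_Ici_dilation:
  fixes f :: "real \<Rightarrow> ennreal"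
  assumes [measurable]: "f \<in> borel_measurable borel" and "0 < c"
  shows "(\<integral>\<^sup>+x. indicator {c * b + a..} x * f ((x - a) / c) \<partial>lborel) = ennreal c * (\<integral>\<^sup>+x. indicator {b..} x * f x \<partial>lborel)"
proof -
  have "(\<integral>\<^sup>+x. indicator {c * b + a..} x * f ((x - a) / c) \<partial>lborel)
    = ennreal \<bar>c\<bar> * (\<integral>\<^sup>+x. indicator {c * b + a..} (a + c * x) * f ((a + c * x - a) / c) \<partial>lborel)"
    using \<open>0 < c\<close> by (intro nn_integral_real_affine) auto
  also have "(\<integral>\<^sup>+x. indicator {c * b + a..} (a + c * x) * f ((a + c * x - a) / c) \<partial>lborel)
     = (\<integral>\<^sup>+x. indicator {b..} x * f x \<partial>lborel)"
    using \<open>0 < c\<close> by (intro nn_integral_cong) (auto simp: indicator_def)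
  finally show ?thesis using \<open>0 < c\<close> by simp
qed

lemma nn_integral_exp_half_line:
  assumes "0 < a"
  shows "(\<integral>\<^sup>+t. indicator {0..} t * ennreal (exp (- (a * t))) \<partial>lborel) = ennreal (1 / a)"
proof -
  have "(\<integral>\<^sup>+t. ennreal (exp (- (a * t))) * indicator {0..} t \<partial>lborel) = 0 - (- (exp (- (a * 0)) / a))"
  proof (rule nn_integral_FTC_atLeast)
    show "((\<lambda>t. - (exp (- (a * t)) / a)) \<longlongrightarrow> 0) at_top"
    proof -
      have "filterlim (\<lambda>t. a * t) at_top at_top"
        using assms by (simp add: filterlim_tendsto_pos_mult_at_top[OF tendsto_const _ filterlim_ident])
      then have "filterlim (\<lambda>t. - (a * t)) at_bot at_top" by (simp add: filterlim_uminus_at_bot)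
      from filterlim_compose[OF exp_at_bot this]
      have "((\<lambda>t. - (exp (- (a * t)) / a)) \<longlongrightarrow> - (0 / a)) at_top"
        by (intro tendsto_minus tendsto_divide tendsto_const) (use assms in auto)
      then show ?thesis by simp
    qed
    show "((\<lambda>t. - (exp (- (a * t)) / a)) has_real_derivative exp (- (a * t))) (at t)" for t
      using assms by (auto intro!: derivative_eq_intros)
  qed auto
  then show ?thesis by (simp add: mult.commute)
qed

text \<open>With \<open>L = I / M\<close>: were \<open>u\<close> below \<open>M / 8\<close> beyond \<open>L / 4\<close>, log-concavity around a near-maximizer
  would make the tail of \<open>u\<close> decay geometrically, and the total mass would fall short of \<open>M * L\<close>.\<close>

lemma log_concave_far_point:
  fixes u :: "real \<Rightarrow> real"
  assumes [measurable]: "u \<in> borel_measurable borel"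
    and u0: "\<And>s. 0 < s \<Longrightarrow> 0 \<le> u s" and bdd: "\<And>s. 0 < s \<Longrightarrow> u s \<le> B"
    and lc: "\<And>s t. 0 < s \<Longrightarrow> 0 < t \<Longrightarrow> u s * u t \<le> (u ((s + t) / 2))\<^sup>2"
    and I: "(\<integral>\<^sup>+s. indicator {0<..} s * ennreal (u s) \<partial>lborel) = ennreal I" "0 < I"
  obtains M s where "0 < M" "I / (4 * M) \<le> s" "M / 8 \<le> u s"
proof -
  define M where "M = (SUP s\<in>{0<..}. u s)"
  have bd: "bdd_above (u ` {0<..})" using bdd by (auto intro!: bdd_aboveI)
  have uM: "u s \<le> M" if "0 < s" for s unfolding M_def using that by (intro cSUP_upper bd) auto
  have M0: "0 < M"
  proof (rule ccontr)
    assume "\<not> 0 < M"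
    then have "u s = 0" if "0 < s" for s using uM[OF that] u0[OF that] by auto
    then have "(\<integral>\<^sup>+s. indicator {0<..} s * ennreal (u s) \<partial>lborel) = (\<integral>\<^sup>+s. 0 \<partial>(lborel :: real measure))"
      by (intro nn_integral_cong) (auto simp: indicator_def)
    then show False using I by simp
  qed
  define L where "L = I / M"
  have L0: "0 < L" using I M0 by (simp add: L_def)
  have "\<exists>s. L / 4 \<le> s \<and> M / 8 \<le> u s"
  proof (rule ccontr)
    assume "\<not> ?thesis"
    then have small: "u s < M / 8" if "L / 4 \<le> s" for s using that by force
    have "M / 2 < M" using M0 by simp
    then have "\<exists>s0\<in>{0<..}. M / 2 < u s0"
      using less_cSUP_iff[OF _ bd, of "M / 2"] unfolding M_def by auto
    then obtain s0 where s0: "0 < s0" "M / 2 < u s0" by auto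
    have s0L: "s0 < L / 4" using small[of s0] s0 M0 by (cases "L / 4 \<le> s0") auto
    define w where "w = (\<lambda>d. ennreal (u (s0 + d)))"
    have [measurable]: "w \<in> borel_measurable borel" by (simp add: w_def)
    define J where "J = (\<integral>\<^sup>+d. indicator {L/4..} d * w d \<partial>lborel)"
    have "J \<le> (\<integral>\<^sup>+s. indicator {0<..} s * ennreal (u s) \<partial>lborel)"
    proof -
      have "(\<integral>\<^sup>+s. indicator {0<..} s * ennreal (u s) \<partial>lborel)
         = (\<integral>\<^sup>+d. indicator {0<..} (s0 + 1 * d) * ennreal (u (s0 + 1 * d)) \<partial>lborel)"
        by (subst nn_integral_real_affine[where c=1 and t=s0]) auto
      then show ?thesis unfolding J_def w_def using s0 L0
        by (auto intro!: nn_integral_mono simp: indicator_def)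
    qed
    \<comment> \<open>Finiteness of \<open>J\<close> is what later allows \<open>Jr / 2\<close> to
      be absorbed into the left side.\<close>
    then have "J < \<infinity>" by (rule le_less_trans) (simp add: I)
    then obtain Jr where Jr: "J = ennreal Jr" "0 \<le> Jr" by (cases J) auto
    \<comment> \<open>Log-concavity at \<open>s0\<close>, \<open>s0 + d\<close>,
      \<open>s0 + 2 * d\<close>: the middle value is below \<open>M / 8\<close> and the first above
      \<open>M / 2\<close>, whence the factor 4.\<close>
    have dbl: "u (s0 + 2 * d) \<le> u (s0 + d) / 4" if "L / 4 \<le> d" for d
    proof -
      have d: "0 < d" using that L0 by auto
      have "u s0 * u (s0 + 2 * d) \<le> (u (s0 + d))\<^sup>2"
      proof -
        have mid: "(s0 + (s0 + 2 * d)) / 2 = s0 + d" by simp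
        show ?thesis using lc[of s0 "s0 + 2 * d"] s0 d unfolding mid by simp
      qed
      also have "\<dots> \<le> u (s0 + d) * (M / 8)"
        unfolding power2_eq_square using s0 d small[of "s0 + d"] that u0[of "s0 + d"]
        by (intro mult_left_mono) auto
      finally have "u s0 * u (s0 + 2 * d) \<le> u (s0 + d) * (M / 8)" .
      moreover have "M / 2 * u (s0 + 2 * d) \<le> u s0 * u (s0 + 2 * d)"
        using s0 d u0[of "s0 + 2 * d"] by (intro mult_right_mono) auto
      ultimately have "M * u (s0 + 2 * d) \<le> M * (u (s0 + d) / 4)" by (simp add: field_simps)
      then show ?thesis using M0 by simp
    qed
    \<comment> \<open>Halving the variable costs a factor 2 and \<open>dbl\<close> gains a factor 4,
      so the tail beyond \<open>L / 2\<close> carries at most half of \<open>J\<close>.\<close>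
    have J2: "(\<integral>\<^sup>+d. indicator {L/2..} d * w d \<partial>lborel) \<le> ennreal (Jr / 2)"
    proof -
      have "(\<integral>\<^sup>+d. indicator {L/2..} d * w d \<partial>lborel)
          = 2 * (\<integral>\<^sup>+d. indicator {L/4..} d * w (2 * d) \<partial>lborel)"
        using nn_integral_Ici_dilation[of "\<lambda>d. w (2 * d)" 2 "L/4" 0] by simp
      also have "\<dots> \<le> 2 * (\<integral>\<^sup>+d. ennreal (1/4) * (indicator {L/4..} d * w d) \<partial>lborel)"
      proof (intro mult_left_mono nn_integral_mono)
        fix d show "indicator {L/4..} d * w (2 * d) \<le> ennreal (1/4) * (indicator {L/4..} d * w d)"
          using dbl[of d] by (auto simp: indicator_def w_def ennreal_mult'[symmetric] intro!: ennreal_leI)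
      qed simp
      also have "\<dots> = 2 * (ennreal (1/4) * J)" unfolding J_def by (subst nn_integral_cmult) auto
      also have "\<dots> = ennreal (2 * (1/4 * Jr))" using Jr by (simp only: Jr ennreal_mult'[symmetric] flip: ennreal_numeral)
      finally show ?thesis by simp
    qed
    have "J \<le> (\<integral>\<^sup>+d. ennreal (M/8) * indicator {L/4..L/2} d + indicator {L/2..} d * w d \<partial>lborel)"
      unfolding J_def
    proof (intro nn_integral_mono)
      fix d
      show "indicator {L/4..} d * w d \<le> ennreal (M/8) * indicator {L/4..L/2} d + indicator {L/2..} d * w d"
        using small[of "s0 + d"] s0 L0
        by (auto simp: indicator_def w_def add_increasing intro!: ennreal_leI)
    qed
    also have "\<dots> = ennreal (M/8) * ennreal (L/4) + (\<integral>\<^sup>+d. indicator {L/2..} d * w d \<partial>lborel)"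
      using L0 by (subst nn_integral_add) (auto simp: nn_integral_cmult_indicator)
    also have "\<dots> \<le> ennreal (M/8) * ennreal (L/4) + ennreal (Jr / 2)" by (intro add_left_mono J2)
    also have "\<dots> = ennreal (M/8 * (L/4) + Jr / 2)" using M0 L0 Jr
      by (simp add: ennreal_mult'[symmetric] flip: ennreal_plus)
    finally have "Jr \<le> M/8 * (L/4) + Jr / 2" using Jr M0 L0 unfolding Jr(1) by (subst (asm) ennreal_le_iff) auto
    then have Jr_le: "Jr \<le> M * L / 16" by simp
    \<comment> \<open>The mass up to \<open>s0 + L / 4\<close> is at most \<open>M * L / 2\<close>
      and the rest at most \<open>M * L / 16\<close>, together less than
      \<open>I = M * L\<close>.\<close>
    have "ennreal I = (\<integral>\<^sup>+d. indicator {0<..} (s0 + 1 * d) * ennreal (u (s0 + 1 * d)) \<partial>lborel)"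
      unfolding I(1)[symmetric] by (subst nn_integral_real_affine[where c=1 and t=s0]) auto
    also have "\<dots> \<le> (\<integral>\<^sup>+d. ennreal M * indicator {-s0..L/4} d + indicator {L/4..} d * w d \<partial>lborel)"
    proof (intro nn_integral_mono)
      fix d
      show "indicator {0<..} (s0 + 1 * d) * ennreal (u (s0 + 1 * d))
          \<le> ennreal M * indicator {-s0..L/4} d + indicator {L/4..} d * w d"
        using uM[of "s0 + d"]
        by (auto simp: indicator_def w_def add_increasing intro!: ennreal_leI)
    qed
    also have "\<dots> = ennreal M * ennreal (L/4 + s0) + J"
      using L0 s0 unfolding J_def by (subst nn_integral_add) (auto simp: nn_integral_cmult_indicator)
    also have "\<dots> = ennreal (M * (L/4 + s0) + Jr)" using M0 L0 Jr s0
      by (simp add: ennreal_mult'[symmetric] flip: ennreal_plus)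
    finally have "I \<le> M * (L/4 + s0) + Jr" using M0 L0 s0 Jr by (subst (asm) ennreal_le_iff) auto
    also have "\<dots> \<le> M * (L / 2) + M * L / 16"
      using s0L M0 Jr_le by (intro add_mono mult_left_mono) auto
    also have "\<dots> < M * L" using M0 L0 by simp
    finally show False using M0 by (simp add: L_def)
  qed
  then obtain s where "L / 4 \<le> s" "M / 8 \<le> u s" by auto
  then show thesis using that[of M s] M0 by (simp add: L_def mult.commute)
qed

text \<open>At the point \<open>s\<close> supplied by \<open>log_concave_far_point\<close>, duality
  bounds \<open>w t\<close> by \<open>(8 * k / M) * exp (- (a * t))\<close> with
  \<open>a = I / (4 * M)\<close>. Integrating over \<open>t\<close> gives a factor
  \<open>1 / a\<close>, and \<open>8 * 4 = 32\<close>.\<close>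

theorem half_line_santalo:
  fixes u :: "real \<Rightarrow> real" and w :: "real \<Rightarrow> ennreal"
  assumes [measurable]: "u \<in> borel_measurable borel"
    and u0: "\<And>s. 0 < s \<Longrightarrow> 0 \<le> u s" and bdd: "\<And>s. 0 < s \<Longrightarrow> u s \<le> B"
    and lc: "\<And>s t. 0 < s \<Longrightarrow> 0 < t \<Longrightarrow> u s * u t \<le> (u ((s + t) / 2))\<^sup>2"
    and I: "(\<integral>\<^sup>+s. indicator {0<..} s * ennreal (u s) \<partial>lborel) = ennreal I" "0 \<le> I"
    and k: "0 \<le> k" and dual: "\<And>s t. 0 < s \<Longrightarrow> 0 \<le> t \<Longrightarrow> ennreal (u s) * w t \<le> ennreal (k * exp (- (s * t)))"
  shows "ennreal I * (\<integral>\<^sup>+t. indicator {0..} t * w t \<partial>lborel) \<le> ennreal (32 * k)"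
proof (cases "I = 0")
  case False
  with I have I0: "0 < I" by simp
  obtain M s where s: "0 < M" "I / (4 * M) \<le> s" "M / 8 \<le> u s"
    using log_concave_far_point[OF assms(1) u0 bdd lc I(1) I0] by auto
  define a where "a = I / (4 * M)"
  have a: "0 < a" using I0 s by (simp add: a_def)
  have w: "w t \<le> ennreal (8 * k / M) * ennreal (exp (- (a * t)))" if "0 \<le> t" for t
  proof -
    have "w t = ennreal (8 / M) * (ennreal (M / 8) * w t)"
      using s by (simp add: mult.assoc[symmetric] ennreal_mult'[symmetric])
    also have "\<dots> \<le> ennreal (8 / M) * (ennreal (u s) * w t)"
      using s by (intro mult_left_mono mult_right_mono ennreal_leI) auto
    also have "\<dots> \<le> ennreal (8 / M) * ennreal (k * exp (- (s * t)))"
      using s a that by (intro mult_left_mono dual) (auto simp: a_def)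
    also have "\<dots> \<le> ennreal (8 / M) * ennreal (k * exp (- (a * t)))"
    proof -
      have "a * t \<le> s * t" using s that by (intro mult_right_mono) (auto simp: a_def)
      then show ?thesis using k by (intro mult_left_mono ennreal_leI) auto
    qed
    also have "\<dots> = ennreal (8 * k / M) * ennreal (exp (- (a * t)))"
      using s k by (simp add: ennreal_mult'[symmetric])
    finally show ?thesis .
  qed
  have "(\<integral>\<^sup>+t. indicator {0..} t * w t \<partial>lborel)
      \<le> (\<integral>\<^sup>+t. ennreal (8 * k / M) * (indicator {0..} t * ennreal (exp (- (a * t)))) \<partial>lborel)"
    using w by (intro nn_integral_mono) (auto simp: indicator_def)
  also have "\<dots> = ennreal (8 * k / M) * ennreal (1 / a)"
    by (subst nn_integral_cmult) (auto simp: nn_integral_exp_half_line[OF a])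
  finally have "ennreal I * (\<integral>\<^sup>+t. indicator {0..} t * w t \<partial>lborel) \<le> ennreal I * (ennreal (8 * k / M) * ennreal (1 / a))"
    by (intro mult_left_mono) auto
  also have "\<dots> = ennreal (I * (8 * k / M * (1 / a)))"
    using I0 s k a by (simp add: ennreal_mult'[symmetric])
  also have "I * (8 * k / M * (1 / a)) = 32 * k" using I0 s by (simp add: a_def)
  finally show ?thesis .
qed simp

text \<open>Here \<open>T\<close> is the tail of a distribution of mass \<open>m\<close> with mean 0 and first absolute moment
  \<open>2 E\<close>; by Markov's inequality at least half of the mass lies above \<open>- 2 E / m\<close>.\<close>

lemma log_concave_tail_at_mean:
  fixes T :: "real \<Rightarrow> real"
  assumes T0: "\<And>x. 0 \<le> T x" and anti: "antimono T"
    and lc: "\<And>x y. T x * T y \<le> (T ((x + y) / 2))\<^sup>2"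
    and E: "(\<integral>\<^sup>+x. indicator {0..} x * ennreal (T x) \<partial>lborel) = ennreal E" "0 < E"
    and m: "0 < m" "m / 2 \<le> T (- (2 * E / m))"
  shows "m \<le> 6 * T 0"
proof -
  have "(\<lambda>x. - T x) \<in> borel_measurable borel"
    using anti by (intro borel_measurable_mono) (auto simp: mono_def antimono_def)
  then have [measurable]: "T \<in> borel_measurable borel" by simp
  define a where "a = 2 * E / m"
  have a: "0 < a" using E m by (simp add: a_def)
  define c where "c = 2 * T 0 / m"
  have c: "0 \<le> c" using T0 m by (simp add: c_def)
  \<comment> \<open>Log-concavity between \<open>-a\<close> and \<open>x\<close>, whose midpoint is
    nonnegative: one factor of the square is replaced by \<open>T 0\<close>, and
    \<open>T (-a)\<close> is at least \<open>m / 2\<close>.\<close>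
  have far: "T x \<le> c * T ((x - a) / 2)" if "a \<le> x" for x
  proof -
    have "T (-a) * T x \<le> (T ((x - a) / 2))\<^sup>2" using lc[of "-a" x] by simp
    also have "\<dots> \<le> T 0 * T ((x - a) / 2)"
      unfolding power2_eq_square using that by (intro mult_right_mono T0 antimonoD[OF anti]) auto
    finally have "T (-a) * T x \<le> T 0 * T ((x - a) / 2)" .
    moreover have "m / 2 * T x \<le> T (-a) * T x" using m by (intro mult_right_mono T0) (auto simp: a_def)
    ultimately have "m / 2 * T x \<le> T 0 * T ((x - a) / 2)" by linarith
    then show ?thesis using m by (simp add: c_def field_simps)
  qed
  have "ennreal E \<le> (\<integral>\<^sup>+x. ennreal (T 0) * indicator {0..<a} x + ennreal c * (indicator {a..} x * ennreal (T ((x - a) / 2))) \<partial>lborel)"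
    unfolding E(1)[symmetric]
  proof (intro nn_integral_mono)
    fix x
    show "indicator {0..} x * ennreal (T x) \<le> ennreal (T 0) * indicator {0..<a} x + ennreal c * (indicator {a..} x * ennreal (T ((x - a) / 2)))"
      using far[of x] antimonoD[OF anti, of 0 x] c a
      by (auto simp: indicator_def ennreal_mult'[symmetric] add_increasing add_increasing2 intro!: ennreal_leI)
  qed
  also have "\<dots> = ennreal (T 0) * ennreal a + ennreal c * (\<integral>\<^sup>+x. indicator {a..} x * ennreal (T ((x - a) / 2)) \<partial>lborel)"
    using a by (subst nn_integral_add) (auto simp: nn_integral_cmult_indicator nn_integral_cmult)
  also have "(\<integral>\<^sup>+x. indicator {a..} x * ennreal (T ((x - a) / 2)) \<partial>lborel) = ennreal 2 * ennreal E"
    using nn_integral_Ici_dilation[of "\<lambda>x. ennreal (T x)" 2 0 a] E by simp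
  also have "ennreal (T 0) * ennreal a + ennreal c * (ennreal 2 * ennreal E) = ennreal (T 0 * a + c * (2 * E))"
    using T0 a c E by (simp add: ennreal_mult'[symmetric] flip: ennreal_plus ennreal_numeral)
  finally have "E \<le> T 0 * a + c * (2 * E)"
    using T0[of 0] a c E by (subst (asm) ennreal_le_iff) auto
  \<comment> \<open>The two terms are \<open>2 * E * T 0 / m\<close> and
    \<open>4 * E * T 0 / m\<close>, which add up to the 6.\<close>
  then have "m * E \<le> (6 * T 0) * E" using m by (simp add: a_def c_def field_simps)
  then show ?thesis using E by simp
qed

section \<open>The functional Santalo inequality\<close>

lemma log_concave_boundedE:
  assumes "log_concave_bounded n f"
  obtains B R where "0 \<le> B" "0 \<le> R" "\<And>x. x \<in> Rn n \<Longrightarrow> 0 \<le> f x" "\<And>x. x \<in> Rn n \<Longrightarrow> f x \<le> B"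
    "\<And>x i. x \<in> Rn n \<Longrightarrow> f x \<noteq> 0 \<Longrightarrow> i < n \<Longrightarrow> \<bar>x i\<bar> \<le> R"
proof -
  obtain B R where BR: "\<And>x. x \<in> Rn n \<Longrightarrow> f x \<le> B"
    "\<And>x i. x \<in> Rn n \<Longrightarrow> f x \<noteq> 0 \<Longrightarrow> i < n \<Longrightarrow> \<bar>x i\<bar> \<le> R"
    and f0: "\<And>x. x \<in> Rn n \<Longrightarrow> 0 \<le> f x"
    using assms unfolding log_concave_bounded_def by meson
  have "f x \<le> \<bar>B\<bar>" if "x \<in> Rn n" for x using BR(1)[OF that] by linarith
  moreover have "\<bar>x i\<bar> \<le> \<bar>R\<bar>" if "x \<in> Rn n" "f x \<noteq> 0" "i < n" for x i using BR(2)[OF that] by linarith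
  ultimately show thesis using that[of "\<bar>B\<bar>" "\<bar>R\<bar>"] f0 by auto
qed

lemma log_concave_bounded_measurable:
  "log_concave_bounded n f \<Longrightarrow> f \<in> borel_measurable (lborel_n n)"
  by (simp add: log_concave_bounded_def)

lemma log_concave_bounded_integrable:
  assumes f: "log_concave_bounded n f" and h: "h \<in> borel_measurable (lborel_n n)"
    and h1: "\<And>x. x \<in> Rn n \<Longrightarrow> \<bar>h x\<bar> \<le> (1::real)"
  shows "integrable (lborel_n n) (\<lambda>x. h x * f x)"
    and "i < n \<Longrightarrow> integrable (lborel_n n) (\<lambda>x. h x * (x i * f x))"
proof -
  obtain B R where BR: "0 \<le> B" "0 \<le> R" "\<And>x. x \<in> Rn n \<Longrightarrow> 0 \<le> f x" "\<And>x. x \<in> Rn n \<Longrightarrow> f x \<le> B"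
    "\<And>x i. x \<in> Rn n \<Longrightarrow> f x \<noteq> 0 \<Longrightarrow> i < n \<Longrightarrow> \<bar>x i\<bar> \<le> R"
    using f by (rule log_concave_boundedE) blast
  note [measurable] = h log_concave_bounded_measurable[OF f]
  show "integrable (lborel_n n) (\<lambda>x. h x * f x)"
  proof (rule integrable_lborel_n_bounded)
    show "\<bar>h x * f x\<bar> \<le> 1 * B" if "x \<in> Rn n" for x
      unfolding abs_mult using h1[OF that] BR(3,4)[OF that] by (intro mult_mono) auto
    show "\<bar>x i\<bar> \<le> R" if "x \<in> Rn n" "h x * f x \<noteq> 0" "i < n" for x i using BR(5) that by auto
  qed measurable
  assume i: "i < n"
  show "integrable (lborel_n n) (\<lambda>x. h x * (x i * f x))"
  proof (rule integrable_lborel_n_bounded)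
    show "\<bar>h x * (x i * f x)\<bar> \<le> 1 * (R * B)" if "x \<in> Rn n" for x
    proof (cases "f x = 0")
      case False
      then show ?thesis unfolding abs_mult
        using h1[OF that] BR(1-4) BR(3,4)[OF that] BR(5)[OF that False i] by (intro mult_mono) auto
    qed (use BR in auto)
    show "\<bar>x j\<bar> \<le> R" if "x \<in> Rn n" "h x * (x i * f x) \<noteq> 0" "j < n" for x j using BR(5) that by auto
    show "(\<lambda>x. h x * (x i * f x)) \<in> borel_measurable (lborel_n n)"
      using measurable_component_n[OF i] by measurable
  qed
qed

text \<open>One-dimensional Prekopa-Leindler on sections; the restriction to \<open>0 < s\<close> is
  compatible with it since midpoints of positive heights are positive. \<open>F\<close> is a Bochner
  integral because \<open>log_concave_bounded\<close> speaks of real functions, and the second part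
  passes to the \<open>ennreal\<close> integrals in which masses are computed.\<close>

lemma positive_section_log_concave:
  assumes f: "log_concave_bounded (Suc n) f"
  defines "F \<equiv> \<lambda>x. LINT s|lborel. indicator {0<..} s * f (x(n := s))"
  shows "log_concave_bounded n F"
    and "x \<in> Rn n \<Longrightarrow> ennreal (F x) = (\<integral>\<^sup>+s. indicator {0<..} s * ennreal (f (x(n := s))) \<partial>lborel)"
proof -
  obtain B R where BR: "0 \<le> B" "0 \<le> R" "\<And>x. x \<in> Rn (Suc n) \<Longrightarrow> 0 \<le> f x" "\<And>x. x \<in> Rn (Suc n) \<Longrightarrow> f x \<le> B"
    "\<And>x i. x \<in> Rn (Suc n) \<Longrightarrow> f x \<noteq> 0 \<Longrightarrow> i < Suc n \<Longrightarrow> \<bar>x i\<bar> \<le> R"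
    using f by (rule log_concave_boundedE) blast
  note fm = log_concave_bounded_measurable[OF f]
  have sm: "(\<lambda>s. f (x(n := s))) \<in> borel_measurable borel" if "x \<in> Rn n" for x
    using measurable_compose[OF measurable_section_point[OF that] fm] .
  have supp: "\<bar>s\<bar> \<le> R" if "x \<in> Rn n" "f (x(n := s)) \<noteq> 0" for x s
    using BR(5)[OF fun_upd_Rn[OF that(1)] that(2), of n] by simp
  have f_nn: "0 \<le> f (x(n := s))" "f (x(n := s)) \<le> B" if "x \<in> Rn n" for x s
    using BR(3,4) fun_upd_Rn[OF that] by auto
  have int: "integrable lborel (\<lambda>s. indicator {0<..} s * f (x(n := s)))" if x: "x \<in> Rn n" for x
  proof (rule integrableI_bounded_set[where A="{-R..R}" and B=B])
    show "AE s in lborel. s \<in> {-R..R} \<longrightarrow> norm (indicator {0<..} s * f (x(n := s))) \<le> B"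
      using f_nn[OF x] BR(1) by (intro AE_I2) (auto simp: indicator_def)
    show "AE s in lborel. s \<notin> {-R..R} \<longrightarrow> indicator {0<..} s * f (x(n := s)) = 0"
      using supp[OF x] by (intro AE_I2) (fastforce simp: abs_le_iff minus_le_iff)
    show "(\<lambda>s. indicator {0<..} s * f (x(n := s))) \<in> borel_measurable lborel"
      using sm[OF x] by simp
  qed (use BR in auto)
  have F: "ennreal (F x) = (\<integral>\<^sup>+s. indicator {0<..} s * ennreal (f (x(n := s))) \<partial>lborel)" if x: "x \<in> Rn n" for x
  proof -
    have "ennreal (F x) = (\<integral>\<^sup>+s. ennreal (indicator {0<..} s * f (x(n := s))) \<partial>lborel)"
      unfolding F_def using f_nn[OF x] by (intro nn_integral_eq_integral[OF int[OF x], symmetric]) auto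
    also have "\<dots> = (\<integral>\<^sup>+s. indicator {0<..} s * ennreal (f (x(n := s))) \<partial>lborel)"
      by (intro nn_integral_cong) (auto simp: indicator_def)
    finally show ?thesis .
  qed
  then show "x \<in> Rn n \<Longrightarrow> ennreal (F x) = (\<integral>\<^sup>+s. indicator {0<..} s * ennreal (f (x(n := s))) \<partial>lborel)" .
  have F0: "0 \<le> F x" if "x \<in> Rn n" for x
    unfolding F_def using f_nn[OF that] by (intro integral_nonneg_AE AE_I2) auto
  have FB: "F x \<le> B * (2 * R)" if x: "x \<in> Rn n" for x
  proof -
    have "ennreal (F x) \<le> (\<integral>\<^sup>+s. ennreal B * indicator {-R..R} s \<partial>lborel)"
      unfolding F[OF x]
    proof (intro nn_integral_mono)
      fix s
      show "indicator {0<..} s * ennreal (f (x(n := s))) \<le> ennreal B * indicator {-R..R} s"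
        using f_nn[OF x, of s] supp[OF x, of s]
        by (cases "f (x(n := s)) = 0") (auto simp: indicator_def abs_le_iff intro: ennreal_leI)
    qed
    also have "\<dots> = ennreal (B * (2 * R))" using BR by (simp add: nn_integral_cmult_indicator ennreal_mult)
    finally show ?thesis using BR by (simp add: ennreal_le_iff)
  qed
  have FR: "\<bar>x i\<bar> \<le> R" if x: "x \<in> Rn n" "F x \<noteq> 0" and i: "i < n" for x i
  proof -
    obtain s where "f (x(n := s)) \<noteq> 0" using x(2) unfolding F_def by fastforce
    from BR(5)[OF fun_upd_Rn[OF x(1)] this, of i] i show ?thesis by simp
  qed
  have Fm: "F \<in> borel_measurable (lborel_n n)"
    unfolding F_def
  proof (rule lborel.borel_measurable_lebesgue_integral)
    show "(\<lambda>(x, s). indicator {0<..} s * f (x(n := s))) \<in> borel_measurable (lborel_n n \<Otimes>\<^sub>M lborel)"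
      using measurable_compose[OF measurable_fun_upd_Suc fm]
      by (simp add: case_prod_beta' borel_measurable_times)
  qed
  have Flc: "F x * F y \<le> (F (midpoint_n n x y))\<^sup>2" if x: "x \<in> Rn n" and y: "y \<in> Rn n" for x y
  proof -
    let ?u = "\<lambda>x s. indicator {0<..} s * ennreal (f (x(n := s)))"
    have "(\<integral>\<^sup>+s. ?u x s \<partial>lborel) * (\<integral>\<^sup>+s. ?u y s \<partial>lborel) \<le> (\<integral>\<^sup>+s. ?u (midpoint_n n x y) s \<partial>lborel)\<^sup>2"
    proof (rule prekopa_leindler_real)
      show "?u x s * ?u y t \<le> (?u (midpoint_n n x y) ((s + t) / 2))\<^sup>2" for s t
      proof (cases "0 < s \<and> 0 < t")
        case True
        have "f (x(n := s)) * f (y(n := t)) \<le> (f ((midpoint_n n x y)(n := (s + t) / 2)))\<^sup>2"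
          using f fun_upd_Rn[OF x] fun_upd_Rn[OF y]
          by (simp add: log_concave_bounded_def midpoint_upd[symmetric] del: fun_upd_apply)
        then have "ennreal (f (x(n := s)) * f (y(n := t))) \<le> ennreal ((f ((midpoint_n n x y)(n := (s + t) / 2)))\<^sup>2)"
          by (rule ennreal_leI)
        moreover have "ennreal ((f ((midpoint_n n x y)(n := (s + t) / 2)))\<^sup>2) = (ennreal (f ((midpoint_n n x y)(n := (s + t) / 2))))\<^sup>2"
          using f_nn by (intro ennreal_power[symmetric]) simp
        ultimately show ?thesis using True f_nn x y by (simp add: ennreal_mult)
      qed auto
    qed (use sm x y in auto)
    then have "ennreal (F x) * ennreal (F y) \<le> (ennreal (F (midpoint_n n x y)))\<^sup>2"
      using F x y by simp
    also have "\<dots> = ennreal ((F (midpoint_n n x y))\<^sup>2)" using F0 by (intro ennreal_power) simp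
    finally show ?thesis using F0 x y by (simp add: ennreal_mult'[symmetric] ennreal_le_iff)
  qed
  show "log_concave_bounded n F"
    unfolding log_concave_bounded_def using Fm F0 FB FR Flc by blast
qed

lemma inner_n_upd: "inner_n (Suc n) (x(n := s)) (y(n := t)) = inner_n n x y + s * t"
  by (simp add: inner_n_def)

lemma AE_lborel_n_last_nonzero: "AE x in lborel_n (Suc n). x n \<noteq> 0"
proof (rule AE_I')
  let ?Z = "Pi\<^sub>E {..<Suc n} (\<lambda>i. if i = n then {0::real} else UNIV)"
  have "emeasure (lborel_n (Suc n)) ?Z = (\<Prod>i<Suc n. emeasure lborel (if i = n then {0::real} else UNIV))"
    by (rule lborel_prod.emeasure_PiM) auto
  also have "\<dots> = 0" by simp
  finally show "?Z \<in> null_sets (lborel_n (Suc n))" by (auto intro!: null_setsI sets_PiM_I_finite)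
  show "{x \<in> space (lborel_n (Suc n)). \<not> x n \<noteq> 0} \<subseteq> ?Z" by (auto simp: PiE_iff extensional_def)
qed

text \<open>The functional form of the inequality: for \<open>f = indicator K\<close> the largest
  admissible \<open>g\<close> is \<open>exp (- h)\<close> with \<open>h\<close> the support function
  of \<open>K\<close>. \<open>g\<close> is \<open>ennreal\<close>-valued because the partial
  integrals that take its place in the induction are not known to be finite.\<close>

definition santalo_bound :: "nat \<Rightarrow> ennreal \<Rightarrow> bool" where
  "santalo_bound n C \<longleftrightarrow> (\<forall>f g. log_concave_bounded n f \<longrightarrow>
     (\<forall>i<n. (LINT x|lborel_n n. x i * f x) = 0) \<longrightarrow> g \<in> borel_measurable (lborel_n n) \<longrightarrow>
     (\<forall>x\<in>Rn n. \<forall>y\<in>Rn n. ennreal (f x) * g y \<le> ennreal (exp (- inner_n n x y))) \<longrightarrow>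
     (\<integral>\<^sup>+x. f x \<partial>lborel_n n) * (\<integral>\<^sup>+y. g y \<partial>lborel_n n) \<le> C)"

lemma santalo_boundD:
  assumes "santalo_bound n C" "log_concave_bounded n f"
    and "\<And>i. i < n \<Longrightarrow> (LINT x|lborel_n n. x i * f x) = 0" "g \<in> borel_measurable (lborel_n n)"
    and "\<And>x y. x \<in> Rn n \<Longrightarrow> y \<in> Rn n \<Longrightarrow> ennreal (f x) * g y \<le> ennreal (exp (- inner_n n x y))"
  shows "(\<integral>\<^sup>+x. f x \<partial>lborel_n n) * (\<integral>\<^sup>+y. g y \<partial>lborel_n n) \<le> C"
  using assms unfolding santalo_bound_def by blast

text \<open>Integration along the last axis gives \<open>F\<close> over \<open>s > 0\<close> and
  \<open>G\<close> over \<open>t \<ge> 0\<close>. For fixed \<open>x\<close> and \<open>y\<close>,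
  the half-line inequality with \<open>k = exp (- inner_n n x y)\<close> makes \<open>F\<close> and
  \<open>G / 32\<close> a dual pair in dimension \<open>n\<close>. The hypothesis
  \<open>bary\<close> puts the barycenter of the half on the last axis, so that \<open>F\<close> has
  barycenter 0 and \<open>C\<close> applies.\<close>

lemma half_space_santalo:
  assumes C: "santalo_bound n C"
    and f: "log_concave_bounded (Suc n) f"
    and bary: "\<And>i. i < n \<Longrightarrow> (LINT x|lborel_n (Suc n). indicator {0<..} (x n) * (x i * f x)) = 0"
    and g: "g \<in> borel_measurable (lborel_n (Suc n))"
    and dual: "\<And>x y. x \<in> Rn (Suc n) \<Longrightarrow> y \<in> Rn (Suc n) \<Longrightarrow> ennreal (f x) * g y \<le> ennreal (exp (- inner_n (Suc n) x y))"
  shows "(\<integral>\<^sup>+x. indicator {0<..} (x n) * ennreal (f x) \<partial>lborel_n (Suc n))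
      * (\<integral>\<^sup>+y. indicator {0..} (y n) * g y \<partial>lborel_n (Suc n)) \<le> 32 * C"
proof -
  define F where "F = (\<lambda>x. LINT s|lborel. indicator {0<..} s * f (x(n := s)))"
  define G where "G = (\<lambda>y. \<integral>\<^sup>+t. indicator {0..} t * g (y(n := t)) \<partial>lborel)"
  have F_lc: "log_concave_bounded n F"
    unfolding F_def by (rule positive_section_log_concave(1)[OF f])
  have F_eq: "ennreal (F x) = (\<integral>\<^sup>+s. indicator {0<..} s * ennreal (f (x(n := s))) \<partial>lborel)" if "x \<in> Rn n" for x
    unfolding F_def by (rule positive_section_log_concave(2)[OF f that])
  obtain B R where BR: "\<And>x. x \<in> Rn (Suc n) \<Longrightarrow> 0 \<le> f x" "\<And>x. x \<in> Rn (Suc n) \<Longrightarrow> f x \<le> B"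
    using f by (rule log_concave_boundedE) blast
  note fm = log_concave_bounded_measurable[OF f]
  have xn: "(\<lambda>x. x n) \<in> borel_measurable (lborel_n (Suc n))"
    by (rule measurable_component_n) simp
  have F_int: "(\<integral>\<^sup>+x. indicator {0<..} (x n) * ennreal (f x) \<partial>lborel_n (Suc n)) = (\<integral>\<^sup>+x. F x \<partial>lborel_n n)"
  proof (subst nn_integral_lborel_Suc(1))
    show "(\<lambda>x. indicator {0<..} (x n) * ennreal (f x)) \<in> borel_measurable (lborel_n (Suc n))"
      using fm xn by (intro borel_measurable_times_ennreal measurable_compose[OF xn] measurable_compose[OF fm]) simp_all
  next
    show "(\<integral>\<^sup>+x. \<integral>\<^sup>+s. indicator {0<..} ((x(n := s)) n) * ennreal (f (x(n := s))) \<partial>lborel \<partial>lborel_n n) = (\<integral>\<^sup>+x. F x \<partial>lborel_n n)"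
      by (rule nn_integral_cong) (simp add: F_eq)
  qed
  have G_int: "(\<integral>\<^sup>+y. indicator {0..} (y n) * g y \<partial>lborel_n (Suc n)) = (\<integral>\<^sup>+y. G y \<partial>lborel_n n)"
  proof (subst nn_integral_lborel_Suc(1))
    show "(\<lambda>x. indicator {0..} (x n) * g x) \<in> borel_measurable (lborel_n (Suc n))"
      using g xn by (intro borel_measurable_times_ennreal measurable_compose[OF xn]) simp_all
  next
    show "(\<integral>\<^sup>+x. \<integral>\<^sup>+s. indicator {0..} ((x(n := s)) n) * g (x(n := s)) \<partial>lborel \<partial>lborel_n n) = (\<integral>\<^sup>+x. G x \<partial>lborel_n n)"
      by (rule nn_integral_cong) (simp add: G_def)
  qed
  have Gm[measurable]: "G \<in> borel_measurable (lborel_n n)"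
    unfolding G_def
  proof (rule lborel.borel_measurable_nn_integral)
    show "(\<lambda>(y, t). indicator {0..} t * g (y(n := t))) \<in> borel_measurable (lborel_n n \<Otimes>\<^sub>M lborel)"
      using measurable_compose[OF measurable_fun_upd_Suc g]
      by (simp add: case_prod_beta' borel_measurable_times)
  qed
  have FG: "ennreal (F x) * G y \<le> ennreal (32 * exp (- inner_n n x y))" if x: "x \<in> Rn n" and y: "y \<in> Rn n" for x y
    unfolding G_def
  proof (rule half_line_santalo[where u="\<lambda>s. f (x(n := s))" and B=B])
    show "(\<lambda>s. f (x(n := s))) \<in> borel_measurable borel"
      using measurable_compose[OF measurable_section_point[OF x] fm] .
    show "0 \<le> f (x(n := s))" "f (x(n := s)) \<le> B" for s using BR fun_upd_Rn[OF x] by auto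
    show "f (x(n := s)) * f (x(n := t)) \<le> (f (x(n := (s + t) / 2)))\<^sup>2" for s t
    proof -
      have "midpoint_n n x x = x" using x by (auto simp: midpoint_n_def PiE_iff extensional_def)
      then show ?thesis using f fun_upd_Rn[OF x] midpoint_upd[of n x s x t]
        unfolding log_concave_bounded_def by metis
    qed
    show "(\<integral>\<^sup>+s. indicator {0<..} s * ennreal (f (x(n := s))) \<partial>lborel) = ennreal (F x)" using F_eq[OF x] by simp
    show "0 \<le> F x" using F_lc x by (simp add: log_concave_bounded_def)
    show "ennreal (f (x(n := s))) * g (y(n := t)) \<le> ennreal (exp (- inner_n n x y) * exp (- (s * t)))" for s t
      using dual[OF fun_upd_Rn[OF x] fun_upd_Rn[OF y], of s t]
      by (simp add: inner_n_upd exp_add[symmetric])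
  qed simp
  have "(\<integral>\<^sup>+x. F x \<partial>lborel_n n) * (\<integral>\<^sup>+y. ennreal (1/32) * G y \<partial>lborel_n n) \<le> C"
  proof (rule santalo_boundD[OF C F_lc])
    fix i assume i: "i < n"
    let ?h = "\<lambda>x. indicator {0<..} (x n) * (x i * f x)"
    have "integrable (lborel_n (Suc n)) ?h"
      using i by (intro log_concave_bounded_integrable[OF f]) (auto simp: indicator_def intro: measurable_compose[OF xn])
    then have "(LINT x|lborel_n (Suc n). ?h x) = (LINT x|lborel_n n. LINT s|lborel. ?h (x(n := s)))"
      using lborel_prod.product_integral_insert[of "{..<n}" n ?h] by (simp add: lessThan_Suc)
    also have "\<dots> = (LINT x|lborel_n n. x i * F x)"
      unfolding F_def using i
      by (intro Bochner_Integration.integral_cong refl)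
         (auto simp: indicator_def mult.left_commute simp flip: integral_mult_right_zero intro!: Bochner_Integration.integral_cong)
    finally show "(LINT x|lborel_n n. x i * F x) = 0" using bary[OF i] by simp
  next
    fix x y assume xy: "x \<in> Rn n" "y \<in> Rn n"
    have "ennreal (F x) * (ennreal (1/32) * G y) = ennreal (1/32) * (ennreal (F x) * G y)" by (simp add: ac_simps)
    also have "\<dots> \<le> ennreal (1/32) * ennreal (32 * exp (- inner_n n x y))" by (intro mult_left_mono FG xy) simp
    also have "\<dots> = ennreal (exp (- inner_n n x y))" by (simp add: ennreal_mult'[symmetric])
    finally show "ennreal (F x) * (ennreal (1/32) * G y) \<le> ennreal (exp (- inner_n n x y))" .
  qed simp
  then have "ennreal (1/32) * ((\<integral>\<^sup>+x. F x \<partial>lborel_n n) * (\<integral>\<^sup>+y. G y \<partial>lborel_n n)) \<le> C"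
    by (subst (asm) nn_integral_cmult) (simp_all only: Gm mult.left_commute)
  then have "ennreal 32 * (ennreal (1/32) * ((\<integral>\<^sup>+x. F x \<partial>lborel_n n) * (\<integral>\<^sup>+y. G y \<partial>lborel_n n))) \<le> ennreal 32 * C"
    by (intro mult_left_mono) auto
  then show ?thesis unfolding F_int G_int
    by (simp add: mult.assoc[symmetric] ennreal_mult'[symmetric] del: ennreal_numeral) simp
qed

text \<open>Mean zero balances the positive and negative parts of \<open>x n * f x\<close>, so both
  have integral \<open>E\<close>. Were \<open>E\<close> zero, \<open>f\<close> would vanish almost
  everywhere off the null hyperplane \<open>x n = 0\<close>, against \<open>pos\<close>.\<close>

lemma nn_integral_lborel_n_half_space_moment:
  assumes f: "log_concave_bounded (Suc n) f"
    and mean: "(LINT x|lborel_n (Suc n). x n * f x) = 0"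
    and pos: "0 < (\<integral>\<^sup>+x. f x \<partial>lborel_n (Suc n))"
  defines "E \<equiv> LINT x|lborel_n (Suc n). indicator {0<..} (x n) * (x n * f x)"
  shows "0 < E"
    and "(\<integral>\<^sup>+x. ennreal (x n * f x) \<partial>lborel_n (Suc n)) = ennreal E"
    and "(\<integral>\<^sup>+x. ennreal (- (x n) * f x) \<partial>lborel_n (Suc n)) = ennreal E"
proof -
  let ?M = "lborel_n (Suc n)"
  have f0: "0 \<le> f x" if "x \<in> Rn (Suc n)" for x using f that by (simp add: log_concave_bounded_def)
  have xn: "(\<lambda>x. x n) \<in> borel_measurable ?M" by (rule measurable_component_n) simp
  have fm: "f \<in> borel_measurable ?M" using f by (rule log_concave_bounded_measurable)
  have i1: "integrable ?M (\<lambda>x. x n * f x)"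
    using log_concave_bounded_integrable(2)[OF f, of "\<lambda>_. 1" n] by simp
  have i2: "integrable ?M (\<lambda>x. indicator {0<..} (x n) * (x n * f x))"
    by (intro log_concave_bounded_integrable[OF f]) (auto simp: indicator_def intro: measurable_compose[OF xn])
  have "(\<integral>\<^sup>+x. ennreal (x n * f x) \<partial>?M) = (\<integral>\<^sup>+x. ennreal (indicator {0<..} (x n) * (x n * f x)) \<partial>?M)"
    using f0 by (intro nn_integral_cong) (auto simp: indicator_def ennreal_neg mult_nonpos_nonneg)
  also have "\<dots> = ennreal E"
    unfolding E_def using f0 by (intro nn_integral_eq_integral i2 AE_I2) (auto simp: indicator_def)
  finally show P: "(\<integral>\<^sup>+x. ennreal (x n * f x) \<partial>?M) = ennreal E" .
  have E0: "0 \<le> E" unfolding E_def using f0 by (intro integral_nonneg_AE AE_I2) (auto simp: indicator_def)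
  let ?N = "\<integral>\<^sup>+x. ennreal (- (x n * f x)) \<partial>?M"
  have "?N < \<infinity>" using i1 by (simp add: real_integrable_def less_top)
  moreover have "enn2real ?N = enn2real (ennreal E)"
    using mean real_lebesgue_integral_def[OF i1] by (simp add: P)
  ultimately have "?N = ennreal E" using E0 by (cases ?N) auto
  then show N: "(\<integral>\<^sup>+x. ennreal (- (x n) * f x) \<partial>?M) = ennreal E" by simp
  show "0 < E"
  proof (rule ccontr)
    assume "\<not> 0 < E"
    with E0 have "E = 0" by simp
    have "AE x in ?M. ennreal (x n * f x) = 0" "AE x in ?M. ennreal (- (x n) * f x) = 0"
      using P N \<open>E = 0\<close> xn fm by (subst nn_integral_0_iff_AE[symmetric]; simp add: borel_measurable_times)+
    with AE_lborel_n_last_nonzero have "AE x in ?M. ennreal (f x) = 0"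
    proof eventually_elim
      case (elim x)
      then have "x n * f x = 0" by (simp add: ennreal_eq_0_iff)
      with elim show ?case by simp
    qed
    then have "(\<integral>\<^sup>+x. f x \<partial>?M) = 0" using fm by (subst nn_integral_0_iff_AE) simp_all
    with pos show False by simp
  qed
qed

lemma nn_integral_half_line_indicator:
  "(\<integral>\<^sup>+c. indicator {0..} c * indicator {c<..} a \<partial>lborel) = ennreal a"
proof -
  have "(\<integral>\<^sup>+c. indicator {0..} c * indicator {c<..} a \<partial>lborel) = (\<integral>\<^sup>+c. indicator {0..<a} c \<partial>lborel)"
    by (intro nn_integral_cong) (auto simp: indicator_def)
  then show ?thesis by (cases "0 \<le> a") (auto simp: ennreal_neg)
qed

text \<open>Projection to the last axis reduces this to \<open>log_concave_tail_at_mean\<close> for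
  the mass \<open>T c\<close> above height \<open>c\<close>. Prekopa-Leindler in dimension
  \<open>Suc n\<close> makes \<open>T\<close> log-concave.\<close>

lemma half_space_mass_ge:
  assumes f: "log_concave_bounded (Suc n) f"
    and mean: "(LINT x|lborel_n (Suc n). x n * f x) = 0"
  shows "(\<integral>\<^sup>+x. f x \<partial>lborel_n (Suc n))
    \<le> 6 * (\<integral>\<^sup>+x. indicator {0<..} (x n) * ennreal (f x) \<partial>lborel_n (Suc n))"
proof (cases "(\<integral>\<^sup>+x. f x \<partial>lborel_n (Suc n)) = 0")
  case False
  let ?M = "lborel_n (Suc n)"
  have f0: "0 \<le> f x" if "x \<in> Rn (Suc n)" for x using f that by (simp add: log_concave_bounded_def)
  have xn: "(\<lambda>x. x n) \<in> borel_measurable ?M" by (rule measurable_component_n) simp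
  have fm: "f \<in> borel_measurable ?M" using f by (rule log_concave_bounded_measurable)
  define E where "E = (LINT x|?M. indicator {0<..} (x n) * (x n * f x))"
  have pos: "0 < (\<integral>\<^sup>+x. f x \<partial>?M)" using False by (simp add: zero_less_iff_neq_zero)
  have E: "0 < E" "(\<integral>\<^sup>+x. ennreal (x n * f x) \<partial>?M) = ennreal E"
    "(\<integral>\<^sup>+x. ennreal (- (x n) * f x) \<partial>?M) = ennreal E"
    unfolding E_def by (rule nn_integral_lborel_n_half_space_moment[OF f mean pos])+
  define T where "T = (\<lambda>c. LINT x|?M. indicator {c<..} (x n) * f x)"
  have int: "integrable ?M (\<lambda>x. indicator {c<..} (x n) * f x)" for c
    by (intro log_concave_bounded_integrable[OF f]) (auto simp: indicator_def intro: measurable_compose[OF xn])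
  have T: "ennreal (T c) = (\<integral>\<^sup>+x. indicator {c<..} (x n) * ennreal (f x) \<partial>?M)" for c
  proof -
    have "ennreal (T c) = (\<integral>\<^sup>+x. ennreal (indicator {c<..} (x n) * f x) \<partial>?M)"
      unfolding T_def using f0 by (intro nn_integral_eq_integral[OF int, symmetric] AE_I2) auto
    also have "\<dots> = (\<integral>\<^sup>+x. indicator {c<..} (x n) * ennreal (f x) \<partial>?M)"
      by (intro nn_integral_cong) (auto simp: indicator_def)
    finally show ?thesis .
  qed
  have im: "(\<lambda>x. indicator {c<..} (x n) * ennreal (f x)) \<in> borel_measurable ?M" for c :: real
    by (intro borel_measurable_times_ennreal measurable_compose[OF xn] measurable_compose[OF fm]) simp_all
  have T0: "0 \<le> T c" for c unfolding T_def using f0 by (intro integral_nonneg_AE AE_I2) auto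
  define m where "m = (LINT x|?M. f x)"
  have intf: "integrable ?M f" using log_concave_bounded_integrable(1)[OF f, of "\<lambda>_. 1"] by simp
  have m: "(\<integral>\<^sup>+x. f x \<partial>?M) = ennreal m"
    unfolding m_def using f0 by (intro nn_integral_eq_integral[OF intf] AE_I2) auto
  then have m0: "0 < m" using pos by simp
  have "m \<le> 6 * T 0"
  proof (rule log_concave_tail_at_mean[OF T0 _ _ _ E(1) m0])
    show "antimono T"
      unfolding T_def antimono_def using f0
      by (intro allI impI integral_mono int) (auto simp: indicator_def)
    show "T x * T y \<le> (T ((x + y) / 2))\<^sup>2" for x y
    proof -
      let ?u = "\<lambda>c z. indicator {c<..} (z n) * ennreal (f z)"
      have "(\<integral>\<^sup>+z. ?u x z \<partial>?M) * (\<integral>\<^sup>+z. ?u y z \<partial>?M) \<le> (\<integral>\<^sup>+z. ?u ((x + y) / 2) z \<partial>?M)\<^sup>2"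
      proof (rule prekopa_leindler[OF im im im])
        fix a b assume ab: "a \<in> Rn (Suc n)" "b \<in> Rn (Suc n)"
        let ?c = "midpoint_n (Suc n) a b"
        show "?u x a * ?u y b \<le> (?u ((x + y) / 2) ?c)\<^sup>2"
        proof (cases "x < a n \<and> y < b n")
          case True
          then have "(x + y) / 2 < ?c n" by (simp add: midpoint_n_def)
          moreover have "ennreal (f a * f b) \<le> ennreal ((f ?c)\<^sup>2)"
            using f ab by (intro ennreal_leI) (simp add: log_concave_bounded_def)
          moreover have "ennreal ((f ?c)\<^sup>2) = (ennreal (f ?c))\<^sup>2"
            using f0 by (intro ennreal_power[symmetric]) simp
          ultimately show ?thesis using True f0 ab by (simp add: ennreal_mult)
        qed auto
      qed
      then have "ennreal (T x) * ennreal (T y) \<le> (ennreal (T ((x + y) / 2)))\<^sup>2" by (simp add: T)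
      also have "\<dots> = ennreal ((T ((x + y) / 2))\<^sup>2)" using T0 by (intro ennreal_power) simp
      finally show ?thesis using T0 by (simp add: ennreal_mult'[symmetric] ennreal_le_iff)
    qed
    \<comment> \<open>Fubini: for fixed \<open>x\<close>, the levels \<open>c \<ge> 0\<close> below
      \<open>x n\<close> have as total length the positive part of \<open>x n\<close>.\<close>
    show "(\<integral>\<^sup>+c. indicator {0..} c * ennreal (T c) \<partial>lborel) = ennreal E"
    proof -
      interpret finite_product_sigma_finite "\<lambda>_::nat. lborel :: real measure" "{..<Suc n}"
        by standard simp
      interpret P: pair_sigma_finite "lborel :: real measure" ?M ..
      have meas: "(\<lambda>(c, x). indicator {0..} c * (indicator {c<..} (x n) * ennreal (f x))) \<in> borel_measurable (lborel \<Otimes>\<^sub>M ?M)"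
      proof -
        have 1: "(\<lambda>p. snd p n - fst p) \<in> borel_measurable (lborel \<Otimes>\<^sub>M ?M)"
          using measurable_compose[OF measurable_snd xn, of lborel] by (intro borel_measurable_diff) auto
        have "(\<lambda>p. indicator {0..} (fst p) * (indicator {0<..} (snd p n - fst p) * ennreal (f (snd p)))) \<in> borel_measurable (lborel \<Otimes>\<^sub>M ?M)"
          by (intro borel_measurable_times_ennreal measurable_compose[OF 1]
              measurable_compose[OF measurable_compose[OF measurable_snd fm]]) simp_all
        also have "(\<lambda>p. indicator {0..} (fst p) * (indicator {0<..} (snd p n - fst p) * ennreal (f (snd p))))
          = (\<lambda>(c, x). indicator {0..} c * (indicator {c<..} (x n) * ennreal (f x)))"
          by (auto simp: fun_eq_iff indicator_def)
        finally show ?thesis .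
      qed
      have "(\<integral>\<^sup>+c. indicator {0..} c * ennreal (T c) \<partial>lborel)
        = (\<integral>\<^sup>+c. \<integral>\<^sup>+x. indicator {0..} c * (indicator {c<..} (x n) * ennreal (f x)) \<partial>?M \<partial>lborel)"
        unfolding T by (intro nn_integral_cong nn_integral_cmult[symmetric] im)
      also have "\<dots> = (\<integral>\<^sup>+x. \<integral>\<^sup>+c. indicator {0..} c * (indicator {c<..} (x n) * ennreal (f x)) \<partial>lborel \<partial>?M)"
        by (rule P.Fubini'[symmetric, OF meas])
      also have "\<dots> = (\<integral>\<^sup>+x. ennreal (x n * f x) \<partial>?M)"
      proof (rule nn_integral_cong)
        fix x assume x: "x \<in> space ?M"
        have "(\<integral>\<^sup>+c. indicator {0..} c * (indicator {c<..} (x n) * ennreal (f x)) \<partial>lborel)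
            = (\<integral>\<^sup>+c. ennreal (f x) * (indicator {0..} c * indicator {..<x n} c) \<partial>lborel)"
          by (intro nn_integral_cong) (auto simp: indicator_def)
        also have "\<dots> = ennreal (f x) * (\<integral>\<^sup>+c. indicator {0..} c * indicator {..<x n} c \<partial>lborel)"
          by (rule nn_integral_cmult) simp
        also have "(\<integral>\<^sup>+c. indicator {0..} c * indicator {..<x n} c \<partial>lborel) = ennreal (x n)"
          using nn_integral_half_line_indicator[of "x n"] by (simp add: indicator_def)
        also have "ennreal (f x) * ennreal (x n) = ennreal (x n * f x)"
          using f0 x by (cases "0 \<le> x n") (auto simp: ennreal_mult' mult.commute ennreal_neg mult_nonpos_nonneg)
        finally show "(\<integral>\<^sup>+c. indicator {0..} c * (indicator {c<..} (x n) * ennreal (f x)) \<partial>lborel) = ennreal (x n * f x)" .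
      qed
      finally show ?thesis using E(2) by simp
    qed
    \<comment> \<open>Markov's inequality: where \<open>x n \<le> - a\<close>, \<open>f x\<close> is
      at most \<open>(- x n / a) * f x\<close>, so the mass there is at most
      \<open>E / a = m / 2\<close>.\<close>
    define a where "a = 2 * E / m"
    have a: "0 < a" using E m0 by (simp add: a_def)
    have "ennreal m \<le> (\<integral>\<^sup>+x. indicator {-a<..} (x n) * ennreal (f x) + ennreal (1 / a) * ennreal (- (x n) * f x) \<partial>?M)"
      unfolding m[symmetric]
    proof (intro nn_integral_mono)
      fix x assume x: "x \<in> space ?M"
      show "ennreal (f x) \<le> indicator {-a<..} (x n) * ennreal (f x) + ennreal (1 / a) * ennreal (- (x n) * f x)"
      proof (cases "- a < x n")
        case False
        then have "a \<le> - (x n)" by simp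
        then have "1 \<le> (1 / a) * (- (x n))" using a divide_right_mono[of a "- (x n)" a] by simp
        then have "1 * f x \<le> (1 / a) * (- (x n)) * f x" using f0 x by (intro mult_right_mono) auto
        then have "ennreal (f x) \<le> ennreal ((1 / a) * (- (x n) * f x))" by (intro ennreal_leI) (simp add: mult.assoc)
        then show ?thesis using False a by (subst (asm) ennreal_mult') auto
      qed simp
    qed
    also have "\<dots> = ennreal (T (- a)) + ennreal (1 / a) * ennreal E"
    proof -
      have m1: "(\<lambda>x. ennreal (- (x n) * f x)) \<in> borel_measurable ?M"
        using xn fm by (intro measurable_compose[OF _ measurable_ennreal] borel_measurable_times borel_measurable_uminus)
      show ?thesis
        by (subst nn_integral_add[OF im]) (use m1 in \<open>simp_all only: nn_integral_cmult T E borel_measurable_times_ennreal borel_measurable_const\<close>)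
    qed
    also have "\<dots> = ennreal (T (- a) + 1 / a * E)"
      using T0 a E by (simp only: ennreal_plus ennreal_mult' zero_le_divide_1_iff less_imp_le mult_nonneg_nonneg)
    finally have "m \<le> T (- a) + 1 / a * E" using T0[of "- a"] a E by (subst (asm) ennreal_le_iff) auto
    also have "1 / a * E = m / 2" using E m0 by (simp add: a_def)
    finally show "m / 2 \<le> T (- (2 * E / m))" by (simp add: a_def)
  qed
  then have "ennreal m \<le> ennreal (6 * T 0)" by (rule ennreal_leI)
  also have "\<dots> = 6 * ennreal (T 0)" using T0 by (simp add: ennreal_mult)
  finally show ?thesis by (simp add: m T)
qed simp

text \<open>With \<open>z = flip_coshear n e v x\<close> one has
  \<open>x i = z i - z n * v i\<close>, and \<open>0 < x n\<close> becomes
  \<open>0 < e * z n\<close>. The choice of \<open>v\<close> kills the moment of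
  \<open>z i - z n * v i\<close> over the positive half; as this moment vanishes over the whole
  space by \<open>bary\<close>, the same \<open>v\<close> serves the negative half.\<close>

lemma sheared_barycenter:
  assumes f: "log_concave_bounded (Suc n) f" and e: "e = 1 \<or> e = -1"
    and bary: "\<And>i. i < Suc n \<Longrightarrow> (LINT x|lborel_n (Suc n). x i * f x) = 0"
    and v: "\<And>i. i < n \<Longrightarrow> (LINT x|lborel_n (Suc n). indicator {0<..} (x n) * (x i * f x))
      = v i * (LINT x|lborel_n (Suc n). indicator {0<..} (x n) * (x n * f x))"
    and i: "i < n"
  shows "(LINT x|lborel_n (Suc n). indicator {0<..} (x n) * (x i * f (flip_coshear n e v x))) = 0"
proof -
  let ?M = "lborel_n (Suc n)"
  have xn: "(\<lambda>x. x n) \<in> borel_measurable ?M" by (rule measurable_component_n) simp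
  have xi: "(\<lambda>x. x i) \<in> borel_measurable ?M" using i by (intro measurable_component_n) simp
  have fm: "f \<in> borel_measurable ?M" using f by (rule log_concave_bounded_measurable)
  let ?p = "\<lambda>z. (z i - z n * v i) * f z"
  let ?\<Phi> = "\<lambda>z. indicator {0<..} (e * z n) * ((z i - z n * v i) * f z)"
  have ee: "e * e = 1" using e by auto
  have int: "integrable ?M (\<lambda>z. h z * (z j * f z))"
    if "h \<in> borel_measurable ?M" "\<And>x. \<bar>h x\<bar> \<le> 1" "j < Suc n" for h j
    using log_concave_bounded_integrable(2)[OF f that(1) _ that(3)] that(2) by simp
  have hm: "(\<lambda>z. indicator {0<..} (z n) :: real) \<in> borel_measurable ?M" by (rule measurable_compose[OF xn]) simp
  have pos: "(LINT z|?M. indicator {0<..} (z n) * ?p z) = 0"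
  proof -
    have "(LINT z|?M. indicator {0<..} (z n) * ?p z)
        = (LINT z|?M. indicator {0<..} (z n) * (z i * f z) - v i * (indicator {0<..} (z n) * (z n * f z)))"
      by (simp add: algebra_simps)
    also have "\<dots> = (LINT z|?M. indicator {0<..} (z n) * (z i * f z)) - v i * (LINT z|?M. indicator {0<..} (z n) * (z n * f z))"
      using i by (subst Bochner_Integration.integral_diff)
        (auto intro!: int hm integrable_mult_right simp: indicator_def)
    finally show ?thesis using v[OF i] by simp
  qed
  have "(LINT x|?M. indicator {0<..} (x n) * (x i * f (flip_coshear n e v x))) = (LINT x|?M. ?\<Phi> (flip_coshear n e v x))"
  proof (rule Bochner_Integration.integral_cong[OF refl])
    fix x :: "nat \<Rightarrow> real"
    have "e * flip_coshear n e v x n = x n" "flip_coshear n e v x i - flip_coshear n e v x n * v i = x i"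
      using i ee by (simp_all add: flip_coshear_def mult.assoc[symmetric])
    then show "indicator {0<..} (x n) * (x i * f (flip_coshear n e v x)) = ?\<Phi> (flip_coshear n e v x)" by simp
  qed
  also have "\<dots> = (LINT z|?M. ?\<Phi> z)"
  proof (rule integral_distr_self[OF distr_flip_coshear[OF e] measurable_flip_coshear])
    have "(\<lambda>z. indicator {0<..} (e * z n) :: real) \<in> borel_measurable ?M"
      by (rule measurable_compose[OF borel_measurable_times[OF borel_measurable_const xn]]) simp
    then show "?\<Phi> \<in> borel_measurable ?M"
      using xn xi fm by (intro borel_measurable_times borel_measurable_diff borel_measurable_const)
  qed
  also have "\<dots> = 0"
    using e
  proof
    assume "e = 1" then show ?thesis using pos by simp
  next
    assume "e = -1"
    have i0: "integrable ?M ?p"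
    proof -
      have "integrable ?M (\<lambda>z. 1 * (z i * f z) - v i * (1 * (z n * f z)))"
        using i by (intro Bochner_Integration.integrable_diff integrable_mult_right int) auto
      then show ?thesis by (simp add: algebra_simps)
    qed
    have i1: "integrable ?M (\<lambda>z. indicator {0<..} (z n) * ?p z)"
    proof -
      have "integrable ?M (\<lambda>z. indicator {0<..} (z n) * (z i * f z) - v i * (indicator {0<..} (z n) * (z n * f z)))"
        using i by (intro Bochner_Integration.integrable_diff integrable_mult_right int hm) (auto simp: indicator_def)
      then show ?thesis by (simp add: algebra_simps)
    qed
    have m2: "?\<Phi> \<in> borel_measurable ?M"
    proof -
      have "(\<lambda>z. indicator {0<..} (e * z n) :: real) \<in> borel_measurable ?M"
        by (rule measurable_compose[OF borel_measurable_times[OF borel_measurable_const xn]]) simp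
      then show ?thesis
        using xn xi fm by (intro borel_measurable_times borel_measurable_diff borel_measurable_const)
    qed
    \<comment> \<open>The two integrands may differ on the hyperplane \<open>z n = 0\<close>, which
      is a null set.\<close>
    have "(LINT z|?M. ?\<Phi> z) = (LINT z|?M. ?p z - indicator {0<..} (z n) * ?p z)"
    proof (rule integral_cong_AE[OF m2])
      show "(\<lambda>z. ?p z - indicator {0<..} (z n) * ?p z) \<in> borel_measurable ?M"
        using i0 i1 by (intro borel_measurable_diff borel_measurable_integrable)
      show "AE z in ?M. ?\<Phi> z = ?p z - indicator {0<..} (z n) * ?p z"
        using AE_lborel_n_last_nonzero
        by eventually_elim (auto simp: indicator_def \<open>e = -1\<close>)
    qed
    also have "\<dots> = (LINT z|?M. ?p z) - 0" using i0 i1 pos by simp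
    also have "(LINT z|?M. ?p z) = (LINT z|?M. z i * f z - v i * (z n * f z))" by (simp add: algebra_simps)
    also have "\<dots> = (LINT z|?M. z i * f z) - v i * (LINT z|?M. z n * f z)"
      using i int[of "\<lambda>_. 1" i] int[of "\<lambda>_. 1" n] by simp
    finally show ?thesis using bary[of i] bary[of n] i by simp
  qed
  finally show ?thesis .
qed

lemma mult_le_chain:
  fixes a b c d :: ennreal
  assumes "x * b \<le> c" "a \<le> d * x"
  shows "a * b \<le> d * c"
  using mult_right_mono[OF assms(2), of b] mult_left_mono[OF assms(1), of d]
  by (simp add: mult.assoc)

text \<open>Each sheared half of \<open>f\<close> carries a sixth of the mass and pairs with one
  half of \<open>g\<close> at the cost of 32. Adding the two dual halves gives
  \<open>2 * 6 * 32 = 384\<close> per dimension.\<close>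

theorem functional_santalo: "santalo_bound n (384 ^ n)"
proof (induction n)
  case 0
  show ?case
    unfolding santalo_bound_def nn_integral_lborel_0
  proof (intro allI impI)
    fix f :: "(nat \<Rightarrow> real) \<Rightarrow> real" and g
    assume "\<forall>x\<in>Rn 0. \<forall>y\<in>Rn 0. ennreal (f x) * g y \<le> ennreal (exp (- inner_n 0 x y))"
    from bspec[OF bspec[OF this], of "\<lambda>_. undefined" "\<lambda>_. undefined"]
    show "ennreal (f (\<lambda>_. undefined)) * g (\<lambda>_. undefined) \<le> 384 ^ 0" by (simp add: inner_n_def)
  qed
next
  case (Suc n)
  show ?case
    unfolding santalo_bound_def
  proof (intro allI impI)
    fix f g
    assume f: "log_concave_bounded (Suc n) f"
      and bary0: "\<forall>i<Suc n. (LINT x|lborel_n (Suc n). x i * f x) = 0"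
      and g: "g \<in> borel_measurable (lborel_n (Suc n))"
      and dual: "\<forall>x\<in>Rn (Suc n). \<forall>y\<in>Rn (Suc n). ennreal (f x) * g y \<le> ennreal (exp (- inner_n (Suc n) x y))"
    note bary = bary0[rule_format]
    let ?M = "lborel_n (Suc n)"
    let ?If = "\<integral>\<^sup>+x. f x \<partial>?M"
    have fm: "f \<in> borel_measurable ?M" using f by (rule log_concave_bounded_measurable)
    show "?If * (\<integral>\<^sup>+y. g y \<partial>?M) \<le> 384 ^ Suc n"
    proof (cases "?If = 0")
      case False
      then have pos: "0 < ?If" by (simp add: zero_less_iff_neq_zero)
      define E where "E = (LINT x|?M. indicator {0<..} (x n) * (x n * f x))"
      have E: "0 < E"
        unfolding E_def by (rule nn_integral_lborel_n_half_space_moment(1)[OF f bary[of n] pos]) simp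
      \<comment> \<open>Extended by a last entry 1, \<open>v\<close> is the direction of the
        barycenter of the half of \<open>f\<close> with \<open>x n > 0\<close>; \<open>E > 0\<close>
        makes the division legitimate.\<close>
      define v where "v = (\<lambda>i. (LINT x|?M. indicator {0<..} (x n) * (x i * f x)) / E)"
      define H where "H = (\<lambda>e. \<integral>\<^sup>+y. indicator {0..} (y n) * g (flip_shear n e v y) \<partial>?M)"
      have half: "?If * H e \<le> 192 * 384 ^ n" if e: "e = 1 \<or> e = -1" for e
      proof -
        let ?f = "\<lambda>x. f (flip_coshear n e v x)" and ?g = "\<lambda>y. g (flip_shear n e v y)"
        have lc: "log_concave_bounded (Suc n) ?f" by (rule log_concave_bounded_flip_coshear[OF f e])
        have If: "(\<integral>\<^sup>+x. ?f x \<partial>?M) = ?If"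
          by (rule nn_integral_distr_self[OF distr_flip_coshear[OF e] measurable_flip_coshear, where f="\<lambda>x. ennreal (f x)"])
            (rule measurable_compose[OF fm measurable_ennreal])
        have b: "(LINT x|?M. indicator {0<..} (x n) * (x i * ?f x)) = 0" if "i < n" for i
          using E by (intro sheared_barycenter[OF f e bary _ that]) (simp_all add: v_def E_def[symmetric])
        have gm: "?g \<in> borel_measurable ?M" by (rule measurable_compose[OF measurable_flip_shear g])
        have ee: "e * e = 1" using e by auto
        have d: "ennreal (?f x) * ?g y \<le> ennreal (exp (- inner_n (Suc n) x y))" for x y
          using bspec[OF bspec[OF dual flip_coshear_Rn[of n e v x]] flip_shear_Rn[of n e v y]]
          by (simp only: inner_flip_coshear_flip_shear[OF ee])
        have santalo: "(\<integral>\<^sup>+x. indicator {0<..} (x n) * ennreal (?f x) \<partial>?M) * H e \<le> 32 * 384 ^ n"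
          unfolding H_def
          by (rule half_space_santalo[where f="?f" and g="?g", OF Suc.IH lc b gm d])
        have "(LINT x|?M. x n * ?f x) = (LINT x|?M. e * (flip_coshear n e v x n * ?f x))"
        proof (rule Bochner_Integration.integral_cong[OF refl])
          fix x :: "nat \<Rightarrow> real"
          have "e * flip_coshear n e v x n = x n" using ee by (simp add: flip_coshear_def mult.assoc[symmetric])
          then show "x n * ?f x = e * (flip_coshear n e v x n * ?f x)" by (simp add: mult.assoc[symmetric])
        qed
        also have "\<dots> = (LINT z|?M. e * (z n * f z))"
          by (rule integral_distr_self[OF distr_flip_coshear[OF e] measurable_flip_coshear])
             (intro borel_measurable_times borel_measurable_const fm measurable_component_n, simp)
        also have "\<dots> = 0" using bary[of n] by simp
        finally have mean: "(LINT x|?M. x n * ?f x) = 0" .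
        have mass: "(\<integral>\<^sup>+x. ?f x \<partial>?M) \<le> 6 * (\<integral>\<^sup>+x. indicator {0<..} (x n) * ennreal (?f x) \<partial>?M)"
          by (rule half_space_mass_ge[OF lc mean])
        have "?If * H e \<le> 6 * (32 * 384 ^ n)"
          by (rule mult_le_chain[OF santalo mass[unfolded If]])
        also have "(6 :: ennreal) * (32 * 384 ^ n) = 192 * 384 ^ n" by (simp add: mult.assoc[symmetric])
        finally show ?thesis .
      qed
      have "(\<integral>\<^sup>+y. g y \<partial>?M) \<le> H 1 + H (-1)"
      proof -
        \<comment> \<open>Because both shears use the same \<open>v\<close>, \<open>H 1\<close> and
          \<open>H (-1)\<close> are the integrals of \<open>g\<close> over the half-spaces
          \<open>s \<ge> 0\<close> and \<open>s \<le> 0\<close> of one linear functional, and these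
          cover the space.\<close>
        define s where "s = (\<lambda>z. z n + (\<Sum>j<n. v j * z j))"
        have sm: "s \<in> borel_measurable ?M"
          unfolding s_def by (intro borel_measurable_add borel_measurable_sum borel_measurable_times borel_measurable_const measurable_component_n) auto
        have hm: "(\<lambda>z. indicator {0..} (e * s z) * g z) \<in> borel_measurable ?M" for e
          by (intro borel_measurable_times_ennreal g measurable_compose[OF borel_measurable_times[OF borel_measurable_const sm]]) simp
        have H: "H e = (\<integral>\<^sup>+z. indicator {0..} (e * s z) * g z \<partial>?M)" if e: "e = 1 \<or> e = -1" for e
        proof -
          have "e * s (flip_shear n e v y) = y n" for y
            using e by (auto simp: s_def flip_shear_def)
          then have "H e = (\<integral>\<^sup>+y. indicator {0..} (e * s (flip_shear n e v y)) * g (flip_shear n e v y) \<partial>?M)"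
            by (simp add: H_def)
          also have "\<dots> = (\<integral>\<^sup>+z. indicator {0..} (e * s z) * g z \<partial>?M)"
            by (rule nn_integral_distr_self[OF distr_flip_shear[OF e] measurable_flip_shear hm])
          finally show ?thesis .
        qed
        have "(\<integral>\<^sup>+y. g y \<partial>?M) \<le> (\<integral>\<^sup>+z. indicator {0..} (1 * s z) * g z + indicator {0..} (-1 * s z) * g z \<partial>?M)"
          by (intro nn_integral_mono) (auto simp: indicator_def)
        also have "\<dots> = H 1 + H (-1)" using H[of 1] H[of "-1"] by (subst nn_integral_add[OF hm hm]) simp
        finally show ?thesis .
      qed
      then have "?If * (\<integral>\<^sup>+y. g y \<partial>?M) \<le> ?If * (H 1 + H (-1))" by (intro mult_left_mono) auto
      also have "\<dots> \<le> 192 * 384 ^ n + 192 * 384 ^ n"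
        unfolding distrib_left by (intro add_mono half) auto
      also have "\<dots> = 384 ^ Suc n" by (simp flip: distrib_right)
      finally show ?thesis .
    qed simp
  qed
qed

section \<open>Reflections\<close>

definition norm_n :: "nat \<Rightarrow> (nat \<Rightarrow> real) \<Rightarrow> real" where
  "norm_n n x = sqrt (inner_n n x x)"

text \<open>The Householder reflection in the hyperplane orthogonal to \<open>v\<close>. One such
  map carries \<open>last_unit\<close> to any other unit vector, so these are the only orthogonal
  maps that occur below.\<close>

definition reflect :: "nat \<Rightarrow> (nat \<Rightarrow> real) \<Rightarrow> (nat \<Rightarrow> real) \<Rightarrow> nat \<Rightarrow> real" where
  "reflect n v x = (\<lambda>i\<in>{..<n}. x i - 2 * inner_n n v x / inner_n n v v * v i)"

definition last_unit :: "nat \<Rightarrow> nat \<Rightarrow> real" where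
  "last_unit n = (\<lambda>i\<in>{..<Suc n}. if i = n then 1 else 0)"

lemma inner_n_commute: "inner_n n x y = inner_n n y x"
  by (simp add: inner_n_def mult.commute)

lemma inner_n_self_nonneg: "0 \<le> inner_n n x x"
  by (auto simp: inner_n_def intro!: sum_nonneg)

lemma inner_n_diff_scale_left:
  "inner_n n (\<lambda>i\<in>{..<n}. x i - c * v i) y = inner_n n x y - c * inner_n n v y"
proof -
  have "inner_n n (\<lambda>i\<in>{..<n}. x i - c * v i) y = (\<Sum>i<n. x i * y i - c * (v i * y i))"
    unfolding inner_n_def by (intro sum.cong) (auto simp: left_diff_distrib mult.assoc)
  then show ?thesis by (simp add: inner_n_def sum_subtractf sum_distrib_left)
qed

lemma inner_n_reflect_left:
  "inner_n n (reflect n v x) y = inner_n n x y - 2 * inner_n n v x / inner_n n v v * inner_n n v y"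
  unfolding reflect_def by (rule inner_n_diff_scale_left)

lemma inner_n_reflect_swap: "inner_n n (reflect n v x) y = inner_n n x (reflect n v y)"
  using inner_n_reflect_left[of n v x y] inner_n_reflect_left[of n v y x]
  by (simp add: inner_n_commute mult.commute)

lemma inner_n_reflect:
  assumes "inner_n n v v \<noteq> 0"
  shows "inner_n n (reflect n v x) (reflect n v y) = inner_n n x y"
proof -
  have a: "inner_n n v (reflect n v y) = - inner_n n v y"
    unfolding inner_n_commute[of n v "reflect n v y"] inner_n_reflect_left
    using assms by (simp add: inner_n_commute)
  show ?thesis
    unfolding inner_n_reflect_left[of n v x] a inner_n_commute[of n x] inner_n_reflect_left[of n v y]
    by (simp add: inner_n_commute mult.commute)
qed

lemma reflect_Rn [simp]: "reflect n v x \<in> Rn n"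
  by (auto simp: reflect_def)

text \<open>Reduces invariance of Lebesgue measure under reflections to that under shears. The inner
  shear turns the last coordinate into \<open>inner_n (Suc n) v x / v n\<close>; the middle map
  negates it and subtracts the required multiple of \<open>v\<close> from the other coordinates; the
  outer shear undoes the change of last coordinate. The entry \<open>v n\<close> is the
  pivot.\<close>

lemma reflect_eq_flips:
  assumes vn: "v n \<noteq> 0" and x: "x \<in> Rn (Suc n)"
  defines "q \<equiv> inner_n (Suc n) v v"
  shows "reflect (Suc n) v x = flip_shear n 1 (\<lambda>j. v j / v n)
    (flip_coshear n (-1) (\<lambda>j. 2 * v j * v n / q) (flip_shear n 1 (\<lambda>j. - (v j / v n)) x))"
    (is "_ = ?R")
proof
  fix i
  let ?p = "inner_n (Suc n) v x"
  have q0: "q \<noteq> 0"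
  proof -
    have "0 < v n * v n" using vn by (auto simp: zero_less_mult_iff neq_iff)
    moreover have "0 \<le> (\<Sum>i<n. v i * v i)" by (intro sum_nonneg) simp
    ultimately show ?thesis by (simp add: q_def inner_n_def)
  qed
  define z where "z = flip_shear n 1 (\<lambda>j. - (v j / v n)) x"
  have zn: "z n = ?p / v n"
    using vn by (simp add: z_def flip_shear_def inner_n_def sum_negf field_simps sum_distrib_left)
  define w where "w = flip_coshear n (-1) (\<lambda>j. 2 * v j * v n / q) z"
  have wn: "w n = - (?p / v n)" using zn by (simp add: w_def flip_coshear_def)
  have wj: "w j = x j - 2 * ?p / q * v j" if "j < n" for j
    using that vn by (simp add: w_def flip_coshear_def zn) (simp add: z_def flip_shear_def)
  have "?R n = w n - (\<Sum>j<n. v j / v n * w j)" by (simp add: w_def z_def flip_shear_def)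
  also have "(\<Sum>j<n. v j / v n * w j) = (\<Sum>j<n. (v j * x j) / v n - 2 * ?p / q / v n * (v j * v j))"
    by (intro sum.cong) (simp_all add: wj right_diff_distrib ac_simps)
  also have "\<dots> = (?p - v n * x n) / v n - 2 * ?p / q / v n * (q - v n * v n)"
    by (simp add: sum_subtractf inner_n_def q_def sum_divide_distrib[symmetric] sum_distrib_left[symmetric])
  also have "w n - ((?p - v n * x n) / v n - 2 * ?p / q / v n * (q - v n * v n)) = x n - 2 * ?p / q * v n"
    using q0 vn by (simp add: wn field_simps)
  finally have "?R n = x n - 2 * ?p / q * v n" .
  moreover have "?R j = w j" if "j < n" for j using that by (simp add: w_def z_def flip_shear_def)
  ultimately show "reflect (Suc n) v x i = ?R i"
    using wj by (cases "i < n"; cases "i = n") (auto simp: reflect_def q_def flip_shear_def)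
qed

lemma measurable_inner_n:
  "(\<lambda>x. inner_n n y x) \<in> borel_measurable (lborel_n n)" "(\<lambda>x. inner_n n x y) \<in> borel_measurable (lborel_n n)"
  "(\<lambda>x. inner_n n x x) \<in> borel_measurable (lborel_n n)"
  unfolding inner_n_def
  by (intro borel_measurable_sum borel_measurable_times borel_measurable_const measurable_component_n; simp)+

lemma measurable_norm_n: "norm_n n \<in> borel_measurable (lborel_n n)"
  unfolding norm_n_def by (rule measurable_compose[OF measurable_inner_n(3)]) simp

lemma measurable_reflect: "reflect n v \<in> lborel_n n \<rightarrow>\<^sub>M lborel_n n"
  unfolding reflect_def
proof (rule measurable_restrict)
  fix i assume "i \<in> {..<n}"
  then have "(\<lambda>x. x i) \<in> borel_measurable (lborel_n n)" by (intro measurable_component_n) simp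
  moreover have "(\<lambda>x. 2 * inner_n n v x / inner_n n v v * v i) \<in> borel_measurable (lborel_n n)"
    by (rule measurable_compose[OF measurable_inner_n(1)[of n v]]) simp
  ultimately show "(\<lambda>x. x i - 2 * inner_n n v x / inner_n n v v * v i) \<in> lborel_n n \<rightarrow>\<^sub>M lborel"
    by (simp add: borel_measurable_diff)
qed

lemma distr_reflect:
  assumes "v n \<noteq> 0"
  shows "distr (lborel_n (Suc n)) (lborel_n (Suc n)) (reflect (Suc n) v) = lborel_n (Suc n)"
proof (rule distr_eqI_nn_integral[OF measurable_reflect])
  fix f :: "_ \<Rightarrow> ennreal" assume f: "f \<in> borel_measurable (lborel_n (Suc n))"
  let ?M = "lborel_n (Suc n)"
  let ?q = "inner_n (Suc n) v v"
  let ?S = "flip_shear n 1 (\<lambda>j. v j / v n)" and ?T = "flip_coshear n (-1) (\<lambda>j. 2 * v j * v n / ?q)"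
    and ?S' = "flip_shear n 1 (\<lambda>j. - (v j / v n))"
  have m1: "(\<lambda>x. f (?S x)) \<in> borel_measurable ?M" by (rule measurable_compose[OF measurable_flip_shear f])
  have m2: "(\<lambda>x. f (?S (?T x))) \<in> borel_measurable ?M" by (rule measurable_compose[OF measurable_flip_coshear m1])
  have "(\<integral>\<^sup>+x. f (reflect (Suc n) v x) \<partial>?M) = (\<integral>\<^sup>+x. f (?S (?T (?S' x))) \<partial>?M)"
    by (rule nn_integral_cong) (simp only: space_lborel_n reflect_eq_flips[of v n, OF assms])
  also have "\<dots> = (\<integral>\<^sup>+x. f (?S (?T x)) \<partial>?M)"
    by (rule nn_integral_distr_self[OF distr_flip_shear measurable_flip_shear m2]) simp
  also have "\<dots> = (\<integral>\<^sup>+x. f (?S x) \<partial>?M)"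
    by (rule nn_integral_distr_self[OF distr_flip_coshear measurable_flip_coshear m1]) simp
  also have "\<dots> = (\<integral>\<^sup>+x. f x \<partial>?M)"
    by (rule nn_integral_distr_self[OF distr_flip_shear measurable_flip_shear f]) simp
  finally show "(\<integral>\<^sup>+x. f (reflect (Suc n) v x) \<partial>?M) = (\<integral>\<^sup>+x. f x \<partial>?M)" .
qed

text \<open>\<open>rotation_invariant_prob\<close> speaks of matrices; the one used here is the
  identity minus \<open>2 / q\<close> times the outer product of \<open>v\<close> with
  itself.\<close>

lemma reflect_as_mat_vec:
  assumes "inner_n n v v \<noteq> 0"
  obtains U where "orthogonal_mat n U" "mat_vec n U = reflect n v"
proof
  define q where "q = inner_n n v v"
  let ?U = "\<lambda>i j. (if i = j then 1 else 0) - 2 / q * v i * v j"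
  show "mat_vec n ?U = reflect n v"
  proof (rule ext)
    fix x
    have "(\<Sum>j<n. ?U i j * x j) = x i - 2 * inner_n n v x / q * v i" if "i < n" for i
    proof -
      have "(\<Sum>j<n. ?U i j * x j) = (\<Sum>j<n. (if i = j then x j else 0) - 2 / q * v i * (v j * x j))"
        by (intro sum.cong) (auto simp: left_diff_distrib mult.assoc)
      also have "\<dots> = x i - 2 / q * v i * inner_n n v x"
        using that by (simp add: sum_subtractf inner_n_def sum_distrib_left)
      finally show ?thesis by (simp add: mult.commute)
    qed
    then show "mat_vec n ?U x = reflect n v x" by (auto simp: mat_vec_def reflect_def q_def)
  qed
  show "orthogonal_mat n ?U"
    unfolding orthogonal_mat_def
  proof (intro allI impI)
    fix i j assume ij: "i < n" "j < n"
    have "(\<Sum>k<n. ?U k i * ?U k j) = (\<Sum>k<n. (if k = i then (if i = j then 1 else 0) else 0)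
        - (if k = i then 2 / q * v i * v j else 0) - (if k = j then 2 / q * v i * v j else 0)
        + 4 / (q * q) * v i * v j * (v k * v k))"
      by (intro sum.cong) (auto simp: algebra_simps)
    also have "\<dots> = (if i = j then 1 else 0) - 2 / q * v i * v j - 2 / q * v i * v j + 4 / (q * q) * v i * v j * q"
    proof -
      have "(\<Sum>k<n. 4 / (q * q) * v i * v j * (v k * v k)) = 4 / (q * q) * v i * v j * q"
        unfolding q_def inner_n_def sum_distrib_left[symmetric] by (rule refl)
      then show ?thesis using ij by (simp only: sum.distrib sum_subtractf sum.delta) simp
    qed
    also have "\<dots> = (if i = j then 1 else 0)" using assms by (simp add: q_def[symmetric] field_simps)
    finally show "(\<Sum>k<n. ?U k i * ?U k j) = (if i = j then 1 else 0)" .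
  qed
qed

lemma reflect_to_last_unit:
  assumes xi: "\<xi> \<in> sphere_n (Suc n)" "\<xi> \<noteq> last_unit n"
  obtains v where "v n \<noteq> 0" "inner_n (Suc n) v v \<noteq> 0" "reflect (Suc n) v (last_unit n) = \<xi>"
proof -
  have \<xi>: "\<xi> \<in> Rn (Suc n)" "(\<Sum>i<n. \<xi> i * \<xi> i) + \<xi> n * \<xi> n = 1"
    using xi by (simp_all add: sphere_n_def inner_n_def)
  have n1: "\<xi> n \<noteq> 1"
  proof
    assume "\<xi> n = 1"
    then have "(\<Sum>i<n. \<xi> i * \<xi> i) = 0" using \<xi> by simp
    then have "\<xi> i = 0" if "i < n" for i using that by (subst (asm) sum_nonneg_eq_0_iff) auto
    with \<open>\<xi> n = 1\<close> \<xi>(1) have "\<xi> = last_unit n"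
      by (auto simp: last_unit_def fun_eq_iff PiE_iff extensional_def less_Suc_eq)
    with xi show False by simp
  qed
  \<comment> \<open>\<open>v\<close> is \<open>\<xi>\<close> minus \<open>last_unit n\<close>, the
    normal of the reflection exchanging these two unit vectors. Its last entry is nonzero by
    \<open>n1\<close>, as \<open>distr_reflect\<close> demands.\<close>
  define v where "v = (\<lambda>i. if i = n then \<xi> n - 1 else \<xi> i)"
  have q: "inner_n (Suc n) v v = 2 - 2 * \<xi> n"
  proof -
    have "inner_n (Suc n) v v = (\<Sum>i<n. \<xi> i * \<xi> i) + (\<xi> n - 1) * (\<xi> n - 1)"
      by (simp add: inner_n_def v_def)
    also have "\<dots> = 2 - 2 * \<xi> n" using \<xi>(2) by (simp add: algebra_simps)
    finally show ?thesis .
  qed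
  have p: "inner_n (Suc n) v (last_unit n) = \<xi> n - 1"
    by (simp add: inner_n_def v_def last_unit_def)
  have "2 * (\<xi> n - 1) / (2 - 2 * \<xi> n) = -1" using n1 by (simp add: field_simps)
  then have "reflect (Suc n) v (last_unit n) i = \<xi> i" for i
    using \<xi>(1) unfolding reflect_def p q
    by (cases "i < n"; cases "i = n") (auto simp: v_def last_unit_def PiE_iff extensional_def)
  then have "reflect (Suc n) v (last_unit n) = \<xi>" by (rule ext)
  then show thesis using that[of v] n1 q by (auto simp: v_def)
qed

section \<open>Averaging over the sphere\<close>

lemma inner_n_last_unit: "inner_n (Suc n) x (last_unit n) = x n"
  by (simp add: inner_n_def last_unit_def)

lemma norm_n_reflect: "inner_n n v v \<noteq> 0 \<Longrightarrow> norm_n n (reflect n v x) = norm_n n x"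
  by (simp add: norm_n_def inner_n_reflect)

lemma norm_n_nonneg [simp]: "0 \<le> norm_n n x"
  by (simp add: norm_n_def inner_n_self_nonneg)

lemma norm_n_square: "norm_n n x * norm_n n x = inner_n n x x"
  by (simp add: norm_n_def inner_n_self_nonneg)

lemma abs_component_le_norm_n: "i < n \<Longrightarrow> \<bar>x i\<bar> \<le> norm_n n x"
proof -
  assume "i < n"
  then have "(x i)\<^sup>2 \<le> inner_n n x x"
    unfolding inner_n_def power2_eq_square by (intro member_le_sum) auto
  then show ?thesis unfolding norm_n_def by (rule real_le_rsqrt[of "\<bar>x i\<bar>", simplified power2_abs])
qed

text \<open>For a unit vector \<open>y\<close>, the open circular cone of those \<open>x\<close>
  whose cosine with \<open>y\<close> exceeds \<open>1 - d\<close>. Written without division it is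
  homogeneous in \<open>x\<close>, and the strict inequality excludes the origin.\<close>

definition in_cone :: "nat \<Rightarrow> real \<Rightarrow> (nat \<Rightarrow> real) \<Rightarrow> (nat \<Rightarrow> real) \<Rightarrow> bool" where
  "in_cone n d x y \<longleftrightarrow> (1 - d) * norm_n n x < inner_n n x y"

text \<open>A thin box around the axis fits into the truncated cone. Positivity is what permits
  cancellation in the double count.\<close>

lemma truncated_cone_positive:
  assumes d: "0 < d" "d < 1" and r: "0 < r"
  shows "0 < emeasure (lborel_n (Suc n)) {x \<in> Rn (Suc n). norm_n (Suc n) x \<le> r \<and> in_cone (Suc n) d x (last_unit n)}"
proof -
  \<comment> \<open>On the box the squared norm is at most \<open>2 * (2 * a)\<^sup>2\<close>, which
    is below \<open>(3 * a)\<^sup>2 = r\<^sup>2\<close>.\<close>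
  define a where "a = r / 3"
  have a: "0 < a" "r = 3 * a" using r by (simp_all add: a_def)
  \<comment> \<open>Makes the transversal part of the squared norm at most
    \<open>(a * d)\<^sup>2\<close>, hence at most \<open>d * (x n)\<^sup>2\<close>. The cone
    condition then follows from \<open>(1 - d)\<^sup>2 * (1 + d) < 1\<close>.\<close>
  define \<eta> where "\<eta> = a * d / real (Suc n)"
  have \<eta>: "0 < \<eta>" using a d by (simp add: \<eta>_def)
  let ?A = "\<lambda>i. if i = n then {a..2 * a} else {-\<eta>..\<eta>}"
  let ?B = "Pi\<^sub>E {..<Suc n} ?A"
  have "emeasure (lborel_n (Suc n)) ?B = (\<Prod>i<Suc n. emeasure lborel (?A i))"
    by (rule lborel_prod.emeasure_PiM) auto
  also have "\<dots> = ennreal ((2 * \<eta>) ^ n) * ennreal a"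
    using \<eta> a by (simp add: ennreal_power)
  also have "\<dots> > 0" using \<eta> a by (simp add: ennreal_zero_less_mult_iff)
  finally have "0 < emeasure (lborel_n (Suc n)) ?B" .
  also have "\<dots> \<le> emeasure (lborel_n (Suc n)) {x \<in> Rn (Suc n). norm_n (Suc n) x \<le> r \<and> in_cone (Suc n) d x (last_unit n)}"
  proof (rule emeasure_mono)
    show "{x \<in> Rn (Suc n). norm_n (Suc n) x \<le> r \<and> in_cone (Suc n) d x (last_unit n)} \<in> sets (lborel_n (Suc n))"
    proof -
      have "{x \<in> space (lborel_n (Suc n)). norm_n (Suc n) x \<le> r \<and> (1 - d) * norm_n (Suc n) x < inner_n (Suc n) x (last_unit n)} \<in> sets (lborel_n (Suc n))"
        by (intro sets.sets_Collect_conj borel_measurable_le borel_measurable_less borel_measurable_times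
            borel_measurable_const measurable_norm_n measurable_inner_n)
      then show ?thesis by (simp add: in_cone_def)
    qed
    show "?B \<subseteq> {x \<in> Rn (Suc n). norm_n (Suc n) x \<le> r \<and> in_cone (Suc n) d x (last_unit n)}"
    proof
      fix x assume x: "x \<in> ?B"
      have xA: "x i \<in> ?A i" if "i < Suc n" for i using PiE_mem[OF x, of i] that by simp
      have xn: "a \<le> x n" "x n \<le> 2 * a" using xA[of n] by simp_all
      have xi: "\<bar>x i\<bar> \<le> \<eta>" if "i < n" for i using xA[of i] that by (simp add: abs_le_iff minus_le_iff)
      have "(\<Sum>i<n. x i * x i) \<le> (\<Sum>i<n. \<eta> * \<eta>)"
      proof (rule sum_mono)
        fix i assume "i \<in> {..<n}"
        then have "\<bar>x i\<bar> * \<bar>x i\<bar> \<le> \<eta> * \<eta>" using xi \<eta> by (intro mult_mono) auto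
        then show "x i * x i \<le> \<eta> * \<eta>" by simp
      qed
      also have "\<dots> = real n * \<eta> * \<eta>" by simp
      also have "\<dots> \<le> (real (Suc n) * \<eta>) * (real (Suc n) * \<eta>)"
      proof -
        have "real n * (\<eta> * \<eta>) \<le> (real (Suc n) * real (Suc n)) * (\<eta> * \<eta>)"
          by (rule mult_right_mono) (auto simp: algebra_simps)
        then show ?thesis by (simp only: ac_simps)
      qed
      also have "real (Suc n) * \<eta> = a * d" by (simp add: \<eta>_def)
      also have "(a * d) * (a * d) \<le> (x n * d) * (x n * 1)"
        using xn a d by (intro mult_mono) auto
      finally have "inner_n (Suc n) x x \<le> (1 + d) * (x n)\<^sup>2"
        by (simp add: inner_n_def power2_eq_square algebra_simps)
      note q = this
      have x0: "0 < x n" using xn a by linarith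
      have "inner_n (Suc n) x x \<le> 2 * (2 * a)\<^sup>2"
        by (rule order_trans[OF q], intro mult_mono power_mono) (use d xn x0 in auto)
      also have "\<dots> \<le> r\<^sup>2" using a by (simp add: power_mult_distrib)
      finally have 1: "norm_n (Suc n) x \<le> r" unfolding norm_n_def using r by (intro real_le_lsqrt) auto
      have "((1 - d) * norm_n (Suc n) x)\<^sup>2 = (1 - d)\<^sup>2 * inner_n (Suc n) x x"
        by (simp add: power_mult_distrib norm_n_def inner_n_self_nonneg)
      also have "\<dots> \<le> (1 - d)\<^sup>2 * ((1 + d) * (x n)\<^sup>2)" by (intro mult_left_mono q) simp
      also have "\<dots> \<le> (1 - d) * ((1 + d) * (x n)\<^sup>2)"
        using d by (intro mult_right_mono) (auto simp: power2_eq_square mult_left_le)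
      also have "\<dots> = (1 - d * d) * (x n)\<^sup>2" by (simp add: algebra_simps)
      also have "\<dots> < (x n)\<^sup>2"
      proof -
        have "0 < (d * d) * (x n)\<^sup>2" using d x0 by simp
        then show ?thesis by (simp only: left_diff_distrib mult_1)
      qed
      finally have "(1 - d) * norm_n (Suc n) x < x n"
        by (rule power2_less_imp_less) (use x0 in simp)
      then show "x \<in> {x \<in> Rn (Suc n). norm_n (Suc n) x \<le> r \<and> in_cone (Suc n) d x (last_unit n)}"
        using 1 x by (auto simp: in_cone_def inner_n_last_unit PiE_iff extensional_def)
    qed
  qed
  finally show ?thesis .
qed

lemma rotation_invariant_measurableI:
  assumes "rotation_invariant_prob n \<sigma>" "f \<in> lborel_n n \<rightarrow>\<^sub>M N"
  shows "f \<in> \<sigma> \<rightarrow>\<^sub>M N"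
proof -
  have "f \<in> restrict_space (lborel_n n) (sphere_n n) \<rightarrow>\<^sub>M N"
    by (rule measurable_restrict_space1[OF assms(2)])
  moreover have "sets \<sigma> = sets (restrict_space (lborel_n n) (sphere_n n))"
    using assms(1) by (simp add: rotation_invariant_prob_def)
  ultimately show ?thesis by (simp cong: measurable_cong_sets)
qed

lemma rotation_invariant_reflect:
  assumes \<sigma>: "rotation_invariant_prob n \<sigma>" and v: "inner_n n v v \<noteq> 0"
  shows "reflect n v \<in> \<sigma> \<rightarrow>\<^sub>M \<sigma>" "distr \<sigma> \<sigma> (reflect n v) = \<sigma>"
proof -
  obtain U where "orthogonal_mat n U" "mat_vec n U = reflect n v"
    using reflect_as_mat_vec[OF v] .
  then show "distr \<sigma> \<sigma> (reflect n v) = \<sigma>" using \<sigma> unfolding rotation_invariant_prob_def by metis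
  have s: "sets \<sigma> = sets (restrict_space (lborel_n n) (sphere_n n))" "space \<sigma> = sphere_n n"
    using \<sigma> by (simp_all add: rotation_invariant_prob_def)
  have "reflect n v \<in> \<sigma> \<rightarrow>\<^sub>M restrict_space (lborel_n n) (sphere_n n)"
  proof (rule measurable_restrict_space2)
    show "reflect n v \<in> \<sigma> \<rightarrow>\<^sub>M lborel_n n"
      by (rule rotation_invariant_measurableI[OF \<sigma> measurable_reflect])
    show "reflect n v \<in> space \<sigma> \<rightarrow> sphere_n n"
      using v by (auto simp: s sphere_n_def inner_n_reflect)
  qed
  then show "reflect n v \<in> \<sigma> \<rightarrow>\<^sub>M \<sigma>" using s by (simp cong: measurable_cong_sets)
qed

text \<open>The Lebesgue marginal of the double count: a reflection moves \<open>y\<close> to the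
  last axis and preserves both norms and volume.\<close>

lemma ball_cone_rotation:
  assumes y: "y \<in> sphere_n (Suc n)"
  shows "emeasure (lborel_n (Suc n)) {x \<in> Rn (Suc n). norm_n (Suc n) x \<le> r \<and> in_cone (Suc n) d x y}
    = emeasure (lborel_n (Suc n)) {x \<in> Rn (Suc n). norm_n (Suc n) x \<le> r \<and> in_cone (Suc n) d x (last_unit n)}"
proof (cases "y = last_unit n")
  case False
  let ?M = "lborel_n (Suc n)"
  let ?C = "\<lambda>y. {x \<in> Rn (Suc n). norm_n (Suc n) x \<le> r \<and> in_cone (Suc n) d x y}"
  obtain v where v: "v n \<noteq> 0" "inner_n (Suc n) v v \<noteq> 0" "reflect (Suc n) v (last_unit n) = y"
    using reflect_to_last_unit[OF y False] .
  have C: "?C y \<in> sets ?M" for y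
  proof -
    have "{x \<in> space ?M. norm_n (Suc n) x \<le> r \<and> (1 - d) * norm_n (Suc n) x < inner_n (Suc n) x y} \<in> sets ?M"
      by (intro sets.sets_Collect_conj borel_measurable_le borel_measurable_less borel_measurable_times
          borel_measurable_const measurable_norm_n measurable_inner_n)
    then show ?thesis by (simp add: in_cone_def)
  qed
  have "emeasure ?M (?C (last_unit n)) = emeasure (distr ?M ?M (reflect (Suc n) v)) (?C (last_unit n))"
    by (simp only: distr_reflect[of v n, OF v(1)])
  also have "\<dots> = emeasure ?M (reflect (Suc n) v -` ?C (last_unit n) \<inter> space ?M)"
    by (rule emeasure_distr[OF measurable_reflect C])
  also have "reflect (Suc n) v -` ?C (last_unit n) \<inter> space ?M = ?C y"
    using v(2) by (auto simp: in_cone_def norm_n_reflect inner_n_reflect_swap v(3))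
  finally show ?thesis by simp
qed simp

text \<open>The marginal over \<open>\<sigma>\<close>: by homogeneity \<open>x\<close> is
  normalized, and a reflection moves it to the last axis. At \<open>x = 0\<close> the cone condition
  fails for every \<open>y\<close>, hence the restriction to nonzero \<open>x\<close>.\<close>

lemma sphere_cone_rotation:
  assumes \<sigma>: "rotation_invariant_prob (Suc n) \<sigma>" and x: "x \<in> Rn (Suc n)" "norm_n (Suc n) x \<noteq> 0"
  shows "emeasure \<sigma> {y \<in> space \<sigma>. in_cone (Suc n) d x y} = emeasure \<sigma> {y \<in> space \<sigma>. 1 - d < y n}"
proof -
  define s where "s = norm_n (Suc n) x"
  have s: "0 < s" using x by (simp add: s_def order_less_le)
  define \<xi> where "\<xi> = (\<lambda>i\<in>{..<Suc n}. x i / s)"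
  have inner_\<xi>: "inner_n (Suc n) x y = s * inner_n (Suc n) \<xi> y" for y
    using s unfolding inner_n_def sum_distrib_left by (intro sum.cong) (auto simp: \<xi>_def)
  have "inner_n (Suc n) \<xi> \<xi> = 1"
  proof -
    have "s * s = s * (s * inner_n (Suc n) \<xi> \<xi>)"
      using norm_n_square[of "Suc n" x] inner_\<xi>[of x] inner_\<xi>[of \<xi>] by (simp add: s_def inner_n_commute)
    then show ?thesis using s by simp
  qed
  then have \<xi>: "\<xi> \<in> sphere_n (Suc n)" by (simp add: sphere_n_def \<xi>_def)
  have cone: "in_cone (Suc n) d x y \<longleftrightarrow> 1 - d < inner_n (Suc n) \<xi> y" for y
    unfolding in_cone_def inner_\<xi> s_def[symmetric] using s by (simp add: mult.commute)
  show ?thesis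
  proof (cases "\<xi> = last_unit n")
    case True
    then show ?thesis by (simp add: cone inner_n_last_unit inner_n_commute[of "Suc n" "last_unit n"])
  next
    case False
    obtain v where v: "v n \<noteq> 0" "inner_n (Suc n) v v \<noteq> 0" "reflect (Suc n) v (last_unit n) = \<xi>"
      using reflect_to_last_unit[OF \<xi> False] .
    note R = rotation_invariant_reflect[OF \<sigma> v(2)]
    have A: "{y \<in> space \<sigma>. 1 - d < y n} \<in> sets \<sigma>"
      by (intro borel_measurable_less borel_measurable_const rotation_invariant_measurableI[OF \<sigma>] measurable_component_n) simp
    have "emeasure \<sigma> {y \<in> space \<sigma>. 1 - d < y n} = emeasure (distr \<sigma> \<sigma> (reflect (Suc n) v)) {y \<in> space \<sigma>. 1 - d < y n}"
      by (simp only: R)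
    also have "\<dots> = emeasure \<sigma> (reflect (Suc n) v -` {y \<in> space \<sigma>. 1 - d < y n} \<inter> space \<sigma>)"
      by (rule emeasure_distr[OF R(1) A])
    also have "reflect (Suc n) v -` {y \<in> space \<sigma>. 1 - d < y n} \<inter> space \<sigma> = {y \<in> space \<sigma>. in_cone (Suc n) d x y}"
    proof -
      have "reflect (Suc n) v y n = inner_n (Suc n) \<xi> y" for y
        using inner_n_reflect_swap[of "Suc n" v y "last_unit n"]
        unfolding v(3) inner_n_last_unit inner_n_commute[of "Suc n" y \<xi>] .
      then show ?thesis by (auto simp: cone intro: measurable_space[OF R(1)])
    qed
    finally show ?thesis by simp
  qed
qed

text \<open>Double counting of the pairs \<open>(x, y)\<close> with \<open>x\<close> in the cone around \<open>y\<close>: reflections make both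
  marginal integrals constant, so no uniqueness theorem for the invariant measure is needed.\<close>

theorem rotation_invariant_measure_le:
  assumes \<sigma>: "rotation_invariant_prob (Suc n) \<sigma>" and d: "0 < d" "d < 1" and r: "0 < r"
    and A: "A \<in> sets \<sigma>" and B: "B \<in> sets (lborel_n (Suc n))"
    and AB: "\<And>x y. y \<in> A \<Longrightarrow> x \<in> Rn (Suc n) \<Longrightarrow> norm_n (Suc n) x \<le> r \<Longrightarrow> in_cone (Suc n) d x y \<Longrightarrow> x \<in> B"
  shows "emeasure \<sigma> A * emeasure (lborel_n (Suc n)) {x \<in> Rn (Suc n). norm_n (Suc n) x \<le> r}
    \<le> emeasure (lborel_n (Suc n)) {x \<in> B. norm_n (Suc n) x \<le> r}"
proof -
  let ?M = "lborel_n (Suc n)"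
  interpret prob_space \<sigma> using \<sigma> by (simp add: rotation_invariant_prob_def)
  interpret finite_product_sigma_finite "\<lambda>_::nat. lborel :: real measure" "{..<Suc n}"
    by standard simp
  interpret P: pair_sigma_finite \<sigma> ?M ..
  let ?ball = "{x \<in> Rn (Suc n). norm_n (Suc n) x \<le> r}"
  let ?k = "\<lambda>y x. indicator {x \<in> Rn (Suc n). norm_n (Suc n) x \<le> r \<and> in_cone (Suc n) d x y} x :: ennreal"
  define c where "c = emeasure ?M {x \<in> Rn (Suc n). norm_n (Suc n) x \<le> r \<and> in_cone (Suc n) d x (last_unit n)}"
  define c' where "c' = emeasure \<sigma> {y \<in> space \<sigma>. 1 - d < y n}"
  have ball: "?ball \<in> sets ?M"
  proof -
    have "{x \<in> space ?M. norm_n (Suc n) x \<le> r} \<in> sets ?M"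
      by (intro borel_measurable_le borel_measurable_const measurable_norm_n)
    then show ?thesis by simp
  qed
  have space_\<sigma>: "space \<sigma> = sphere_n (Suc n)" using \<sigma> by (simp add: rotation_invariant_prob_def)
  have cone_sets: "{x \<in> Rn (Suc n). norm_n (Suc n) x \<le> r \<and> in_cone (Suc n) d x y} \<in> sets ?M" for y
  proof -
    have "{x \<in> space ?M. norm_n (Suc n) x \<le> r \<and> (1 - d) * norm_n (Suc n) x < inner_n (Suc n) x y} \<in> sets ?M"
      by (intro sets.sets_Collect_conj borel_measurable_le borel_measurable_less borel_measurable_times
          borel_measurable_const measurable_norm_n measurable_inner_n)
    then show ?thesis by (simp add: in_cone_def)
  qed
  have cone_sets': "{y \<in> space \<sigma>. in_cone (Suc n) d x y} \<in> sets \<sigma>" for x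
    unfolding in_cone_def
    by (intro borel_measurable_less borel_measurable_const rotation_invariant_measurableI[OF \<sigma>] measurable_inner_n)
  have k_meas: "(\<lambda>(y, x). ?k y x) \<in> borel_measurable (\<sigma> \<Otimes>\<^sub>M ?M)"
  proof -
    have fstm: "(\<lambda>p. fst p i) \<in> borel_measurable (\<sigma> \<Otimes>\<^sub>M ?M)" if "i < Suc n" for i
      by (rule measurable_compose[OF measurable_fst rotation_invariant_measurableI[OF \<sigma> measurable_component_n[OF that]]])
    have sndm: "(\<lambda>p. snd p i) \<in> borel_measurable (\<sigma> \<Otimes>\<^sub>M ?M)" if "i < Suc n" for i
      by (rule measurable_compose[OF measurable_snd measurable_component_n[OF that]])
    have nm: "(\<lambda>p. norm_n (Suc n) (snd p)) \<in> borel_measurable (\<sigma> \<Otimes>\<^sub>M ?M)"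
      by (rule measurable_compose[OF measurable_snd measurable_norm_n])
    have im: "(\<lambda>p. inner_n (Suc n) (snd p) (fst p)) \<in> borel_measurable (\<sigma> \<Otimes>\<^sub>M ?M)"
      unfolding inner_n_def by (intro borel_measurable_sum borel_measurable_times fstm sndm) auto
    have S: "{p \<in> space (\<sigma> \<Otimes>\<^sub>M ?M). norm_n (Suc n) (snd p) \<le> r \<and> (1 - d) * norm_n (Suc n) (snd p) < inner_n (Suc n) (snd p) (fst p)} \<in> sets (\<sigma> \<Otimes>\<^sub>M ?M)"
      by (intro sets.sets_Collect_conj borel_measurable_le borel_measurable_less borel_measurable_times borel_measurable_const nm im)
    show ?thesis
    proof (rule measurable_cong[THEN iffD2])
      show "(\<lambda>p. indicator {p \<in> space (\<sigma> \<Otimes>\<^sub>M ?M). norm_n (Suc n) (snd p) \<le> r \<and> (1 - d) * norm_n (Suc n) (snd p) < inner_n (Suc n) (snd p) (fst p)} p)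
         \<in> borel_measurable (\<sigma> \<Otimes>\<^sub>M ?M)"
        by (rule borel_measurable_indicator[OF S])
      fix p assume "p \<in> space (\<sigma> \<Otimes>\<^sub>M ?M)"
      then show "(case p of (y, x) \<Rightarrow> ?k y x) = indicator {p \<in> space (\<sigma> \<Otimes>\<^sub>M ?M). norm_n (Suc n) (snd p) \<le> r \<and> (1 - d) * norm_n (Suc n) (snd p) < inner_n (Suc n) (snd p) (fst p)} p"
        by (cases p) (simp add: in_cone_def space_pair_measure indicator_def)
    qed
  qed
  have inner_x: "(\<integral>\<^sup>+x. ?k y x \<partial>?M) = c" if "y \<in> space \<sigma>" for y
    using ball_cone_rotation[of y n r d] that cone_sets by (simp add: c_def space_\<sigma>)
  have inner_y: "(\<integral>\<^sup>+y. ?k y x \<partial>\<sigma>) = c' * indicator ?ball x" if x: "x \<in> Rn (Suc n)" "norm_n (Suc n) x \<noteq> 0" for x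
  proof -
    have "(\<integral>\<^sup>+y. ?k y x \<partial>\<sigma>) = (\<integral>\<^sup>+y. indicator ?ball x * indicator {y \<in> space \<sigma>. in_cone (Suc n) d x y} y \<partial>\<sigma>)"
      using x by (intro nn_integral_cong) (auto simp: indicator_def)
    also have "\<dots> = indicator ?ball x * emeasure \<sigma> {y \<in> space \<sigma>. in_cone (Suc n) d x y}"
      using cone_sets' by (simp add: nn_integral_cmult_indicator)
    also have "\<dots> = c' * indicator ?ball x"
      by (simp add: sphere_cone_rotation[OF \<sigma> x] c'_def mult.commute)
    finally show ?thesis .
  qed
  \<comment> \<open>At the origin the inner integral over \<open>\<sigma>\<close> is 0 instead of
    \<open>c'\<close>; the origin is a null set.\<close>
  have nz: "AE x in ?M. norm_n (Suc n) x \<noteq> 0"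
    using AE_lborel_n_last_nonzero
  proof eventually_elim
    case (elim x)
    then show ?case using abs_component_le_norm_n[of n "Suc n" x] by auto
  qed
  \<comment> \<open>Counting all pairs, with \<open>y\<close> ranging over the whole sphere,
    expresses \<open>c\<close> through \<open>c'\<close> and the volume of the ball.\<close>
  have "c = (\<integral>\<^sup>+y. c \<partial>\<sigma>)" by (simp add: emeasure_space_1)
  also have "\<dots> = (\<integral>\<^sup>+y. \<integral>\<^sup>+x. ?k y x \<partial>?M \<partial>\<sigma>)"
    by (intro nn_integral_cong) (simp only: inner_x)
  also have "\<dots> = (\<integral>\<^sup>+x. \<integral>\<^sup>+y. ?k y x \<partial>\<sigma> \<partial>?M)" by (rule P.Fubini'[symmetric, OF k_meas])
  also have "\<dots> = (\<integral>\<^sup>+x. c' * indicator ?ball x \<partial>?M)"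
  proof (rule nn_integral_cong_AE)
    show "AE x in ?M. (\<integral>\<^sup>+y. ?k y x \<partial>\<sigma>) = c' * indicator ?ball x"
      using nz AE_space
    proof eventually_elim
      case (elim x)
      then show ?case by (intro inner_y) simp_all
    qed
  qed
  also have "\<dots> = c' * emeasure ?M ?ball" by (rule nn_integral_cmult_indicator[OF ball])
  finally have cc': "c = c' * emeasure ?M ?ball" .
  have "0 < c" unfolding c_def by (rule truncated_cone_positive[OF d r])
  then have c'0: "c' \<noteq> 0" using cc' by auto
  have c'f: "c' \<noteq> \<infinity>" by (simp add: c'_def)
  \<comment> \<open>The same count restricted to \<open>y\<close> in \<open>A\<close>: by
    \<open>AB\<close> every \<open>x\<close> that occurs lies in \<open>B\<close>. The common factor
    \<open>c'\<close>, nonzero and finite, cancels at the end.\<close>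
  have "emeasure \<sigma> A * c = (\<integral>\<^sup>+y. c * indicator A y \<partial>\<sigma>)"
    by (simp add: nn_integral_cmult_indicator[OF A] mult.commute)
  also have "\<dots> = (\<integral>\<^sup>+y. \<integral>\<^sup>+x. indicator A y * ?k y x \<partial>?M \<partial>\<sigma>)"
  proof (intro nn_integral_cong)
    fix y assume y: "y \<in> space \<sigma>"
    have "(\<integral>\<^sup>+x. indicator A y * ?k y x \<partial>?M) = indicator A y * (\<integral>\<^sup>+x. ?k y x \<partial>?M)"
      using cone_sets by (intro nn_integral_cmult) simp
    then show "c * indicator A y = (\<integral>\<^sup>+x. indicator A y * ?k y x \<partial>?M)" by (simp only: inner_x[OF y] mult.commute)
  qed
  also have "\<dots> \<le> (\<integral>\<^sup>+y. \<integral>\<^sup>+x. indicator B x * ?k y x \<partial>?M \<partial>\<sigma>)"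
  proof (intro nn_integral_mono)
    fix y x
    show "indicator A y * ?k y x \<le> indicator B x * ?k y x"
      using AB[of y x] by (cases "y \<in> A"; cases "x \<in> B") (auto split: split_indicator)
  qed
  also have "\<dots> = (\<integral>\<^sup>+x. \<integral>\<^sup>+y. indicator B x * ?k y x \<partial>\<sigma> \<partial>?M)"
  proof (rule P.Fubini'[symmetric])
    have "(\<lambda>p. indicator B (snd p) :: ennreal) \<in> borel_measurable (\<sigma> \<Otimes>\<^sub>M ?M)"
      by (rule measurable_compose[OF measurable_snd borel_measurable_indicator[OF B]])
    from borel_measurable_times_ennreal[OF this k_meas]
    show "(\<lambda>(y, x). indicator B x * ?k y x) \<in> borel_measurable (\<sigma> \<Otimes>\<^sub>M ?M)"
      by (simp only: case_prod_beta')
  qed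
  also have "\<dots> = (\<integral>\<^sup>+x. c' * indicator {x \<in> B. norm_n (Suc n) x \<le> r} x \<partial>?M)"
  proof (rule nn_integral_cong_AE)
    show "AE x in ?M. (\<integral>\<^sup>+y. indicator B x * ?k y x \<partial>\<sigma>) = c' * indicator {x \<in> B. norm_n (Suc n) x \<le> r} x"
      using nz AE_space
    proof eventually_elim
      case (elim x)
      have "(\<lambda>y. ?k y x) \<in> borel_measurable \<sigma>"
        using measurable_compose[OF measurable_Pair2'[OF elim(2)] k_meas] by (simp only: prod.case)
      then have "(\<integral>\<^sup>+y. indicator B x * ?k y x \<partial>\<sigma>) = indicator B x * (\<integral>\<^sup>+y. ?k y x \<partial>\<sigma>)"
        by (rule nn_integral_cmult)
      also have "(\<integral>\<^sup>+y. ?k y x \<partial>\<sigma>) = c' * indicator ?ball x"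
        using elim by (intro inner_y) simp_all
      also have "indicator B x * (c' * indicator ?ball x) = c' * indicator {x \<in> B. norm_n (Suc n) x \<le> r} x"
        using elim by (auto simp: indicator_def)
      finally show ?case .
    qed
  qed
  also have "\<dots> = c' * emeasure ?M {x \<in> B. norm_n (Suc n) x \<le> r}"
  proof (rule nn_integral_cmult_indicator)
    have "{x \<in> B. norm_n (Suc n) x \<le> r} = B \<inter> ?ball" using sets.sets_into_space[OF B] by auto
    then show "{x \<in> B. norm_n (Suc n) x \<le> r} \<in> sets ?M" using B ball by auto
  qed
  finally have "c' * (emeasure \<sigma> A * emeasure ?M ?ball) \<le> c' * emeasure ?M {x \<in> B. norm_n (Suc n) x \<le> r}"
    by (simp add: cc' ac_simps)
  then show ?thesis using c'0 c'f by (simp add: ennreal_mult_le_mult_iff)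
qed

section \<open>Small ball estimate for the support function\<close>

locale centered_body =
  fixes n :: nat and K :: "(nat \<Rightarrow> real) set"
  assumes body: "convex_body n K" and cent: "centered n K" and vol: "volume_n n K = 1"
begin

text \<open>\<open>measure\<close> is 0 by default on nonmeasurable sets, so volume one forces
  measurability.\<close>

lemma K_sets: "K \<in> sets (lborel_n n)"
proof (rule ccontr)
  assume "K \<notin> sets (lborel_n n)"
  then have "volume_n n K = 0" unfolding volume_n_def by (rule measure_notin_sets)
  with vol show False by simp
qed

lemma emeasure_K: "emeasure (lborel_n n) K = 1"
proof -
  \<comment> \<open>An infinite \<open>emeasure\<close> would likewise give \<open>measure\<close>
    the value 0.\<close>
  have "emeasure (lborel_n n) K \<noteq> \<infinity>"
    using vol by (auto simp: volume_n_def measure_def)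
  then have "emeasure (lborel_n n) K = ennreal (measure (lborel_n n) K)"
    by (simp add: emeasure_eq_ennreal_measure)
  then show ?thesis using vol by (simp add: volume_n_def)
qed

lemma K_ne: "K \<noteq> {}"
  using emeasure_K by auto

lemma K_Rn: "K \<subseteq> Rn n"
  using sets.sets_into_space[OF K_sets] by simp

lemma coordinates_bounded: "\<exists>R. 0 \<le> R \<and> (\<forall>x\<in>K. \<forall>i<n. \<bar>x i\<bar> \<le> R)"
proof -
  have "\<exists>b. \<forall>x\<in>K. \<bar>x i\<bar> \<le> b" if "i < n" for i
  proof -
    have "compactin (powertop_real {..<n}) K" using body by (simp add: convex_body_def)
    moreover have "continuous_map (powertop_real {..<n}) euclideanreal (\<lambda>x. x i)"
      using that by (intro continuous_map_product_projection) simp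
    ultimately have "compactin euclideanreal ((\<lambda>x. x i) ` K)" by (rule image_compactin)
    then have "bounded ((\<lambda>x. x i) ` K)" by (intro compact_imp_bounded) simp
    then show ?thesis by (auto simp: bounded_iff)
  qed
  then obtain b where b: "\<And>i x. i < n \<Longrightarrow> x \<in> K \<Longrightarrow> \<bar>x i\<bar> \<le> b i" by metis
  have "\<bar>x i\<bar> \<le> (\<Sum>j<n. \<bar>b j\<bar>)" if "x \<in> K" "i < n" for x i
  proof -
    have "\<bar>x i\<bar> \<le> \<bar>b i\<bar>" using b[OF that(2,1)] by linarith
    also have "\<dots> \<le> (\<Sum>j<n. \<bar>b j\<bar>)" using that by (intro member_le_sum) auto
    finally show ?thesis .
  qed
  then show ?thesis by (intro exI[of _ "\<Sum>j<n. \<bar>b j\<bar>"]) (auto intro: sum_nonneg)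
qed

lemma norm_bounded: "\<exists>R>0. \<forall>x\<in>K. norm_n n x \<le> R"
proof -
  obtain R where R: "0 \<le> R" "\<And>x i. x \<in> K \<Longrightarrow> i < n \<Longrightarrow> \<bar>x i\<bar> \<le> R" using coordinates_bounded by metis
  \<comment> \<open>The \<open>+ 1\<close> keeps the bound positive, since it serves as a divisor
    later.\<close>
  have "norm_n n x \<le> sqrt (real n * (R * R)) + 1" if "x \<in> K" for x
  proof -
    have "inner_n n x x \<le> (\<Sum>i<n. R * R)"
      unfolding inner_n_def
    proof (rule sum_mono)
      fix i assume "i \<in> {..<n}"
      then have "\<bar>x i\<bar> * \<bar>x i\<bar> \<le> R * R" using R that by (intro mult_mono) auto
      then show "x i * x i \<le> R * R" by simp
    qed
    then have "norm_n n x \<le> sqrt (real n * (R * R))" unfolding norm_n_def by (intro real_sqrt_le_mono) simp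
    then show ?thesis by simp
  qed
  moreover have "0 < sqrt (real n * (R * R)) + 1" by (intro add_nonneg_pos) simp_all
  ultimately show ?thesis by blast
qed

lemma inner_bdd_above: "bdd_above (inner_n n x ` K)"
proof -
  obtain R where R: "0 \<le> R" "\<And>x i. x \<in> K \<Longrightarrow> i < n \<Longrightarrow> \<bar>x i\<bar> \<le> R" using coordinates_bounded by metis
  have "inner_n n x y \<le> (\<Sum>i<n. \<bar>x i\<bar> * R)" if "y \<in> K" for y
    unfolding inner_n_def
  proof (rule sum_mono)
    fix i assume "i \<in> {..<n}"
    have "x i * y i \<le> \<bar>x i\<bar> * \<bar>y i\<bar>" by (simp add: abs_mult[symmetric])
    also have "\<dots> \<le> \<bar>x i\<bar> * R" using R that \<open>i \<in> _\<close> by (intro mult_left_mono) auto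
    finally show "x i * y i \<le> \<bar>x i\<bar> * R" .
  qed
  then show ?thesis by (rule bdd_aboveI2)
qed

lemma inner_le_support: "y \<in> K \<Longrightarrow> inner_n n x y \<le> support_fun n K x"
  unfolding support_fun_def by (intro cSUP_upper inner_bdd_above)

lemma support_le: "(\<And>y. y \<in> K \<Longrightarrow> inner_n n x y \<le> c) \<Longrightarrow> support_fun n K x \<le> c"
  unfolding support_fun_def using K_ne by (intro cSUP_least)

lemma log_concave_indicator: "log_concave_bounded n (indicator K)"
proof -
  obtain R where R: "0 \<le> R" "\<And>x i. x \<in> K \<Longrightarrow> i < n \<Longrightarrow> \<bar>x i\<bar> \<le> R" using coordinates_bounded by metis
  have mid: "midpoint_n n x y \<in> K" if "x \<in> K" "y \<in> K" for x y
  proof -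
    have "convex_n n K" using body by (simp add: convex_body_def)
    from this[unfolded convex_n_def, rule_format, OF that, of "1/2" "1/2"]
    have "(\<lambda>i\<in>{..<n}. (1/2) * x i + (1/2) * y i) \<in> K" by simp
    also have "(\<lambda>i\<in>{..<n}. (1/2) * x i + (1/2) * y i) = midpoint_n n x y"
      unfolding midpoint_n_def by (intro restrict_ext) (simp add: field_simps)
    finally show ?thesis .
  qed
  show ?thesis
    unfolding log_concave_bounded_def
  proof (intro conjI ballI)
    show "(indicator K :: _ \<Rightarrow> real) \<in> borel_measurable (lborel_n n)" by (rule borel_measurable_indicator[OF K_sets])
    show "\<exists>B R. \<forall>x\<in>Rn n. (indicator K x :: real) \<le> B \<and> (indicator K x \<noteq> (0 :: real) \<longrightarrow> (\<forall>i<n. \<bar>x i\<bar> \<le> R))"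
      using R by (intro exI[of _ 1] exI[of _ R]) (auto simp: indicator_def)
    show "indicator K x * indicator K y \<le> (indicator K (midpoint_n n x y) :: real)\<^sup>2" for x y
      using mid[of x y] by (auto simp: indicator_def)
  qed simp
qed

lemma barycenter_zero: "i < n \<Longrightarrow> (LINT x|lborel_n n. x i * indicator K x) = 0"
proof -
  assume i: "i < n"
  have "barycenter n K i = 0" using cent i by (simp add: centered_def)
  then have "(LINT x:K|lborel_n n. x i) = 0" using i vol by (simp add: barycenter_def)
  then show ?thesis by (simp add: set_lebesgue_integral_def mult.commute)
qed

text \<open>Integrate \<open>inner_n n x y \<le> support_fun n K x\<close> over \<open>y\<close> in
  \<open>K\<close>: the left side gives 0 because \<open>K\<close> is centered, the right side keeps
  its value because the volume is one.\<close>

lemma support_nonneg: "0 \<le> support_fun n K x"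
proof -
  let ?M = "lborel_n n"
  have int: "integrable ?M (\<lambda>y. 1 * (y i * indicator K y))" if "i < n" for i
    by (rule log_concave_bounded_integrable(2)[OF log_concave_indicator _ _ that]) auto
  have sum: "integrable ?M (\<lambda>y. \<Sum>i<n. x i * (y i * indicator K y))"
    using int by (intro Bochner_Integration.integrable_sum integrable_mult_right) auto
  have "(LINT y|?M. (\<Sum>i<n. x i * (y i * indicator K y))) = (\<Sum>i<n. x i * (LINT y|?M. y i * indicator K y))"
    using int by (subst Bochner_Integration.integral_sum) auto
  also have "\<dots> = 0" by (simp add: barycenter_zero)
  finally have 0: "(LINT y|?M. (\<Sum>i<n. x i * (y i * indicator K y))) = 0" .
  have "(LINT y|?M. (\<Sum>i<n. x i * (y i * indicator K y))) \<le> (LINT y|?M. support_fun n K x * indicator K y)"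
  proof (rule integral_mono[OF sum])
    show "integrable ?M (\<lambda>y. support_fun n K x * indicator K y)"
      using K_sets emeasure_K by (intro integrable_mult_right) simp
    fix y
    have "(\<Sum>i<n. x i * (y i * indicator K y)) = inner_n n x y * indicator K y"
      by (simp add: inner_n_def sum_distrib_right mult.assoc)
    also have "\<dots> \<le> support_fun n K x * indicator K y"
      using inner_le_support[of y x] by (auto simp: indicator_def)
    finally show "(\<Sum>i<n. x i * (y i * indicator K y)) \<le> support_fun n K x * indicator K y" .
  qed
  also have "\<dots> = support_fun n K x" using K_sets vol by (simp add: volume_n_def Int_absorb2[OF K_Rn])
  finally show ?thesis using 0 by simp
qed

text \<open>The supremum may run over uncountably many \<open>y\<close>, but its superlevel sets are
  unions of open sets in the product topology on all functions. The result is pulled back to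
  \<open>lborel_n n\<close>, where the coordinates outside \<open>{..<n}\<close> are
  constant.\<close>

lemma measurable_support: "support_fun n K \<in> borel_measurable (lborel_n n)"
proof -
  have id: "(\<lambda>x. x) \<in> lborel_n n \<rightarrow>\<^sub>M (borel :: (nat \<Rightarrow> real) measure)"
  proof (rule measurable_coordinatewise_then_product)
    fix i
    show "(\<lambda>x. x i) \<in> borel_measurable (lborel_n n)"
    proof (cases "i < n")
      case False
      have "(\<lambda>x. x i) \<in> borel_measurable (lborel_n n) \<longleftrightarrow> (\<lambda>x. undefined :: real) \<in> borel_measurable (lborel_n n)"
        using False by (intro measurable_cong) (auto simp: PiE_iff extensional_def)
      then show ?thesis by simp
    qed (rule measurable_component_n)
  qed
  have "support_fun n K \<in> borel_measurable borel"
    unfolding borel_measurable_iff_greater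
  proof
    fix a
    have "{x \<in> space borel. a < support_fun n K x} = (\<Union>y\<in>K. {x. a < inner_n n x y})"
      unfolding support_fun_def using less_cSUP_iff[OF K_ne inner_bdd_above] by auto
    moreover have "open {x. a < inner_n n x y}" for y
      unfolding inner_n_def
      by (intro open_Collect_less continuous_on_const continuous_on_sum continuous_on_mult continuous_on_product_coordinates)
    ultimately show "{x \<in> space borel. a < support_fun n K x} \<in> sets borel"
      by (simp only:) (intro borel_open open_UN ballI)
  qed
  from measurable_compose[OF id this] show ?thesis .
qed

lemma integral_exp_support_le: "(\<integral>\<^sup>+y. ennreal (exp (- support_fun n K y)) \<partial>lborel_n n) \<le> 384 ^ n"
proof -
  have "(\<integral>\<^sup>+x. ennreal (indicator K x) \<partial>lborel_n n) * (\<integral>\<^sup>+y. ennreal (exp (- support_fun n K y)) \<partial>lborel_n n) \<le> 384 ^ n"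
  proof (rule santalo_boundD[OF functional_santalo log_concave_indicator barycenter_zero])
    show "(\<lambda>y. ennreal (exp (- support_fun n K y))) \<in> borel_measurable (lborel_n n)"
      by (rule measurable_compose[OF measurable_support]) simp
    show "ennreal (indicator K x) * ennreal (exp (- support_fun n K y)) \<le> ennreal (exp (- inner_n n x y))" for x y
      using inner_le_support[of x y] by (auto simp: indicator_def inner_n_commute[of n x y])
  qed
  moreover have "(\<integral>\<^sup>+x. ennreal (indicator K x) \<partial>lborel_n n) = 1"
    using K_sets by (simp add: ennreal_indicator emeasure_K)
  ultimately show ?thesis by simp
qed

text \<open>Write \<open>x\<close> as \<open>z + c * y\<close> with \<open>c\<close> the norm of
  \<open>x\<close>. The cone condition bounds the norm of \<open>z\<close> by
  \<open>sqrt (2 * d) * c\<close>, so by Cauchy-Schwarz \<open>z\<close> contributes at most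
  \<open>sqrt (2 * d) * c * R\<close>, while \<open>c * y\<close> contributes at most
  \<open>c * s\<close>.\<close>

lemma support_in_cone_le:
  assumes y: "inner_n n y y = 1" "support_fun n K y \<le> s" and R: "\<And>w. w \<in> K \<Longrightarrow> norm_n n w \<le> R"
    and cone: "in_cone n d x y"
  shows "support_fun n K x \<le> (s + sqrt (2 * d) * R) * norm_n n x"
proof (rule support_le)
  fix w assume w: "w \<in> K"
  define c where "c = norm_n n x"
  have c0: "0 \<le> c" by (simp add: c_def)
  define z where "z = (\<lambda>i\<in>{..<n}. x i - c * y i)"
  have z: "inner_n n z u = inner_n n x u - c * inner_n n y u" for u
    unfolding z_def by (rule inner_n_diff_scale_left)
  have "inner_n n z z = inner_n n x z - c * inner_n n y z" by (rule z)
  also have "\<dots> = 2 * (c * c) - 2 * c * inner_n n x y"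
    using y(1) by (simp add: inner_n_commute[of n _ z] z norm_n_square c_def[symmetric] inner_n_commute[of n y x])
       (simp add: c_def norm_n_square algebra_simps)
  also have "\<dots> \<le> 2 * (c * c) - 2 * c * ((1 - d) * c)"
    using cone c0 by (intro diff_left_mono mult_left_mono) (auto simp: in_cone_def c_def)
  finally have zz: "inner_n n z z \<le> 2 * d * (c * c)" by (simp add: algebra_simps)
  have "(inner_n n z w)\<^sup>2 \<le> inner_n n z z * inner_n n w w"
    using Cauchy_Schwarz_ineq_sum[of z w "{..<n}"] by (simp add: inner_n_def power2_eq_square)
  then have "\<bar>inner_n n z w\<bar> \<le> norm_n n z * norm_n n w"
    unfolding norm_n_def real_sqrt_mult[symmetric] by (metis real_sqrt_abs real_sqrt_le_mono)
  also have "\<dots> \<le> sqrt (2 * d) * c * R"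
  proof -
    have "norm_n n z \<le> sqrt (2 * d * (c * c))" unfolding norm_n_def by (intro real_sqrt_le_mono zz)
    then have nz: "norm_n n z \<le> sqrt (2 * d) * c" using c0 by (simp add: real_sqrt_mult)
    show ?thesis by (rule mult_mono[OF nz R[OF w] order_trans[OF norm_n_nonneg nz] norm_n_nonneg])
  qed
  finally have 1: "inner_n n z w \<le> sqrt (2 * d) * c * R" by linarith
  have "inner_n n x w = inner_n n z w + c * inner_n n y w" by (simp add: z)
  also have "\<dots> \<le> sqrt (2 * d) * c * R + c * s"
    using inner_le_support[OF w, of y] y(2) by (intro add_mono 1 mult_left_mono c0) simp
  finally show "inner_n n x w \<le> (s + sqrt (2 * d) * R) * norm_n n x"
    by (simp add: c_def[symmetric] algebra_simps)
qed

text \<open>The gap between \<open>s\<close> and \<open>s'\<close> pays for thickening directions to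
  cones: around a unit vector where the support function is at most \<open>s\<close>, it is at most
  \<open>s'\<close> times the norm on a thin cone. These cones lie in \<open>B\<close>, and the
  double count applies.\<close>

lemma small_ball_estimate_aux:
  assumes n: "1 \<le> n" and \<sigma>: "rotation_invariant_prob n \<sigma>" and s: "0 < s" "s < s'"
  shows "measure \<sigma> {\<theta> \<in> sphere_n n. support_fun n K \<theta> \<le> s} \<le> (192 * exp 1 / sqrt (real n) * s') ^ n"
proof -
  obtain m where m: "n = Suc m" using n by (cases n) auto
  interpret S: prob_space \<sigma> using \<sigma> by (simp add: rotation_invariant_prob_def)
  obtain R where R: "0 < R" "\<And>w. w \<in> K \<Longrightarrow> norm_n n w \<le> R" using norm_bounded by blast
  let ?M = "lborel_n n"
  define A where "A = {\<theta> \<in> sphere_n n. support_fun n K \<theta> \<le> s}"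
  define e where "e = (s' - s) / R"
  have e: "0 < e" using s R by (simp add: e_def)
  \<comment> \<open>Chosen so that \<open>sqrt (2 * d) * R \<le> s' - s\<close>; the
    \<open>1/2\<close> keeps \<open>d < 1\<close>.\<close>
  define d where "d = min (1/2) (e\<^sup>2 / 2)"
  have d: "0 < d" "d < 1" using e by (auto simp: d_def)
  have "sqrt (2 * d) \<le> sqrt (e\<^sup>2)" by (intro real_sqrt_le_mono) (simp add: d_def min_def)
  then have "sqrt (2 * d) * R \<le> e * R" using e R by (intro mult_right_mono) auto
  then have sd: "s + sqrt (2 * d) * R \<le> s'" using R by (simp add: e_def)
  define r where "r = real n / s'"
  have r: "0 < r" using n s by (simp add: r_def)
  define B where "B = {x \<in> Rn n. support_fun n K x \<le> s' * norm_n n x}"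
  have A_sets: "A \<in> sets \<sigma>"
  proof -
    have "{\<theta> \<in> space \<sigma>. support_fun n K \<theta> \<le> s} \<in> sets \<sigma>"
      by (intro borel_measurable_le borel_measurable_const rotation_invariant_measurableI[OF \<sigma>] measurable_support)
    then show ?thesis using \<sigma> by (simp add: A_def rotation_invariant_prob_def)
  qed
  have B_sets: "B \<in> sets ?M"
  proof -
    have "{x \<in> space ?M. support_fun n K x \<le> s' * norm_n n x} \<in> sets ?M"
      by (intro borel_measurable_le borel_measurable_times borel_measurable_const measurable_support measurable_norm_n)
    then show ?thesis by (simp add: B_def)
  qed
  have AB: "x \<in> B" if "y \<in> A" "x \<in> Rn n" "in_cone n d x y" for x y
  proof -
    have "support_fun n K x \<le> (s + sqrt (2 * d) * R) * norm_n n x"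
      using that R by (intro support_in_cone_le[of y]) (auto simp: A_def sphere_n_def)
    also have "\<dots> \<le> s' * norm_n n x" by (intro mult_right_mono sd) simp
    finally show ?thesis using that by (simp add: B_def)
  qed
  have main: "emeasure \<sigma> A * emeasure ?M {x \<in> Rn n. norm_n n x \<le> r} \<le> emeasure ?M {x \<in> B. norm_n n x \<le> r}"
    unfolding m using \<sigma> d r A_sets B_sets AB unfolding m by (intro rotation_invariant_measure_le) auto
  have up: "emeasure ?M {x \<in> B. norm_n n x \<le> r} \<le> ennreal ((384 * exp 1) ^ n)"
  proof -
    let ?D = "{x \<in> B. norm_n n x \<le> r}"
    have D: "?D \<in> sets ?M"
    proof -
      have "{x \<in> space ?M. norm_n n x \<le> r} \<in> sets ?M"
        by (intro borel_measurable_le borel_measurable_const measurable_norm_n)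
      moreover have "?D = B \<inter> {x \<in> space ?M. norm_n n x \<le> r}" by (auto simp: B_def)
      ultimately show ?thesis using B_sets by auto
    qed
    have "ennreal (exp (- real n)) * emeasure ?M ?D = (\<integral>\<^sup>+x. ennreal (exp (- real n)) * indicator ?D x \<partial>?M)"
      by (rule nn_integral_cmult_indicator[OF D, symmetric])
    also have "\<dots> \<le> (\<integral>\<^sup>+x. ennreal (exp (- support_fun n K x)) \<partial>?M)"
    proof (rule nn_integral_mono)
      fix x
      show "ennreal (exp (- real n)) * indicator ?D x \<le> ennreal (exp (- support_fun n K x))"
      proof (cases "x \<in> ?D")
        case True
        then have "support_fun n K x \<le> s' * norm_n n x" "norm_n n x \<le> r" by (auto simp: B_def)
        moreover have "s' * norm_n n x \<le> s' * r" using \<open>norm_n n x \<le> r\<close> s by (intro mult_left_mono) auto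
        ultimately have "support_fun n K x \<le> real n" using s by (simp add: r_def)
        then show ?thesis using True by (simp add: ennreal_leI)
      qed simp
    qed
    also have "\<dots> \<le> 384 ^ n" by (rule integral_exp_support_le)
    finally have "ennreal (exp (real n)) * (ennreal (exp (- real n)) * emeasure ?M ?D) \<le> ennreal (exp (real n)) * 384 ^ n"
      by (rule mult_left_mono) simp
    moreover have "ennreal (exp (real n)) * (ennreal (exp (- real n)) * emeasure ?M ?D) = emeasure ?M ?D"
      by (simp add: mult.assoc[symmetric] ennreal_mult'[symmetric] exp_minus)
    moreover have "ennreal (exp (real n)) * 384 ^ n = ennreal ((384 * exp 1) ^ n)"
    proof -
      have "ennreal ((384 * exp 1) ^ n) = ennreal (exp (real n) * 384 ^ n)"
        by (simp add: power_mult_distrib exp_of_nat_mult[symmetric] mult.commute)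
      also have "\<dots> = ennreal (exp (real n)) * ennreal (384 ^ n)" by (simp add: ennreal_mult)
      also have "ennreal (384 ^ n) = 384 ^ n" by (simp add: ennreal_power[symmetric])
      finally show ?thesis by simp
    qed
    ultimately show ?thesis by simp
  qed
  define l where "l = sqrt (real n) / s'"
  have l: "0 < l" using n s by (simp add: l_def)
  have low: "ennreal ((2 * l) ^ n) \<le> emeasure ?M {x \<in> Rn n. norm_n n x \<le> r}"
  proof -
    have "ennreal ((2 * l) ^ n) = emeasure ?M ({..<n} \<rightarrow>\<^sub>E {-l..l})"
      using l by (simp add: emeasure_lborel_n_cube)
    also have "\<dots> \<le> emeasure ?M {x \<in> Rn n. norm_n n x \<le> r}"
    proof (rule emeasure_mono)
      show "{..<n} \<rightarrow>\<^sub>E {-l..l} \<subseteq> {x \<in> Rn n. norm_n n x \<le> r}"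
      proof
        fix x assume x: "x \<in> {..<n} \<rightarrow>\<^sub>E {-l..l}"
        have "inner_n n x x \<le> (\<Sum>i<n. l * l)"
          unfolding inner_n_def
        proof (rule sum_mono)
          fix i assume "i \<in> {..<n}"
          then have "\<bar>x i\<bar> \<le> l" using PiE_mem[OF x, of i] by (simp add: abs_le_iff minus_le_iff)
          then have "\<bar>x i\<bar> * \<bar>x i\<bar> \<le> l * l" using l by (intro mult_mono) auto
          then show "x i * x i \<le> l * l" by simp
        qed
        also have "\<dots> = r\<^sup>2" by (simp add: l_def r_def power2_eq_square)
        finally have "norm_n n x \<le> r" unfolding norm_n_def using r by (intro real_le_lsqrt) auto
        then show "x \<in> {x \<in> Rn n. norm_n n x \<le> r}" using x by (auto simp: PiE_iff)
      qed
      have "{x \<in> space ?M. norm_n n x \<le> r} \<in> sets ?M"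
        by (intro borel_measurable_le borel_measurable_const measurable_norm_n)
      then show "{x \<in> Rn n. norm_n n x \<le> r} \<in> sets ?M" by simp
    qed
    finally show ?thesis .
  qed
  have "ennreal (measure \<sigma> A * (2 * l) ^ n) = emeasure \<sigma> A * ennreal ((2 * l) ^ n)"
    using l by (simp add: S.emeasure_eq_measure ennreal_mult)
  also have "\<dots> \<le> emeasure \<sigma> A * emeasure ?M {x \<in> Rn n. norm_n n x \<le> r}" by (intro mult_left_mono low) simp
  also note main
  also note up
  finally have "measure \<sigma> A * (2 * l) ^ n \<le> (384 * exp 1) ^ n" by (subst (asm) ennreal_le_iff) auto
  then have "measure \<sigma> A \<le> (384 * exp 1) ^ n / (2 * l) ^ n" using l by (simp add: pos_le_divide_eq)
  also have "\<dots> = (384 * exp 1 / (2 * l)) ^ n" by (rule power_divide[symmetric])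
  also have "384 * exp 1 / (2 * l) = 192 * exp 1 / sqrt (real n) * s'" using s by (simp add: l_def)
  finally show ?thesis by (simp add: A_def)
qed

text \<open>Let \<open>s'\<close> decrease to \<open>s\<close> in the preceding bound, whose right
  side is continuous in \<open>s'\<close>.\<close>

theorem small_ball_estimate:
  assumes n: "1 \<le> n" and \<sigma>: "rotation_invariant_prob n \<sigma>" and s: "0 < s"
  shows "measure \<sigma> {\<theta> \<in> sphere_n n. support_fun n K \<theta> \<le> s} \<le> (192 * exp 1 / sqrt (real n) * s) ^ n"
proof (rule tendsto_lowerbound)
  show "((\<lambda>s'. (192 * exp 1 / sqrt (real n) * s') ^ n) \<longlongrightarrow> (192 * exp 1 / sqrt (real n) * s) ^ n) (at_right s)"
    by (intro tendsto_intros)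
  show "eventually (\<lambda>s'. measure \<sigma> {\<theta> \<in> sphere_n n. support_fun n K \<theta> \<le> s} \<le> (192 * exp 1 / sqrt (real n) * s') ^ n) (at_right s)"
    using eventually_at_right_less[of s] by eventually_elim (rule small_ball_estimate_aux[OF n \<sigma> s])
qed simp

end

section \<open>From the small ball estimate to the bound for \<open>d_star\<close>\<close>

lemma neg_ln_nonneg: "0 \<le> p \<Longrightarrow> p \<le> 1 \<Longrightarrow> 0 \<le> neg_ln p"
  by (auto simp: neg_ln_def)

lemma neg_ln_power_ge:
  assumes "0 \<le> p" "p \<le> q ^ n" "0 < q"
  shows "ereal (real n * ln (1 / q)) \<le> neg_ln p"
proof (cases "p = 0")
  case False
  then have "ln p \<le> ln (q ^ n)" using assms by simp
  then show ?thesis using False assms by (simp add: neg_ln_def ln_realpow ln_div)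
qed (simp add: neg_ln_def)

theorem theorem1p1:
  shows "\<exists>c1 c2 :: real. c1 > 0 \<and> c2 > 0 \<and>
    (\<forall>(n::nat) \<ge> 1. \<forall>(\<sigma> :: (nat \<Rightarrow> real) measure) (K :: (nat \<Rightarrow> real) set).
      rotation_invariant_prob n \<sigma> \<longrightarrow>
      convex_body n K \<longrightarrow> centered n K \<longrightarrow> volume_n n K = 1 \<longrightarrow>
      (\<forall>t::real. 0 < t \<longrightarrow> t < 1 \<longrightarrow>
        d_star n \<sigma> K t \<ge>
          ereal (min (real n)
            (real n * max 0 (ln (c1 * sqrt (real n) / (t * mean_support n \<sigma> K))))) \<and>
        (t \<le> c2 * sqrt (real n) / mean_support n \<sigma> K \<longrightarrow> d_star n \<sigma> K t = ereal (real n))))"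
proof -
  \<comment> \<open>The reciprocal of the constant in \<open>small_ball_estimate\<close>.\<close>
  define c1 :: real where "c1 = 1 / (192 * exp 1)"
  \<comment> \<open>Dividing by \<open>exp 1\<close> makes the logarithm in the lower bound at least
    1.\<close>
  define c2 :: real where "c2 = c1 / exp 1"
  have c: "0 < c1" "0 < c2" by (simp_all add: c1_def c2_def)
  have "d_star n \<sigma> K t \<ge> ereal (min (real n)
            (real n * max 0 (ln (c1 * sqrt (real n) / (t * mean_support n \<sigma> K)))))" (is ?lower)
    and "t \<le> c2 * sqrt (real n) / mean_support n \<sigma> K \<Longrightarrow> d_star n \<sigma> K t = ereal (real n)"
    if n: "1 \<le> n" and \<sigma>: "rotation_invariant_prob n \<sigma>" and K: "convex_body n K" "centered n K" "volume_n n K = 1"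
      and t: "0 < t" for n \<sigma> K and t :: real
  proof -
    interpret centered_body n K using K by unfold_locales
    interpret S: prob_space \<sigma> using \<sigma> by (simp add: rotation_invariant_prob_def)
    define w where "w = mean_support n \<sigma> K"
    define p where "p = measure \<sigma> {\<theta> \<in> sphere_n n. support_fun n K \<theta> \<le> t * w}"
    have p: "0 \<le> p" "p \<le> 1" by (simp_all add: p_def)
    have d: "d_star n \<sigma> K t = min (neg_ln p) (ereal (real n))" by (simp add: d_star_def p_def w_def)
    have w0: "0 \<le> w" unfolding w_def mean_support_def by (intro integral_nonneg_AE AE_I2 support_nonneg)
    have log: "ereal (real n * ln (c1 * sqrt (real n) / (t * w))) \<le> neg_ln p" if "0 < w"
    proof -
      have tw: "0 < t * w" using t that by simp
      define q where "q = 192 * exp 1 / sqrt (real n) * (t * w)"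
      have q: "0 < q" using tw n by (simp add: q_def)
      have "p \<le> q ^ n" unfolding p_def q_def by (rule small_ball_estimate[OF n \<sigma> tw])
      from neg_ln_power_ge[OF p(1) this q]
      have "ereal (real n * ln (1 / q)) \<le> neg_ln p" .
      moreover have "1 / q = c1 * sqrt (real n) / (t * w)" by (simp add: q_def c1_def)
      ultimately show ?thesis by simp
    qed
    show ?lower
    proof (cases "w = 0")
      \<comment> \<open>Positivity of \<open>w\<close> is not established. For \<open>w = 0\<close>
        the quotient is 0 and \<open>ln 0 = 0\<close> by convention, so the bound becomes
        nonnegativity of \<open>d_star n \<sigma> K t\<close>.\<close>
      case True
      then show ?thesis unfolding d w_def[symmetric] using neg_ln_nonneg[OF p] by (simp add: zero_ereal_def[symmetric])
    next
      case False
      with w0 log have "ereal (real n * max 0 (ln (c1 * sqrt (real n) / (t * w)))) \<le> neg_ln p"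
        using neg_ln_nonneg[OF p] by (auto simp: max_def zero_ereal_def)
      then show ?thesis unfolding d w_def[symmetric]
        by (simp add: min_le_iff_disj flip: ereal_min) (meson ereal_less_eq(3) min.cobounded1 min.cobounded2 order_trans)
    qed
    assume "t \<le> c2 * sqrt (real n) / mean_support n \<sigma> K"
    then have tle: "t \<le> c2 * sqrt (real n) / w" by (simp add: w_def)
    \<comment> \<open>Division by zero yields 0, so \<open>w = 0\<close> would give
      \<open>t \<le> 0\<close>.\<close>
    have w: "0 < w" using tle t w0 by (cases "w = 0") auto
    have "t * w \<le> c2 * sqrt (real n)" using tle w by (simp add: pos_le_divide_eq)
    then have "exp 1 * (t * w) \<le> c1 * sqrt (real n)" by (simp add: c2_def field_simps)
    then have "exp 1 \<le> c1 * sqrt (real n) / (t * w)" using t w by (simp add: pos_le_divide_eq)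
    then have "1 \<le> ln (c1 * sqrt (real n) / (t * w))"
      by (subst ln_ge_iff) (auto intro: less_le_trans[OF exp_gt_zero])
    then have "real n * 1 \<le> real n * ln (c1 * sqrt (real n) / (t * w))" by (intro mult_left_mono) auto
    then have "ereal (real n) \<le> ereal (real n * ln (c1 * sqrt (real n) / (t * w)))" by simp
    also note log[OF w]
    finally show "d_star n \<sigma> K t = ereal (real n)" unfolding d by (rule min_absorb2)
  qed
  then show ?thesis using c by blast
qed

end
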